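(* Let $(\mathcal{B},\|\cdot\|_{\mathcal{B}})$ be a separable Banach space, $k\in\mathbb{N}$, $C\subset\mathcal{B}$, and let $X$ be a random element taking values in $\mathcal{B}$ with probability distribution $\mathrm{P}$. Assume that $$\int_0^1\sqrt{\log\left(N(\varepsilon,C,d_{\mathcal{B}})\right)}\,d\varepsilon<\infty.$$ Then the class $\mathcal{F}_{V_k(C)}$ is a $\mathrm{P}$-Donsker class.
   Context: $d_{\mathcal{B}}$ is the metric induced by the norm of $\mathcal{B}$. For $\varepsilon>0$, $N(\varepsilon,C,d_{\mathcal{B}})$ is the $\varepsilon$-covering number of $C$: the minimal number of $d_{\mathcal{B}}$-balls of radius $\varepsilon$ (with centers in $\mathcal{B}$) required to cover $C$ (equal to $+\infty$ if no finite cover exists). $V_k(C)=\{(a_1,\dots,a_k)\in C^k: a_i\ne a_j\text{ for }i\ne j\}$. For $a=(a_1,\dots,a_k)\in V_k(C)$, the function $f_a:\mathcal{B}\to\mathbb{R}$ is $f_a(z)=\min_{i=1,\dots,k}\|z-a_i\|_{\mathcal{B}}^2$. The class is $\mathcal{F}_{V_k(C)}=\{f_a:a\in V_k(C)\}$. $\mathrm{P}(f)=\mathrm{E}_{\mathrm{P}}(f)$ denotes the expectation of $f$ under $\mathrm{P}$. For a class $\mathcal{F}$ of real functions, $\ell^\infty(\mathcal{F})$ is the real Banach space of bounded functionals $\phi:\mathcal{F}\to\mathbb{R}$ with the supremum norm $\|\phi\|_\infty=\sup_{f\in\mathcal{F}}|\phi(f)|$. With $X_1,X_2,\dots$ independent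 observations drawn from $X$, the $\mathcal{F}$-indexed empirical process is $\mathbb{G}_n(f)=n^{-1/2}\sum_{i=1}^n(f(X_i)-\mathrm{P}(f))$, $f\in\mathcal{F}$. The class $\mathcal{F}$ is $\mathrm{P}$-Donsker if $\mathbb{G}_n\rightsquigarrow\mathbb{G}_{\mathrm{P}}$ in $\ell^\infty(\mathcal{F})$, where $\rightsquigarrow$ denotes weak convergence and $\mathbb{G}_{\mathrm{P}}$ is a $\mathrm{P}$-Brownian bridge indexed by $\mathcal{F}$, that is, $\{\mathbb{G}_{\mathrm{P}}(f):f\in\mathcal{F}\}$ is a zero-mean Gaussian process with covariance function $\mathrm{Cov}(\mathbb{G}_{\mathrm{P}}(f_1),\mathbb{G}_{\mathrm{P}}(f_2))=\mathrm{P}(f_1f_2)-\mathrm{P}(f_1)\mathrm{P}(f_2)$ for $f_1,f_2\in\mathcal{F}$.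
   Formalization: The formal theorem additionally assumes that every f in F_{V_k(C)} is measurable with P(f²) finite; without this P(f) and the bridge covariance can be undefined, e.g. B = ℝ, k = 1, C = {0}, X Cauchy. *)

theory Defs
  imports "HOL-Probability.Probability"
begin

definition covering_number :: "real \<Rightarrow> 'b::metric_space set \<Rightarrow> enat" where
  "covering_number \<epsilon> C = Inf {enat (card S) | S. finite S \<and> C \<subseteq> (\<Union>x\<in>S. ball x \<epsilon>)}"

text \<open>\<open>sqrt (log N)\<close> with the value \<open>\<infinity>\<close> at \<open>N = \<infinity>\<close>.  The case \<open>N = 0\<close> arises only for the
  empty set, where the value is \<open>0\<close>.\<close>

definition sqrt_log :: "enat \<Rightarrow> ennreal" where
  "sqrt_log N = (case N of enat n \<Rightarrow> ennreal (sqrt (ln (real n))) | \<infinity> \<Rightarrow> \<infinity>)"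

definition distinct_tuples :: "nat \<Rightarrow> 'b set \<Rightarrow> (nat \<Rightarrow> 'b) set" where
  "distinct_tuples k C = {a \<in> {1..k} \<rightarrow>\<^sub>E C. inj_on a {1..k}}"

definition min_sq_dist :: "nat \<Rightarrow> (nat \<Rightarrow> 'b::real_normed_vector) \<Rightarrow> 'b \<Rightarrow> real" where
  "min_sq_dist k a z = (MIN i\<in>{1..k}. (norm (z - a i))\<^sup>2)"

definition min_sq_dist_class :: "nat \<Rightarrow> 'b::real_normed_vector set \<Rightarrow> ('b \<Rightarrow> real) set" where
  "min_sq_dist_class k C = min_sq_dist k ` distinct_tuples k C"

text \<open>Elements are bounded functions on \<open>F\<close>, represented extensionally, with the supremum
  distance; the two lemmas below spell this out.\<close>

definition linfty :: "'i set \<Rightarrow> ('i \<Rightarrow> real) metric" where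
  "linfty F = funspace F euclidean_metric"

lemma mspace_linfty: "mspace (linfty F) = {\<phi> \<in> extensional F. bounded (\<phi> ` F)}"
  by (auto simp: linfty_def Met_TC.fspace_def)

lemma mdist_linfty:
  assumes "\<phi> \<in> mspace (linfty F)" "\<psi> \<in> mspace (linfty F)" "F \<noteq> {}"
  shows "mdist (linfty F) \<phi> \<psi> = (SUP f\<in>F. \<bar>\<phi> f - \<psi> f\<bar>)"
  using assms by (simp add: linfty_def Met_TC.fdist_def dist_real_def)

definition metric_borel :: "'a metric \<Rightarrow> 'a measure" where
  "metric_borel m = sigma (mspace m) {U. openin (mtopology_of m) U}"

definition tight_measure :: "'a metric \<Rightarrow> 'a measure \<Rightarrow> bool" where
  "tight_measure m L \<longleftrightarrow>
     (\<forall>\<epsilon>>0. \<exists>K. compactin (mtopology_of m) K \<and> measure L K \<ge> 1 - \<epsilon>)"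

text \<open>Outer expectation of a bounded function on a probability space.\<close>

definition outer_expectation :: "'w measure \<Rightarrow> ('w \<Rightarrow> real) \<Rightarrow> real" where
  "outer_expectation M Z =
     Inf {integral\<^sup>L M U | U. integrable M U \<and> (\<forall>\<omega>\<in>space M. Z \<omega> \<le> U \<omega>)}"

text \<open>Weak convergence in the sense of Hoffmann-Jorgensen: the maps \<open>Y n\<close> on the probability
  space \<open>M\<close> need not be Borel measurable, the limit law \<open>L\<close> is a Borel probability measure.\<close>

definition weakly_converges_to ::
    "'w measure \<Rightarrow> 'a metric \<Rightarrow> (nat \<Rightarrow> 'w \<Rightarrow> 'a) \<Rightarrow> 'a measure \<Rightarrow> bool" where
  "weakly_converges_to M m Y L \<longleftrightarrow>
     (\<forall>n. \<forall>\<omega>\<in>space M. Y n \<omega> \<in> mspace m) \<and>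
     prob_space L \<and> sets L = sets (metric_borel m) \<and>
     (\<forall>h. continuous_map (mtopology_of m) euclideanreal h \<and> bounded (h ` mspace m) \<longrightarrow>
        (\<lambda>n. outer_expectation M (\<lambda>\<omega>. h (Y n \<omega>))) \<longlonglongrightarrow> integral\<^sup>L L h)"

text \<open>Degenerate (constant) Gaussian variables are included.\<close>

definition gaussian_rv :: "'w measure \<Rightarrow> ('w \<Rightarrow> real) \<Rightarrow> bool" where
  "gaussian_rv M Z \<longleftrightarrow> Z \<in> borel_measurable M \<and>
     (\<exists>\<mu> \<sigma>. (\<sigma> > 0 \<and> distributed M lborel Z (normal_density \<mu> \<sigma>)) \<or>
            (AE \<omega> in M. Z \<omega> = \<mu>))"

definition gaussian_process :: "'w measure \<Rightarrow> 'i set \<Rightarrow> ('i \<Rightarrow> 'w \<Rightarrow> real) \<Rightarrow> bool" where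
  "gaussian_process M I G \<longleftrightarrow>
     (\<forall>J c. finite J \<and> J \<subseteq> I \<longrightarrow> gaussian_rv M (\<lambda>\<omega>. \<Sum>i\<in>J. c i * G i \<omega>))"

definition brownian_bridge ::
    "'b measure \<Rightarrow> ('b \<Rightarrow> real) set \<Rightarrow> 'w measure \<Rightarrow> (('b \<Rightarrow> real) \<Rightarrow> 'w \<Rightarrow> real) \<Rightarrow> bool" where
  "brownian_bridge P F M G \<longleftrightarrow>
     gaussian_process M F G \<and>
     (\<forall>f\<in>F. integral\<^sup>L M (G f) = 0) \<and>
     (\<forall>f\<in>F. \<forall>g\<in>F.
        integral\<^sup>L M (\<lambda>\<omega>. (G f \<omega> - integral\<^sup>L M (G f)) * (G g \<omega> - integral\<^sup>L M (G g))) =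
        integral\<^sup>L P (\<lambda>x. f x * g x) - integral\<^sup>L P f * integral\<^sup>L P g)"

definition empirical_process ::
    "'b measure \<Rightarrow> ('b \<Rightarrow> real) set \<Rightarrow> nat \<Rightarrow> (nat \<Rightarrow> 'b) \<Rightarrow> ('b \<Rightarrow> real) \<Rightarrow> real" where
  "empirical_process P F n x =
     (\<lambda>f\<in>F. (\<Sum>i<n. f (x i) - integral\<^sup>L P f) / sqrt (real n))"

text \<open>The mean and covariance of the bridge only make sense for functions in \<open>L\<^sup>2(P)\<close>;
  for others the Bochner integral would silently be \<open>0\<close>.\<close>

definition square_integrable_class :: "'b measure \<Rightarrow> ('b \<Rightarrow> real) set \<Rightarrow> bool" where
  "square_integrable_class P F \<longleftrightarrow>
     (\<forall>f\<in>F. f \<in> borel_measurable P \<and> integrable P (\<lambda>x. (f x)\<^sup>2))"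

text \<open>As usual, the observations are the coordinate projections of the infinite product space,
  and the bridge is a tight Borel random element of \<open>\<ell>\<^sup>\<infinity>(F)\<close>; it is represented by its law \<open>L\<close>,
  under which the evaluations \<open>\<phi> \<mapsto> \<phi> f\<close> form the process.\<close>

definition Donsker :: "'b measure \<Rightarrow> ('b \<Rightarrow> real) set \<Rightarrow> bool" where
  "Donsker P F \<longleftrightarrow>
     square_integrable_class P F \<and>
     (\<exists>L. tight_measure (linfty F) L \<and>
          brownian_bridge P F L (\<lambda>f \<phi>. \<phi> f) \<and>
          weakly_converges_to (Pi\<^sub>M UNIV (\<lambda>_::nat. P)) (linfty F) (empirical_process P F) L)"

end

theory Submission
  imports Defs
begin

text \<open>
  Write the empirical process as \<open>G\<^sub>n\<close>. Functions in the class depend on the centres in a Lipschitz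
  way: moving the centres by at most \<open>\<delta>\<close> changes the function at \<open>z\<close> by at most
  \<open>\<delta> (2 \<parallel>z\<parallel> + 2 R)\<close>, where \<open>R\<close> bounds the norms in \<open>C\<close>, and this envelope is square integrable. Hence
  dyadic nets of \<open>C\<close> give finite approximations \<open>proj m\<close> of the class with error \<open>2\<^sup>-\<^sup>m\<close> times the
  envelope. Symmetrization, a Rademacher maximal inequality and chaining bound the expected supremum
  of \<open>G\<^sub>n - G\<^sub>n \<circ> proj m\<close> by the tail of the entropy sum, uniformly in \<open>n\<close>, so only the
  finite-dimensional processes \<open>G\<^sub>n \<circ> proj m\<close> matter for the limit.

  Their limits come from a Gaussian sequence \<open>gau\<close> built from independent standard normal variables by
  a Cholesky factorization of the covariance kernel. The chaining bound passes to this sequence, so the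
  finite-dimensional Gaussian processes converge uniformly almost surely, and the law of the
  limit is the tight limit law. That it is a Brownian bridge need not be tracked through the
  construction: linear functionals are continuous, so the weak convergence and the one-dimensional
  central limit theorem identify their laws.
\<close>

section \<open>Convergence of finite-dimensional distributions\<close>

text \<open>\<open>linfty F\<close> is in general not separable and the empirical process need not
  be Borel measurable in it, so no supremum over the whole class is ever integrated. Instead,
  \<open>jump\<close> is a maximum over finitely many pairs, and what remains beyond level
  \<open>j\<close> is dominated pointwise by \<open>(1/2) ^ j * total n\<close>. This majorant grows
  with \<open>n\<close>, but \<open>j\<close> tends to infinity while \<open>n\<close> is fixed,
  which removes it. Finitely many coordinates are tested on cosines of affine functionals only, so
  the central limit theorem is needed just in dimension one; uniform second moments play the part of
  tightness. The Gaussian sequence needs no maximal inequality of its own: the distance of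
  consecutive approximations, cut off at 1, is a bounded Lipschitz function of finitely many
  coordinates, so its mean inherits the bound \<open>rate\<close> from the empirical process. Square
  integrability of the class serves twice: it gives meaning to the covariance, and since one member
  of the class already controls the square of \<open>norm z\<close>, it makes the envelope square
  integrable.\<close>

inductive_set trigs :: "nat set \<Rightarrow> ((nat \<Rightarrow> real) \<Rightarrow> real) set" for I where
  trigs_cos: "(\<lambda>x. cos ((\<Sum>i\<in>I. u i * x i) + c)) \<in> trigs I"
| trigs_add: "p \<in> trigs I \<Longrightarrow> q \<in> trigs I \<Longrightarrow> (\<lambda>x. p x + q x) \<in> trigs I"
| trigs_scale: "p \<in> trigs I \<Longrightarrow> (\<lambda>x. b * p x) \<in> trigs I"

lemma trigs_const: "(\<lambda>_. c) \<in> trigs I"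
  using trigs_scale[OF trigs_cos[where u="\<lambda>_. 0" and c=0], of c] by simp

lemma trigs_sin:
  assumes "finite I" "i \<in> I"
  shows "(\<lambda>x. r * sin (x i / r)) \<in> trigs I"
proof -
  have "(\<Sum>j\<in>I. (if j = i then 1 / r else 0) * x j) = x i / r" for x :: "nat \<Rightarrow> real"
  proof -
    have "(\<Sum>j\<in>I. (if j = i then 1 / r else 0) * x j) = (\<Sum>j\<in>I. if j = i then x j / r else 0)"
      by (rule sum.cong) auto
    then show ?thesis using assms by simp
  qed
  then show ?thesis
    using trigs_scale[OF trigs_cos[where I=I and u="\<lambda>j. if j = i then 1 / r else 0" and c="- (pi / 2)"], of r]
    by (simp add: cos_diff)
qed

text \<open>The product-to-sum formula is what turns \<open>trigs\<close>, generated by sums and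
  scalings alone, into an algebra.\<close>

lemma trigs_cos_mult:
  assumes "q \<in> trigs I"
  shows "(\<lambda>x. cos ((\<Sum>i\<in>I. u i * x i) + c) * q x) \<in> trigs I"
  using assms
proof (induction rule: trigs.induct)
  case (trigs_cos v d)
  have "cos ((\<Sum>i\<in>I. u i * x i) + c) * cos ((\<Sum>i\<in>I. v i * x i) + d) =
     1/2 * cos ((\<Sum>i\<in>I. (u i - v i) * x i) + (c - d)) +
     1/2 * cos ((\<Sum>i\<in>I. (u i + v i) * x i) + (c + d))" for x
  proof -
    have *: "cos A * cos B = 1/2 * cos (A - B) + 1/2 * cos (A + B)" for A B :: real
      by (simp add: cos_diff cos_add field_simps)
    have "((\<Sum>i\<in>I. u i * x i) + c) - ((\<Sum>i\<in>I. v i * x i) + d) =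
        (\<Sum>i\<in>I. (u i - v i) * x i) + (c - d)"
      by (simp add: left_diff_distrib sum_subtractf)
    moreover have "((\<Sum>i\<in>I. u i * x i) + c) + ((\<Sum>i\<in>I. v i * x i) + d) =
        (\<Sum>i\<in>I. (u i + v i) * x i) + (c + d)"
      by (simp add: distrib_right sum.distrib)
    ultimately show ?thesis by (simp only: *)
  qed
  then show ?case
    using trigs_add[OF trigs_scale[OF trigs.trigs_cos[where u="\<lambda>i. u i - v i" and c="c - d"], of "1/2"]
      trigs_scale[OF trigs.trigs_cos[where u="\<lambda>i. u i + v i" and c="c + d"], of "1/2"]] by simp
next
  case (trigs_add p q)
  then show ?case by (simp add: distrib_left trigs.trigs_add)
next
  case (trigs_scale p b)
  then show ?case using trigs.trigs_scale[OF trigs_scale.IH, of b]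
    by (simp add: mult.left_commute)
qed

lemma trigs_mult:
  assumes "p \<in> trigs I" "q \<in> trigs I"
  shows "(\<lambda>x. p x * q x) \<in> trigs I"
  using assms
proof (induction rule: trigs.induct)
  case (trigs_cos v d)
  then show ?case by (rule trigs_cos_mult)
next
  case (trigs_add p q)
  then show ?case by (simp add: distrib_right trigs.trigs_add)
next
  case (trigs_scale p b)
  then show ?case using trigs.trigs_scale[OF trigs_scale.IH, of b]
    by (simp add: mult.assoc)
qed

text \<open>The map \<open>T\<close> sends the whole space into the compact cube \<open>S\<close>,
  so Stone-Weierstrass on \<open>S\<close> gives an approximation that is uniform in every
  \<open>x\<close>, without any periodicity or decay of \<open>g\<close>.\<close>

lemma trigs_approx:
  fixes g :: "(nat \<Rightarrow> real) \<Rightarrow> real"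
  assumes "finite I" "continuous_on UNIV g" "r > 0" "e > 0"
  shows "\<exists>p\<in>trigs I. \<forall>x. \<bar>g (\<lambda>i. if i \<in> I then r * sin (x i / r) else 0) - p x\<bar> < e"
proof -
  \<comment> \<open>Freezing the coordinates outside \<open>I\<close> at 0 keeps \<open>S\<close>
    compact and ensures that distinct points of \<open>S\<close> differ in a coordinate of
    \<open>I\<close>, where \<open>A\<close> can separate them.\<close>
  define S where "S = PiE UNIV (\<lambda>i::nat. if i \<in> I then {-r..r} else {0})"
  define T where "T x = (\<lambda>i. if i \<in> I then r * sin (x i / r) else 0)" for x :: "nat \<Rightarrow> real"
  \<comment> \<open>Only the composite with \<open>T\<close> has to be a trigonometric polynomial:
    the plain coordinate \<open>x i\<close> qualifies because its composite is
    \<open>r * sin (x i / r)\<close>.\<close>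
  define A where "A = {q. continuous_on S q \<and> (\<lambda>x. q (T x)) \<in> trigs I}"
  have "compactin (product_topology (\<lambda>_. euclidean) UNIV) S"
    unfolding S_def by (subst compactin_PiE) auto
  then have S: "compact S"
    by (metis compactin_euclidean_iff euclidean_product_topology)
  have coord: "\<exists>f\<in>A. f x \<noteq> f y" if "x \<in> S" "y \<in> S" "x \<noteq> y" for x y
  proof -
    obtain i where i: "x i \<noteq> y i" using \<open>x \<noteq> y\<close> by (meson ext)
    moreover have "i \<in> I"
    proof (rule ccontr)
      assume "i \<notin> I"
      then show False
        using PiE_mem[OF that(1)[unfolded S_def], of i] PiE_mem[OF that(2)[unfolded S_def], of i] i by simp
    qed
    moreover have "(\<lambda>x. x i) \<in> A" using \<open>i \<in> I\<close> trigs_sin[OF \<open>finite I\<close> \<open>i \<in> I\<close>]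
      by (auto simp: A_def T_def intro: continuous_on_subset[OF continuous_on_product_coordinates])
    ultimately show ?thesis by (intro bexI[of _ "\<lambda>x. x i"])
  qed
  interpret function_ring_on A S
  proof
    fix f g assume "f \<in> A" "g \<in> A"
    then show "(\<lambda>x. f x + g x) \<in> A" "(\<lambda>x. f x * g x) \<in> A"
      by (auto simp: A_def intro: continuous_on_add continuous_on_mult trigs_add trigs_mult)
  qed (use S coord in \<open>auto simp: A_def trigs_const\<close>)
  obtain q where q: "q \<in> A" "\<forall>x\<in>S. \<bar>g x - q x\<bar> < e"
    using Stone_Weierstrass_basic[of g e] assms continuous_on_subset[of UNIV g S] by auto
  have "T x \<in> S" for x
  proof -
    have "\<bar>r * sin (x i / r)\<bar> \<le> r" for i
      using \<open>r > 0\<close> by (simp add: abs_mult mult_left_le)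
    then have "r * sin (x i / r) \<in> {-r..r}" for i
      unfolding abs_le_iff atLeastAtMost_iff by (metis minus_le_iff)
    then show ?thesis by (simp add: S_def T_def PiE_iff)
  qed
  then show ?thesis
    using q by (intro bexI[of _ "\<lambda>x. q (T x)"]) (auto simp: A_def T_def[symmetric])
qed

text \<open>The Taylor error is taken quadratic rather than cubic because the coordinates to which
  this is applied have controlled second moments only.\<close>

lemma abs_diff_scaled_sin_le:
  fixes y r :: real
  assumes "r > 0"
  shows "\<bar>y - r * sin (y / r)\<bar> \<le> y\<^sup>2 / r"
proof -
  have "\<bar>sin (y / r) - y / r\<bar> \<le> (y / r)\<^sup>2 / 2"
    using Maclaurin_sin_bound[of "y / r" 2] by (simp add: numeral_2_eq_2 sin_coeff_def inverse_eq_divide)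
  then have "r * \<bar>sin (y / r) - y / r\<bar> \<le> r * ((y / r)\<^sup>2 / 2)"
    using assms by (intro mult_left_mono) auto
  also have "r * \<bar>sin (y / r) - y / r\<bar> = \<bar>y - r * sin (y / r)\<bar>"
    using assms by (subst abs_of_pos[OF \<open>r > 0\<close>, symmetric], subst abs_mult[symmetric])
      (simp add: right_diff_distrib abs_minus_commute)
  also have "r * ((y / r)\<^sup>2 / 2) = y\<^sup>2 / r / 2"
    using assms by (simp add: power2_eq_square)
  also have "y\<^sup>2 / r / 2 \<le> y\<^sup>2 / r"
  proof -
    have "a / 2 \<le> a" if "a \<ge> 0" for a :: real using that by simp
    from this[of "y\<^sup>2 / r"] show ?thesis using assms by simp
  qed
  finally show ?thesis .
qed

lemma trigs_integrable:
  assumes "p \<in> trigs I" "prob_space M" "\<And>i. i \<in> I \<Longrightarrow> (\<lambda>\<omega>. Y \<omega> i) \<in> borel_measurable M"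
  shows "integrable M (\<lambda>\<omega>. p (Y \<omega>))"
  using assms(1)
proof (induction rule: trigs.induct)
  case (trigs_cos u c)
  interpret prob_space M by fact
  show ?case
    using assms(3) by (intro integrable_const_bound[where B=1]) auto
qed auto

lemma trigs_convergence:
  fixes Y :: "nat \<Rightarrow> 'w \<Rightarrow> nat \<Rightarrow> real" and Z :: "'v \<Rightarrow> nat \<Rightarrow> real"
  assumes M: "prob_space M" and N: "prob_space N"
    and Y: "\<And>n i. i \<in> I \<Longrightarrow> (\<lambda>\<omega>. Y n \<omega> i) \<in> borel_measurable M"
    and Z: "\<And>i. i \<in> I \<Longrightarrow> (\<lambda>\<omega>. Z \<omega> i) \<in> borel_measurable N"
    and conv: "\<And>u c. (\<lambda>n. \<integral>\<omega>. cos ((\<Sum>i\<in>I. u i * Y n \<omega> i) + c) \<partial>M)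
                 \<longlonglongrightarrow> (\<integral>\<omega>. cos ((\<Sum>i\<in>I. u i * Z \<omega> i) + c) \<partial>N)"
    and p: "p \<in> trigs I"
  shows "(\<lambda>n. \<integral>\<omega>. p (Y n \<omega>) \<partial>M) \<longlonglongrightarrow> (\<integral>\<omega>. p (Z \<omega>) \<partial>N)"
  using p
proof (induction rule: trigs.induct)
  case (trigs_cos u c)
  then show ?case by (rule conv)
next
  case (trigs_add p q)
  have "integrable M (\<lambda>\<omega>. h (Y n \<omega>))" "integrable N (\<lambda>\<omega>. h (Z \<omega>))" if "h \<in> trigs I" for h n
    using trigs_integrable[OF that M, of "Y n"] trigs_integrable[OF that N, of Z] Y Z by auto
  then show ?case
    using tendsto_add[OF trigs_add.IH] trigs_add.hyps by simp
next
  case (trigs_scale p b)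
  then show ?case by (simp add: tendsto_mult_left)
qed

text \<open>The substitution \<open>x \<mapsto> r sin (x / r)\<close> turns a Lipschitz function into one that is uniformly
  close to a trigonometric polynomial, at a cost of order \<open>E x\<^sup>2 / r\<close>.\<close>

lemma integral_lipschitz_truncation:
  assumes M: "prob_space M" and "finite I" "r > 0" "L \<ge> 0"
    and Y: "\<And>i. i \<in> I \<Longrightarrow> (\<lambda>\<omega>. Y \<omega> i) \<in> borel_measurable M"
    and Y2: "\<And>i. i \<in> I \<Longrightarrow> integrable M (\<lambda>\<omega>. (Y \<omega> i)\<^sup>2)"
    and B: "\<And>i. i \<in> I \<Longrightarrow> (\<integral>\<omega>. (Y \<omega> i)\<^sup>2 \<partial>M) \<le> B"
    and lip: "\<And>x y. \<bar>g x - g y\<bar> \<le> L * (\<Sum>i\<in>I. \<bar>x i - y i\<bar>)"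
    and gM: "integrable M (\<lambda>\<omega>. g (Y \<omega>))"
    and p: "p \<in> trigs I" "\<And>x. \<bar>g (\<lambda>i. if i \<in> I then r * sin (x i / r) else 0) - p x\<bar> < e"
  shows "\<bar>(\<integral>\<omega>. g (Y \<omega>) \<partial>M) - (\<integral>\<omega>. p (Y \<omega>) \<partial>M)\<bar> \<le> e + L * (real (card I) * B / r)"
proof -
  interpret prob_space M by fact
  have pM: "integrable M (\<lambda>\<omega>. p (Y \<omega>))"
    using trigs_integrable[OF p(1) M, of Y] Y by auto
  have pt: "\<bar>g (Y \<omega>) - p (Y \<omega>)\<bar> \<le> e + L * (\<Sum>i\<in>I. (Y \<omega> i)\<^sup>2 / r)" for \<omega>
  proof -
    have "\<bar>g (Y \<omega>) - g (\<lambda>i. if i \<in> I then r * sin (Y \<omega> i / r) else 0)\<bar>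
      \<le> L * (\<Sum>i\<in>I. \<bar>Y \<omega> i - r * sin (Y \<omega> i / r)\<bar>)"
      by (rule order_trans[OF lip]) (use \<open>L \<ge> 0\<close> in \<open>auto intro!: mult_left_mono sum_mono\<close>)
    also have "\<dots> \<le> L * (\<Sum>i\<in>I. (Y \<omega> i)\<^sup>2 / r)"
      using \<open>L \<ge> 0\<close> \<open>r > 0\<close> by (intro mult_left_mono sum_mono abs_diff_scaled_sin_le) auto
    finally show ?thesis using p(2)[of "Y \<omega>"] by linarith
  qed
  have "\<bar>(\<integral>\<omega>. g (Y \<omega>) \<partial>M) - (\<integral>\<omega>. p (Y \<omega>) \<partial>M)\<bar> \<le> (\<integral>\<omega>. \<bar>g (Y \<omega>) - p (Y \<omega>)\<bar> \<partial>M)"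
    unfolding Bochner_Integration.integral_diff[OF gM pM, symmetric] by (rule integral_abs_bound)
  also have "\<dots> \<le> (\<integral>\<omega>. e + L * (\<Sum>i\<in>I. (Y \<omega> i)\<^sup>2 / r) \<partial>M)"
    using gM pM Y2 by (intro integral_mono pt) auto
  also have "\<dots> = e + L * (\<Sum>i\<in>I. (\<integral>\<omega>. (Y \<omega> i)\<^sup>2 \<partial>M) / r)"
    using Y2 by (subst Bochner_Integration.integral_add) (auto simp: prob_space)
  also have "\<dots> \<le> e + L * (\<Sum>i\<in>I. B / r)"
    using B \<open>L \<ge> 0\<close> \<open>r > 0\<close> by (intro add_mono mult_left_mono sum_mono divide_right_mono) auto
  finally show ?thesis by simp
qed

lemma lipschitz_coordinates_measurable:
  fixes g :: "(nat \<Rightarrow> real) \<Rightarrow> real"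
  assumes "finite I" and lip: "\<And>x y. \<bar>g x - g y\<bar> \<le> L * (\<Sum>i\<in>I. \<bar>x i - y i\<bar>)"
  shows "continuous_on UNIV g"
    and "(\<And>i. i \<in> I \<Longrightarrow> (\<lambda>\<omega>. Y \<omega> i) \<in> borel_measurable M) \<Longrightarrow> (\<lambda>\<omega>. g (Y \<omega>)) \<in> borel_measurable M"
proof -
  show cont: "continuous_on UNIV g"
  proof -
    have "isCont g x" for x
    proof -
      have "((\<lambda>y. L * (\<Sum>i\<in>I. \<bar>y i - x i\<bar>)) \<longlongrightarrow> L * (\<Sum>i\<in>I. \<bar>x i - x i\<bar>)) (at x)"
        by (intro tendsto_intros tendsto_sum)
           (metis UNIV_I continuous_on_def continuous_on_product_coordinates)
      then have "((\<lambda>y. L * (\<Sum>i\<in>I. \<bar>y i - x i\<bar>)) \<longlongrightarrow> 0) (at x)"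
        by simp
      moreover have "\<forall>\<^sub>F y in at x. norm (g y - g x) \<le> L * (\<Sum>i\<in>I. \<bar>y i - x i\<bar>)"
        by (rule always_eventually) (simp only: real_norm_def lip simp_thms)
      ultimately have "((\<lambda>y. g y - g x) \<longlongrightarrow> 0) (at x)"
        by (rule Lim_null_comparison[rotated])
      then show ?thesis by (simp add: isCont_def LIM_zero_iff)
    qed
    then show ?thesis by (simp add: continuous_at_imp_continuous_on)
  qed
  assume Y: "\<And>i. i \<in> I \<Longrightarrow> (\<lambda>\<omega>. Y \<omega> i) \<in> borel_measurable M"
  \<comment> \<open>For these two arguments the Lipschitz bound is a sum of zeros: \<open>g\<close>
    sees only the coordinates in \<open>I\<close>, so measurability is required of those
    alone.\<close>
  have "g (Y \<omega>) = g (\<lambda>i. if i \<in> I then Y \<omega> i else 0)" for \<omega>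
    using lip[of "Y \<omega>" "\<lambda>i. if i \<in> I then Y \<omega> i else 0"] by simp
  moreover have "(\<lambda>\<omega>. (\<lambda>i. if i \<in> I then Y \<omega> i else 0)) \<in> borel_measurable M"
  proof (rule measurable_coordinatewise_then_product)
    show "(\<lambda>\<omega>. if i \<in> I then Y \<omega> i else 0) \<in> borel_measurable M" for i
      using Y by (cases "i \<in> I") auto
  qed
  ultimately show "(\<lambda>\<omega>. g (Y \<omega>)) \<in> borel_measurable M"
    using measurable_compose[OF _ borel_measurable_continuous_onI[OF cont]] by simp
qed

text \<open>A form of the Cramer-Wold device. The bound \<open>B\<close> makes the truncation error
  uniform in \<open>n\<close>; after truncation \<open>g\<close> is replaced by a trigonometric
  polynomial, whose means converge by \<open>conv\<close> and linearity.\<close>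

lemma finite_dimensional_convergence:
  fixes Y :: "nat \<Rightarrow> 'w \<Rightarrow> nat \<Rightarrow> real" and Z :: "'v \<Rightarrow> nat \<Rightarrow> real"
  assumes M: "prob_space M" and N: "prob_space N" and "finite I"
    and Y: "\<And>n i. i \<in> I \<Longrightarrow> (\<lambda>\<omega>. Y n \<omega> i) \<in> borel_measurable M"
    and Z: "\<And>i. i \<in> I \<Longrightarrow> (\<lambda>\<omega>. Z \<omega> i) \<in> borel_measurable N"
    and Y2: "\<And>n i. i \<in> I \<Longrightarrow> integrable M (\<lambda>\<omega>. (Y n \<omega> i)\<^sup>2)"
    and Z2: "\<And>i. i \<in> I \<Longrightarrow> integrable N (\<lambda>\<omega>. (Z \<omega> i)\<^sup>2)"
    and BY: "\<And>n i. i \<in> I \<Longrightarrow> (\<integral>\<omega>. (Y n \<omega> i)\<^sup>2 \<partial>M) \<le> B"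
    and BZ: "\<And>i. i \<in> I \<Longrightarrow> (\<integral>\<omega>. (Z \<omega> i)\<^sup>2 \<partial>N) \<le> B"
    and conv: "\<And>u c. (\<lambda>n. \<integral>\<omega>. cos ((\<Sum>i\<in>I. u i * Y n \<omega> i) + c) \<partial>M)
                 \<longlonglongrightarrow> (\<integral>\<omega>. cos ((\<Sum>i\<in>I. u i * Z \<omega> i) + c) \<partial>N)"
    and lip: "\<And>x y. \<bar>g x - g y\<bar> \<le> L * (\<Sum>i\<in>I. \<bar>x i - y i\<bar>)" and "L \<ge> 0"
    and bnd: "\<And>x. \<bar>g x\<bar> \<le> b"
  shows "(\<lambda>n. \<integral>\<omega>. g (Y n \<omega>) \<partial>M) \<longlonglongrightarrow> (\<integral>\<omega>. g (Z \<omega>) \<partial>N)"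
proof (rule LIMSEQ_I)
  fix e :: real assume "e > 0"
  interpret M: prob_space M by fact
  interpret N: prob_space N by fact
  have gY: "integrable M (\<lambda>\<omega>. g (Y n \<omega>))" for n
    by (rule M.integrable_const_bound[where B=b])
       (use bnd lipschitz_coordinates_measurable(2)[OF \<open>finite I\<close> lip Y] in auto)
  have gZ: "integrable N (\<lambda>\<omega>. g (Z \<omega>))"
    by (rule N.integrable_const_bound[where B=b])
       (use bnd lipschitz_coordinates_measurable(2)[OF \<open>finite I\<close> lip Z] in auto)
  \<comment> \<open>Chosen so that the truncation error is at most \<open>e / 8\<close>; the summand
    1 keeps \<open>r\<close> positive when \<open>L\<close>, \<open>B\<close> or
    \<open>card I\<close> vanishes. With another \<open>e / 8\<close> for the polynomial, the three
    errors below are \<open>e / 4\<close> each.\<close>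
  define r where "r = (L * card I * \<bar>B\<bar> + 1) / (e / 8)"
  have r: "r > 0" using \<open>e > 0\<close> \<open>L \<ge> 0\<close> unfolding r_def by (intro divide_pos_pos add_nonneg_pos) auto
  have "L * (real (card I) * B / r) \<le> (L * card I * \<bar>B\<bar>) / r"
  proof -
    have "L * real (card I) * B \<le> L * real (card I) * \<bar>B\<bar>"
      using \<open>L \<ge> 0\<close> by (intro mult_left_mono) auto
    then show ?thesis using r by (simp add: divide_right_mono mult.assoc)
  qed
  also have "\<dots> \<le> (L * card I * \<bar>B\<bar> + 1) / r" using r by (simp add: divide_right_mono)
  also have "\<dots> = e / 8" using r \<open>e > 0\<close> by (simp add: r_def field_simps)
  finally have small: "e / 8 + L * (real (card I) * B / r) \<le> e / 4" by linarith
  obtain p where p: "p \<in> trigs I"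
    "\<And>x. \<bar>g (\<lambda>i. if i \<in> I then r * sin (x i / r) else 0) - p x\<bar> < e / 8"
    using trigs_approx[OF \<open>finite I\<close> lipschitz_coordinates_measurable(1)[OF \<open>finite I\<close> lip] r, of "e/8"]
      \<open>e > 0\<close> by auto
  have 1: "\<bar>(\<integral>\<omega>. g (Y n \<omega>) \<partial>M) - (\<integral>\<omega>. p (Y n \<omega>) \<partial>M)\<bar> \<le> e / 4" for n
    by (rule order_trans[OF integral_lipschitz_truncation[OF M \<open>finite I\<close> r \<open>L \<ge> 0\<close> Y Y2 BY lip gY p] small])
  have 2: "\<bar>(\<integral>\<omega>. g (Z \<omega>) \<partial>N) - (\<integral>\<omega>. p (Z \<omega>) \<partial>N)\<bar> \<le> e / 4"
    by (rule order_trans[OF integral_lipschitz_truncation[OF N \<open>finite I\<close> r \<open>L \<ge> 0\<close> Z Z2 BZ lip gZ p] small])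
  obtain n0 where n0: "\<And>n. n \<ge> n0 \<Longrightarrow> \<bar>(\<integral>\<omega>. p (Y n \<omega>) \<partial>M) - (\<integral>\<omega>. p (Z \<omega>) \<partial>N)\<bar> < e / 4"
    using LIMSEQ_D[OF trigs_convergence[where Y=Y and Z=Z, OF M N Y Z conv p(1)], of "e/4"] \<open>e > 0\<close> by auto
  show "\<exists>no. \<forall>n\<ge>no. norm ((\<integral>\<omega>. g (Y n \<omega>) \<partial>M) - (\<integral>\<omega>. g (Z \<omega>) \<partial>N)) < e"
  proof (intro exI allI impI)
    fix n assume "n \<ge> n0"
    then show "norm ((\<integral>\<omega>. g (Y n \<omega>) \<partial>M) - (\<integral>\<omega>. g (Z \<omega>) \<partial>N)) < e"
      using 1[of n] 2 n0[of n] \<open>e > 0\<close> unfolding real_norm_def by linarith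
  qed
qed

section \<open>A maximal inequality for empirical sums\<close>

lemma cosh_le_exp_half_square:
  fixes x :: real
  shows "exp x + exp (- x) \<le> 2 * exp (x\<^sup>2 / 2)"
proof -
  have *: "exp x + exp (- x) \<le> 2 * exp (x\<^sup>2 / 2)" if "x \<ge> 0" for x :: real
  proof -
    have pos: "1 + 1/2 * (exp (2 * x) - 1) > 0" by (simp add: add_pos_pos algebra_simps)
    \<comment> \<open>The inequality behind Hoeffding's lemma for a fair coin and step
      \<open>2 * x\<close>: its quadratic term, one eighth of the squared step, is
      \<open>x\<^sup>2 / 2\<close>. Multiplying by \<open>exp (- x)\<close> then centres the
      coin.\<close>
    have "ln (1 + 1/2 * (exp (2 * x) - 1)) \<le> x\<^sup>2 / 2 + x"
      using Hoeffdings_lemma_aux[of "2 * x" "1/2"] that by (simp add: power2_eq_square)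
    then have "1 + 1/2 * (exp (2 * x) - 1) \<le> exp (x\<^sup>2 / 2 + x)"
      using pos by (metis exp_le_cancel_iff exp_ln)
    then have "exp (- x) * (1 + 1/2 * (exp (2 * x) - 1)) \<le> exp (- x) * exp (x\<^sup>2 / 2 + x)"
      by (intro mult_left_mono) auto
    also have "exp (- x) * exp (x\<^sup>2 / 2 + x) = exp (x\<^sup>2 / 2)"
      by (simp add: exp_add[symmetric])
    also have "exp (- x) * (1 + 1/2 * (exp (2 * x) - 1)) = (exp x + exp (- x)) / 2"
      using exp_add[of "- x" "2 * x"] by (simp add: algebra_simps)
    finally show ?thesis by simp
  qed
  show ?thesis using *[of x] *[of "- x"] by (cases "x \<ge> 0") auto
qed

text \<open>The constant \<open>k\<close> will be a non-random bound on the total exponential moment, which avoids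
  Jensen's inequality for the logarithm.\<close>

lemma Max_abs_le_exp_sum:
  fixes D :: "'j \<Rightarrow> real"
  assumes "finite J" "J \<noteq> {}" "l > 0" "k > 0"
  shows "l * Max ((\<lambda>j. \<bar>D j\<bar>) ` J) \<le> (\<Sum>j\<in>J. exp (l * D j) + exp (- (l * D j))) / k + ln k - 1"
proof -
  have "Max ((\<lambda>j. \<bar>D j\<bar>) ` J) \<in> (\<lambda>j. \<bar>D j\<bar>) ` J"
    using assms by (intro Max_in) auto
  then obtain i where i: "i \<in> J" and m: "Max ((\<lambda>j. \<bar>D j\<bar>) ` J) = \<bar>D i\<bar>" by auto
  define w where "w = exp (l * \<bar>D i\<bar>)"
  have "ln (w / k) \<le> w / k - 1"
    using assms by (intro ln_le_minus_one) (simp add: w_def)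
  then have "l * \<bar>D i\<bar> \<le> w / k + ln k - 1"
    using assms by (simp add: ln_div w_def)
  also have "w \<le> exp (l * D i) + exp (- (l * D i))"
    by (cases "D i \<ge> 0") (simp_all add: w_def add_increasing add_increasing2)
  also have "\<dots> \<le> (\<Sum>j\<in>J. exp (l * D j) + exp (- (l * D j)))"
    using i assms by (intro member_le_sum) (auto intro: add_nonneg_nonneg)
  finally show ?thesis using assms m by (simp add: divide_right_mono)
qed

text \<open>Expectation over random signs is written as a sum over all \<open>2 ^ n\<close> sign
  vectors, so independence of the signs is just the distributive law
  \<open>prod_sum_PiE\<close>.\<close>

lemma rademacher_exp_sum:
  fixes d :: "nat \<Rightarrow> real"
  shows "(\<Sum>s\<in>PiE {..<n} (\<lambda>_. {-1, 1}). exp (l * (\<Sum>i<n. s i * d i)))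
    \<le> 2 ^ n * exp (l\<^sup>2 * (\<Sum>i<n. (d i)\<^sup>2) / 2)"
proof -
  have "(\<Sum>s\<in>PiE {..<n} (\<lambda>_. {-1, 1}). exp (l * (\<Sum>i<n. s i * d i)))
    = (\<Sum>s\<in>PiE {..<n} (\<lambda>_. {-1, 1}). \<Prod>i<n. exp (l * (s i * d i)))"
    by (simp add: sum_distrib_left exp_sum)
  also have "\<dots> = (\<Prod>i<n. \<Sum>e\<in>{-1, 1}. exp (l * (e * d i)))"
    by (rule prod_sum_PiE[symmetric]) auto
  also have "\<dots> = (\<Prod>i<n. exp (l * d i) + exp (- (l * d i)))"
    by (simp add: add.commute)
  also have "\<dots> \<le> (\<Prod>i<n. 2 * exp ((l * d i)\<^sup>2 / 2))"
    by (intro prod_mono) (auto intro: cosh_le_exp_half_square add_nonneg_nonneg)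
  also have "\<dots> = 2 ^ n * exp (\<Sum>i<n. (l * d i)\<^sup>2 / 2)"
    by (simp add: prod.distrib exp_sum)
  also have "(\<Sum>i<n. (l * d i)\<^sup>2 / 2) = l\<^sup>2 * (\<Sum>i<n. (d i)\<^sup>2) / 2"
    by (simp add: power_mult_distrib sum_distrib_left sum_divide_distrib)
  finally show ?thesis .
qed

lemma rademacher_maximal:
  fixes d :: "'j \<Rightarrow> nat \<Rightarrow> real"
  assumes J: "finite J" "J \<noteq> {}" and "l > 0" and V: "\<And>j. j \<in> J \<Longrightarrow> (\<Sum>i<n. (d j i)\<^sup>2) \<le> V"
  shows "(\<Sum>s\<in>PiE {..<n} (\<lambda>_. {-1, 1}). Max ((\<lambda>j. \<bar>\<Sum>i<n. s i * d j i\<bar>) ` J))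
    \<le> 2 ^ n * (l * V / 2 + ln (2 * card J) / l)"
proof -
  define S where "S = PiE {..<n} (\<lambda>_. {-1, 1::real})"
  \<comment> \<open>Bounds the sign average of the total exponential moment. The first term of
    \<open>Max_abs_le_exp_sum\<close> then averages to at most 1, which cancels the
    \<open>- 1\<close> and leaves \<open>ln k\<close>.\<close>
  define k where "k = 2 * card J * exp (l\<^sup>2 * V / 2)"
  have cJ: "real (card J) > 0" using J by (simp add: card_gt_0_iff)
  have k: "k > 0" using cJ by (simp add: k_def)
  have cS: "real (card S) = 2 ^ n" by (simp add: S_def card_PiE)
  have lnk: "ln k = ln (2 * card J) + l\<^sup>2 * V / 2"
    using cJ unfolding k_def by (subst ln_mult) auto
  have le: "(\<Sum>s\<in>S. exp (l * (\<Sum>i<n. s i * d j i))) \<le> 2 ^ n * exp (l\<^sup>2 * V / 2)"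
    if "j \<in> J" for j l
    using V[OF that] unfolding S_def
    by (intro order_trans[OF rademacher_exp_sum]) (auto intro!: mult_left_mono)
  have "l * (\<Sum>s\<in>S. Max ((\<lambda>j. \<bar>\<Sum>i<n. s i * d j i\<bar>) ` J))
    = (\<Sum>s\<in>S. l * Max ((\<lambda>j. \<bar>\<Sum>i<n. s i * d j i\<bar>) ` J))"
    by (simp add: sum_distrib_left)
  also have "\<dots> \<le> (\<Sum>s\<in>S. (\<Sum>j\<in>J. exp (l * (\<Sum>i<n. s i * d j i)) + exp (- (l * (\<Sum>i<n. s i * d j i)))) / k + ln k - 1)"
    by (intro sum_mono Max_abs_le_exp_sum assms k)
  also have "\<dots> = (\<Sum>j\<in>J. (\<Sum>s\<in>S. exp (l * (\<Sum>i<n. s i * d j i))) + (\<Sum>s\<in>S. exp (- l * (\<Sum>i<n. s i * d j i)))) / k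
      + 2 ^ n * (ln k - 1)"
    by (simp add: sum.distrib sum_subtractf cS sum_divide_distrib[symmetric] sum.swap[of _ S J] algebra_simps)
  also have "\<dots> \<le> (\<Sum>j\<in>J. 2 ^ n * exp (l\<^sup>2 * V / 2) + 2 ^ n * exp ((- l)\<^sup>2 * V / 2)) / k + 2 ^ n * (ln k - 1)"
    using k by (intro add_right_mono divide_right_mono sum_mono add_mono le) auto
  also have "\<dots> = 2 ^ n * k / k + 2 ^ n * (ln k - 1)"
    by (simp add: k_def)
  also have "\<dots> = 2 ^ n * ln k" using k by (simp add: algebra_simps)
  finally have "(\<Sum>s\<in>S. Max ((\<lambda>j. \<bar>\<Sum>i<n. s i * d j i\<bar>) ` J)) \<le> 2 ^ n * ln k / l"
    using \<open>l > 0\<close> by (simp add: field_simps)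
  also have "\<dots> = 2 ^ n * (l * V / 2 + ln (2 * card J) / l)"
    using \<open>l > 0\<close> by (simp add: lnk field_simps power2_eq_square)
  finally show ?thesis unfolding S_def .
qed

section \<open>Product measures and symmetrization\<close>

lemma PiM_coordinate:
  assumes P: "prob_space P" and "i \<in> I" and f: "f \<in> borel_measurable P"
  shows "integrable (PiM I (\<lambda>_. P)) (\<lambda>\<omega>. f (\<omega> i)) \<longleftrightarrow> integrable P (f :: _ \<Rightarrow> real)"
    and "(\<integral>\<omega>. f (\<omega> i) \<partial>PiM I (\<lambda>_. P)) = (\<integral>x. f x \<partial>P)"
proof -
  have d: "distr (PiM I (\<lambda>_. P)) P (\<lambda>\<omega>. \<omega> i) = P"
    using assms by (intro distr_PiM_component) auto
  have m: "(\<lambda>\<omega>. \<omega> i) \<in> PiM I (\<lambda>_. P) \<rightarrow>\<^sub>M P"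
    using \<open>i \<in> I\<close> by measurable
  show "integrable (PiM I (\<lambda>_. P)) (\<lambda>\<omega>. f (\<omega> i)) \<longleftrightarrow> integrable P f"
    using integrable_distr_eq[OF m f] d by simp
  show "(\<integral>\<omega>. f (\<omega> i) \<partial>PiM I (\<lambda>_. P)) = (\<integral>x. f x \<partial>P)"
    using integral_distr[OF m f] d by simp
qed

text \<open>Serves two purposes: with the identity as \<open>t\<close> it discards coordinates that
  \<open>H\<close> ignores, and with an involution it exchanges the two halves of a doubled
  sample.\<close>

lemma PiM_permute:
  fixes H :: "(nat \<Rightarrow> 'b) \<Rightarrow> real"
  assumes P: "prob_space P" and t: "inj_on t I" "t \<in> I \<rightarrow> K"
    and H: "H \<in> borel_measurable (PiM I (\<lambda>_. P))"
  shows "(\<integral>\<omega>. H (\<lambda>i\<in>I. \<omega> (t i)) \<partial>PiM K (\<lambda>_. P)) = (\<integral>\<omega>. H \<omega> \<partial>PiM I (\<lambda>_. P))"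
proof -
  have d: "distr (PiM K (\<lambda>_. P)) (PiM I (\<lambda>_. P)) (\<lambda>\<omega>. \<lambda>i\<in>I. \<omega> (t i)) = PiM I (\<lambda>_. P)"
    using distr_PiM_reindex[of K "\<lambda>_. P" t I] assms by simp
  have m: "(\<lambda>\<omega>. \<lambda>i\<in>I. \<omega> (t i)) \<in> PiM K (\<lambda>_. P) \<rightarrow>\<^sub>M PiM I (\<lambda>_. P)"
    using t by (intro measurable_restrict measurable_component_singleton) auto
  show "(\<integral>\<omega>. H (\<lambda>i\<in>I. \<omega> (t i)) \<partial>PiM K (\<lambda>_. P)) = (\<integral>\<omega>. H \<omega> \<partial>PiM I (\<lambda>_. P))"
    using integral_distr[OF m H] d by simp
qed

lemma integrable_Max_abs:
  fixes f :: "'j \<Rightarrow> 'a \<Rightarrow> real"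
  assumes "finite J" "J \<noteq> {}" "\<And>j. j \<in> J \<Longrightarrow> integrable M (f j)"
  shows "integrable M (\<lambda>\<omega>. Max ((\<lambda>j. \<bar>f j \<omega>\<bar>) ` J))"
proof (rule Bochner_Integration.integrable_bound)
  show "integrable M (\<lambda>\<omega>. \<Sum>j\<in>J. \<bar>f j \<omega>\<bar>)" using assms by auto
  show "(\<lambda>\<omega>. Max ((\<lambda>j. \<bar>f j \<omega>\<bar>) ` J)) \<in> borel_measurable M"
    using assms by (intro borel_measurable_Max) auto
  have "\<bar>Max ((\<lambda>j. \<bar>f j \<omega>\<bar>) ` J)\<bar> \<le> \<bar>\<Sum>j\<in>J. \<bar>f j \<omega>\<bar>\<bar>" for \<omega>
  proof -
    have "Max ((\<lambda>j. \<bar>f j \<omega>\<bar>) ` J) \<in> (\<lambda>j. \<bar>f j \<omega>\<bar>) ` J"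
      using assms by (intro Max_in) auto
    then obtain i where i: "i \<in> J" "Max ((\<lambda>j. \<bar>f j \<omega>\<bar>) ` J) = \<bar>f i \<omega>\<bar>" by blast
    have "\<bar>f i \<omega>\<bar> \<le> (\<Sum>j\<in>J. \<bar>f j \<omega>\<bar>)"
      using i assms by (intro member_le_sum) auto
    then show ?thesis using i by simp
  qed
  then show "AE \<omega> in M. norm (Max ((\<lambda>j. \<bar>f j \<omega>\<bar>) ` J)) \<le> norm (\<Sum>j\<in>J. \<bar>f j \<omega>\<bar>)"
    by simp
qed

text \<open>The coordinates from \<open>n\<close> to \<open>2 * n - 1\<close> are a ghost sample.
  Integrating over them reproduces the mean of \<open>g j\<close>, and the absolute value and the
  maximum of an integral are at most the integral of the maximum.\<close>

lemma symmetrization: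
  fixes g :: "'j \<Rightarrow> 'b \<Rightarrow> real"
  assumes P: "prob_space P" and J: "finite J" "J \<noteq> {}" and g: "\<And>j. j \<in> J \<Longrightarrow> integrable P (g j)"
  shows "(\<integral>\<omega>. Max ((\<lambda>j. \<bar>\<Sum>i<n. g j (\<omega> i) - (\<integral>z. g j z \<partial>P)\<bar>) ` J) \<partial>PiM UNIV (\<lambda>_::nat. P))
    \<le> (\<integral>\<omega>. Max ((\<lambda>j. \<bar>\<Sum>i<n. g j (\<omega> i) - g j (\<omega> (n + i))\<bar>) ` J) \<partial>PiM {..<2*n} (\<lambda>_::nat. P))"
proof -
  interpret P: prob_space P by fact
  interpret PP: product_prob_space "\<lambda>_::nat. P" UNIV by unfold_locales
  define A where "A = {..<n}"
  define B where "B = {n..<2*n}"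
  have AB: "A \<union> B = {..<2*n}" "A \<inter> B = {}" "finite A" "finite B" by (auto simp: A_def B_def)
  interpret QA: prob_space "PiM A (\<lambda>_. P)" by (intro prob_space_PiM P)
  interpret QB: prob_space "PiM B (\<lambda>_. P)" by (intro prob_space_PiM P)
  have gm: "g j \<in> borel_measurable P" if "j \<in> J" for j using g[OF that] by auto
  let ?F = "\<lambda>\<omega>. Max ((\<lambda>j. \<bar>\<Sum>i<n. g j (\<omega> i) - (\<integral>z. g j z \<partial>P)\<bar>) ` J)"
  let ?H = "\<lambda>\<omega>. Max ((\<lambda>j. \<bar>\<Sum>i<n. g j (\<omega> i) - g j (\<omega> (n + i))\<bar>) ` J)"
  have gi: "integrable (PiM K (\<lambda>_. P)) (\<lambda>\<omega>. g j (\<omega> i))" if "j \<in> J" "i \<in> K" for j i and K :: "nat set"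
    using PiM_coordinate(1)[OF P that(2) gm[OF that(1)]] g that by simp
  have intF: "integrable (PiM A (\<lambda>_. P)) ?F"
    by (intro integrable_Max_abs Bochner_Integration.integrable_sum
      Bochner_Integration.integrable_diff J gi QA.integrable_const) (auto simp: A_def)
  have intH: "integrable (PiM (A \<union> B) (\<lambda>_. P)) ?H"
    using J gi by (intro integrable_Max_abs Bochner_Integration.integrable_sum
      Bochner_Integration.integrable_diff) (auto simp: A_def B_def)
  have "(\<integral>\<omega>. ?F \<omega> \<partial>PiM UNIV (\<lambda>_::nat. P)) = (\<integral>\<omega>. ?F (\<lambda>i\<in>A. \<omega> i) \<partial>PiM UNIV (\<lambda>_::nat. P))"
    by (simp add: A_def)
  also have "\<dots> = (\<integral>\<omega>. ?F \<omega> \<partial>PiM A (\<lambda>_. P))"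
    using intF by (intro PiM_permute[OF P, where t="\<lambda>i. i"]) auto
  \<comment> \<open>The first half \<open>x\<close> is frozen and the ghost half \<open>y\<close> is
    integrated out; Fubini then reassembles the product.\<close>
  also have "\<dots> \<le> (\<integral>x. (\<integral>y. ?H (merge A B (x, y)) \<partial>PiM B (\<lambda>_. P)) \<partial>PiM A (\<lambda>_. P))"
  proof (rule integral_mono[OF intF])
    interpret pair_sigma_finite "PiM A (\<lambda>_. P)" "PiM B (\<lambda>_. P)" by unfold_locales
    have intm: "integrable (PiM A (\<lambda>_. P) \<Otimes>\<^sub>M PiM B (\<lambda>_. P)) (\<lambda>z. ?H (merge A B z))"
      using intH by (intro integrable_distr[OF measurable_merge]) (simp only: PP.distr_merge[OF AB(2-4)])
    then show "integrable (PiM A (\<lambda>_. P)) (\<lambda>x. \<integral>y. ?H (merge A B (x, y)) \<partial>PiM B (\<lambda>_. P))"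
      by (rule integrable_fst')
    fix x assume x: "x \<in> space (PiM A (\<lambda>_. P))"
    have eq: "?H (merge A B (x, y)) = Max ((\<lambda>j. \<bar>\<Sum>i<n. g j (x i) - g j (y (n + i))\<bar>) ` J)" for y
      by (intro arg_cong[where f=Max] image_cong refl arg_cong[where f=abs] sum.cong)
         (auto simp: merge_def A_def B_def)
    have inty: "integrable (PiM B (\<lambda>_. P)) (\<lambda>y. \<Sum>i<n. g j (x i) - g j (y (n + i)))" if "j \<in> J" for j
      by (intro Bochner_Integration.integrable_sum Bochner_Integration.integrable_diff gi that QB.integrable_const)
        (auto simp: B_def)
    have intM: "integrable (PiM B (\<lambda>_. P)) (\<lambda>y. ?H (merge A B (x, y)))"
      unfolding eq using J inty by (intro integrable_Max_abs) auto
    have "\<bar>\<Sum>i<n. g j (x i) - (\<integral>z. g j z \<partial>P)\<bar> \<le> (\<integral>y. ?H (merge A B (x, y)) \<partial>PiM B (\<lambda>_. P))"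
      if j: "j \<in> J" for j
    proof -
      have co: "(\<integral>y. g j (y (n + i)) \<partial>PiM B (\<lambda>_. P)) = (\<integral>z. g j z \<partial>P)" if "i < n" for i
        using that by (intro PiM_coordinate(2) P gm j) (auto simp: B_def)
      have "(\<Sum>i<n. g j (x i) - (\<integral>z. g j z \<partial>P)) = (\<integral>y. (\<Sum>i<n. g j (x i) - g j (y (n + i))) \<partial>PiM B (\<lambda>_. P))"
      proof (subst Bochner_Integration.integral_sum)
        show "integrable (PiM B (\<lambda>_. P)) (\<lambda>y. g j (x i) - g j (y (n + i)))" if "i \<in> {..<n}" for i
          by (intro Bochner_Integration.integrable_diff gi j QB.integrable_const) (use that in \<open>auto simp: B_def\<close>)
        have "(\<integral>y. g j (x i) - g j (y (n + i)) \<partial>PiM B (\<lambda>_. P)) = g j (x i) - (\<integral>y. g j (y (n + i)) \<partial>PiM B (\<lambda>_. P))"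
          if "i < n" for i
          using gi[OF j, of "n + i" B] that by (subst Bochner_Integration.integral_diff) (auto simp: QB.prob_space B_def[THEN eqset_imp_iff])
        with co show "(\<Sum>i<n. g j (x i) - (\<integral>z. g j z \<partial>P)) =
          (\<Sum>i<n. \<integral>y. g j (x i) - g j (y (n + i)) \<partial>PiM B (\<lambda>_. P))"
          by simp
      qed
      also have "\<bar>\<dots>\<bar> \<le> (\<integral>y. \<bar>\<Sum>i<n. g j (x i) - g j (y (n + i))\<bar> \<partial>PiM B (\<lambda>_. P))"
        by (rule integral_abs_bound)
      also have "\<dots> \<le> (\<integral>y. ?H (merge A B (x, y)) \<partial>PiM B (\<lambda>_. P))"
        using inty[OF j] intM J j unfolding eq by (intro integral_mono) auto
      finally show ?thesis .
    qed
    then show "?F x \<le> (\<integral>y. ?H (merge A B (x, y)) \<partial>PiM B (\<lambda>_. P))"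
      using J by (intro Max.boundedI) auto
  qed
  also have "\<dots> = (\<integral>\<omega>. ?H \<omega> \<partial>PiM (A \<union> B) (\<lambda>_. P))"
    using AB intH by (intro PP.product_integral_fold[symmetric]) auto
  finally show ?thesis by (simp only: AB)
qed

text \<open>Conditionally on the doubled sample this is \<open>rademacher_maximal\<close>. Its
  variance bound is random while \<open>l\<close> is not, and the estimate is linear in that
  variance, so it can be integrated directly; \<open>l\<close> is optimized only afterwards.\<close>

lemma maximal_inequality:
  fixes g :: "'j \<Rightarrow> 'b \<Rightarrow> real" and E :: "'b \<Rightarrow> real"
  assumes P: "prob_space P" and J: "finite J" "J \<noteq> {}"
    and g: "\<And>j. j \<in> J \<Longrightarrow> integrable P (g j)"
    and E: "E \<in> borel_measurable P" "integrable P (\<lambda>z. (E z)\<^sup>2)"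
    and bnd: "\<And>j z. j \<in> J \<Longrightarrow> z \<in> space P \<Longrightarrow> \<bar>g j z\<bar> \<le> \<delta> * E z"
    and l: "l > 0"
  shows "(\<integral>\<omega>. Max ((\<lambda>j. \<bar>\<Sum>i<n. g j (\<omega> i) - (\<integral>z. g j z \<partial>P)\<bar>) ` J) \<partial>PiM UNIV (\<lambda>_::nat. P))
    \<le> l * (2 * n * \<delta>\<^sup>2 * (\<integral>z. (E z)\<^sup>2 \<partial>P)) + ln (2 * card J) / l"
proof -
  define K where "K = {..<2*n}"
  define Q where "Q = PiM K (\<lambda>_::nat. P)"
  interpret Q: prob_space Q unfolding Q_def by (intro prob_space_PiM P)
  define S where "S = PiE {..<n} (\<lambda>_. {-1, 1::real})"
  have cS: "real (card S) = 2 ^ n" "finite S" by (simp_all add: S_def card_PiE finite_PiE)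
  define H where "H s \<omega> = Max ((\<lambda>j. \<bar>\<Sum>i<n. s i * (g j (\<omega> i) - g j (\<omega> (n + i)))\<bar>) ` J)"
    for s :: "nat \<Rightarrow> real" and \<omega> :: "nat \<Rightarrow> 'b"
  have gm: "g j \<in> borel_measurable P" if "j \<in> J" for j using g[OF that] by auto
  have gi: "integrable Q (\<lambda>\<omega>. g j (\<omega> i))" if "j \<in> J" "i \<in> K" for j i
    using PiM_coordinate(1)[OF P that(2) gm[OF that(1)]] g that by (simp add: Q_def)
  have intH: "integrable Q (H s)" for s
    unfolding H_def using J gi by (intro integrable_Max_abs Bochner_Integration.integrable_sum
      Bochner_Integration.integrable_mult_right Bochner_Integration.integrable_diff) (auto simp: K_def)
  \<comment> \<open>exchanging \<open>\<omega> i\<close> and \<open>\<omega> (n + i)\<close> for the indices with \<open>s i = -1\<close> preserves the measure\<close>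
  have swap: "(\<integral>\<omega>. H (\<lambda>_. 1) \<omega> \<partial>Q) = (\<integral>\<omega>. H s \<omega> \<partial>Q)" if s: "s \<in> S" for s
  proof -
    define t where "t i = (if i < n then (if s i = 1 then i else n + i)
      else if i < 2 * n then (if s (i - n) = 1 then i else i - n) else i)" for i
    have tt: "t (t i) = i" for i by (auto simp: t_def)
    then have inj: "inj_on t A" for A by (metis inj_onI)
    have "(\<integral>\<omega>. H (\<lambda>_. 1) (\<lambda>i\<in>K. \<omega> (t i)) \<partial>Q) = (\<integral>\<omega>. H (\<lambda>_. 1) \<omega> \<partial>Q)"
      using intH[of "\<lambda>_. 1"] unfolding Q_def
      by (intro PiM_permute[OF P inj]) (auto simp: t_def K_def)
    moreover have "H (\<lambda>_. 1) (\<lambda>i\<in>K. \<omega> (t i)) = H s \<omega>" for \<omega>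
      unfolding H_def
    proof (intro arg_cong[where f=Max] image_cong refl arg_cong[where f=abs] sum.cong)
      fix j i assume "i \<in> {..<n}"
      then have "s i \<in> {-1, 1}" using s PiE_mem[of s "{..<n}" _ i] unfolding S_def by auto
      with \<open>i \<in> {..<n}\<close> show "1 * (g j (restrict (\<lambda>i. \<omega> (t i)) K i) - g j (restrict (\<lambda>i. \<omega> (t i)) K (n + i)))
         = s i * (g j (\<omega> i) - g j (\<omega> (n + i)))"
        by (auto simp: K_def t_def)
    qed
    ultimately show ?thesis by simp
  qed
  \<comment> \<open>From \<open>(a - b)\<^sup>2 \<le> 2 * (a\<^sup>2 + b\<^sup>2)\<close> and the
    envelope: one bound for all \<open>j\<close>. Its mean is
    \<open>4 * n * \<delta>\<^sup>2\<close> times the second moment of \<open>E\<close>, and half of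
    this appears in the conclusion.\<close>
  define V where "V \<omega> = (\<Sum>i<n. 2 * \<delta>\<^sup>2 * ((E (\<omega> i))\<^sup>2 + (E (\<omega> (n + i)))\<^sup>2))" for \<omega> :: "nat \<Rightarrow> 'b"
  have Ei: "integrable Q (\<lambda>\<omega>. (E (\<omega> i))\<^sup>2)" "(\<integral>\<omega>. (E (\<omega> i))\<^sup>2 \<partial>Q) = (\<integral>z. (E z)\<^sup>2 \<partial>P)" if "i \<in> K" for i
    using PiM_coordinate[OF P that, of "\<lambda>z. (E z)\<^sup>2"] E by (auto simp: Q_def)
  have intV: "integrable Q V"
    unfolding V_def using Ei by (intro Bochner_Integration.integrable_sum
      Bochner_Integration.integrable_mult_right Bochner_Integration.integrable_add) (auto simp: K_def)
  have EV: "(\<integral>\<omega>. V \<omega> \<partial>Q) = 4 * n * \<delta>\<^sup>2 * (\<integral>z. (E z)\<^sup>2 \<partial>P)"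
  proof -
    have "(\<integral>\<omega>. V \<omega> \<partial>Q) = (\<Sum>i<n. \<integral>\<omega>. 2 * \<delta>\<^sup>2 * ((E (\<omega> i))\<^sup>2 + (E (\<omega> (n + i)))\<^sup>2) \<partial>Q)"
      unfolding V_def using Ei by (intro Bochner_Integration.integral_sum
        Bochner_Integration.integrable_mult_right Bochner_Integration.integrable_add) (auto simp: K_def)
    also have "\<dots> = (\<Sum>i<n. 4 * \<delta>\<^sup>2 * (\<integral>z. (E z)\<^sup>2 \<partial>P))"
      using Ei by (intro sum.cong refl, subst integral_mult_right_zero, subst Bochner_Integration.integral_add) (auto simp: K_def)
    finally show ?thesis by simp
  qed
  have pt: "(\<Sum>s\<in>S. H s \<omega>) \<le> 2 ^ n * (l * V \<omega> / 2 + ln (2 * card J) / l)" if \<omega>: "\<omega> \<in> space Q" for \<omega>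
    unfolding S_def H_def
  proof (rule rademacher_maximal[OF J l])
    fix j assume j: "j \<in> J"
    show "(\<Sum>i<n. (g j (\<omega> i) - g j (\<omega> (n + i)))\<^sup>2) \<le> V \<omega>"
      unfolding V_def
    proof (intro sum_mono)
      fix i assume "i \<in> {..<n}"
      then have sp: "\<omega> i \<in> space P" "\<omega> (n + i) \<in> space P"
        using \<omega> by (auto simp: Q_def K_def space_PiM PiE_iff)
      have sq: "(g j z)\<^sup>2 \<le> \<delta>\<^sup>2 * (E z)\<^sup>2" if "z \<in> space P" for z
        using power_mono[OF bnd[OF j that], of 2] by (simp add: power_mult_distrib)
      have "(a - b)\<^sup>2 \<le> 2 * (a\<^sup>2 + b\<^sup>2)" for a b :: real
        using zero_le_power2[of "a + b"] by (simp add: power2_eq_square algebra_simps)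
      then have "(g j (\<omega> i) - g j (\<omega> (n + i)))\<^sup>2 \<le> 2 * ((g j (\<omega> i))\<^sup>2 + (g j (\<omega> (n + i)))\<^sup>2)" .
      also have "\<dots> \<le> 2 * (\<delta>\<^sup>2 * (E (\<omega> i))\<^sup>2 + \<delta>\<^sup>2 * (E (\<omega> (n + i)))\<^sup>2)"
        using sq sp by (intro mult_left_mono add_mono) auto
      finally show "(g j (\<omega> i) - g j (\<omega> (n + i)))\<^sup>2 \<le> 2 * \<delta>\<^sup>2 * ((E (\<omega> i))\<^sup>2 + (E (\<omega> (n + i)))\<^sup>2)"
        by (simp add: algebra_simps)
    qed
  qed
  have "2 ^ n * (\<integral>\<omega>. H (\<lambda>_. 1) \<omega> \<partial>Q) = (\<Sum>s\<in>S. \<integral>\<omega>. H (\<lambda>_. 1) \<omega> \<partial>Q)"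
    using cS by simp
  also have "\<dots> = (\<Sum>s\<in>S. \<integral>\<omega>. H s \<omega> \<partial>Q)"
    by (intro sum.cong swap refl)
  also have "\<dots> = (\<integral>\<omega>. (\<Sum>s\<in>S. H s \<omega>) \<partial>Q)"
    using intH by (simp add: Bochner_Integration.integral_sum)
  also have "\<dots> \<le> (\<integral>\<omega>. 2 ^ n * (l * V \<omega> / 2 + ln (2 * card J) / l) \<partial>Q)"
    using intH intV pt by (intro integral_mono) auto
  also have "\<dots> = 2 ^ n * (l * (\<integral>\<omega>. V \<omega> \<partial>Q) / 2 + ln (2 * card J) / l)"
    using intV by (simp add: Q.prob_space)
  finally have "(\<integral>\<omega>. H (\<lambda>_. 1) \<omega> \<partial>Q) \<le> l * (\<integral>\<omega>. V \<omega> \<partial>Q) / 2 + ln (2 * card J) / l"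
    by simp
  moreover have "(\<integral>\<omega>. Max ((\<lambda>j. \<bar>\<Sum>i<n. g j (\<omega> i) - (\<integral>z. g j z \<partial>P)\<bar>) ` J) \<partial>PiM UNIV (\<lambda>_::nat. P))
    \<le> (\<integral>\<omega>. H (\<lambda>_. 1) \<omega> \<partial>Q)"
    unfolding H_def Q_def K_def mult_1 by (rule symmetrization[OF P J g])
  moreover have "l * (\<integral>\<omega>. V \<omega> \<partial>Q) / 2 = l * (2 * n * \<delta>\<^sup>2 * (\<integral>z. (E z)\<^sup>2 \<partial>P))"
    by (simp add: EV)
  ultimately show ?thesis by linarith
qed

section \<open>Gaussian sequences and characteristic functions\<close>

definition psd_kernel :: "(nat \<Rightarrow> nat \<Rightarrow> real) \<Rightarrow> bool" where
  "psd_kernel K \<longleftrightarrow> (\<forall>i j. K i j = K j i) \<and>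
     (\<forall>A a. finite A \<longrightarrow> 0 \<le> (\<Sum>i\<in>A. \<Sum>j\<in>A. a i * a j * K i j))"

text \<open>For \<open>K n n = 0\<close> division by zero makes this the identity, which is the right convention
  because then the \<open>n\<close>-th row of \<open>K\<close> vanishes.\<close>

definition schur_complement :: "nat \<Rightarrow> (nat \<Rightarrow> nat \<Rightarrow> real) \<Rightarrow> nat \<Rightarrow> nat \<Rightarrow> real" where
  "schur_complement n K = (\<lambda>i j. K i j - K i n * K n j / K n n)"

lemma psd_kernel_diag: "psd_kernel K \<Longrightarrow> 0 \<le> K i i"
  unfolding psd_kernel_def by (elim conjE allE[of _ "{i}"] allE[of _ "\<lambda>_. 1"]) simp

text \<open>The degenerate case of the Cauchy-Schwarz inequality: weight 1 at \<open>i\<close> and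
  \<open>y\<close> at \<open>n\<close> give an expression affine in \<open>y\<close> that can never
  be negative.\<close>

lemma psd_kernel_zero_row:
  assumes "psd_kernel K" "K n n = 0"
  shows "K i n = 0"
proof (cases "i = n")
  case False
  have sym: "K n i = K i n" using assms by (auto simp: psd_kernel_def)
  define a where "a y j = (if j = i then 1 else y)" for y :: real and j
  have "0 \<le> (\<Sum>p\<in>{i, n}. \<Sum>q\<in>{i, n}. a y p * a y q * K p q)" for y
    using assms by (simp add: psd_kernel_def)
  then have nn: "0 \<le> K i i + 2 * y * K i n" for y
    using False assms(2) sym by (simp add: a_def algebra_simps)
  show ?thesis
  proof (rule ccontr)
    assume "K i n \<noteq> 0"
    \<comment> \<open>At this \<open>y\<close> the affine expression equals -1.\<close>
    then show False
      using nn[of "- (K i i + 1) / (2 * K i n)"] by (simp add: field_simps)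
  qed
qed (use assms in simp)

lemma psd_kernel_schur_complement:
  assumes K: "psd_kernel K"
  shows "psd_kernel (schur_complement n K)"
proof (cases "K n n = 0")
  case True
  then show ?thesis using K by (simp add: schur_complement_def)
next
  case False
  have sym: "K i j = K j i" for i j using K by (auto simp: psd_kernel_def)
  have main: "0 \<le> (\<Sum>i\<in>A. \<Sum>j\<in>A. a i * a j * schur_complement n K i j)"
    if A: "finite A" "n \<in> A" for A a
  proof -
    define s where "s = (\<Sum>i\<in>A. a i * K i n)"
    have s2: "s = (\<Sum>i\<in>A. a i * K n i)"
      unfolding s_def by (rule sum.cong, rule refl, subst sym, rule refl)
    \<comment> \<open>The change of the weight at \<open>n\<close> that minimizes the quadratic
      form; the minimum is exactly the form of the Schur complement at \<open>a\<close>.\<close>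
    define t where "t = - s / K n n"
    define e where "e i = (if i = n then t else 0)" for i
    have delta: "(\<Sum>i\<in>A. e i * f i) = t * f n" for f
    proof -
      have "(\<Sum>i\<in>A. e i * f i) = (\<Sum>i\<in>A. if i = n then t * f i else 0)"
        by (intro sum.cong) (auto simp: e_def)
      then show ?thesis using A by simp
    qed
    have "0 \<le> (\<Sum>i\<in>A. \<Sum>j\<in>A. (a i + e i) * (a j + e j) * K i j)"
      using K A by (simp add: psd_kernel_def)
    also have "\<dots> = (\<Sum>i\<in>A. \<Sum>j\<in>A. a i * a j * K i j) + (\<Sum>i\<in>A. a i * (\<Sum>j\<in>A. e j * K i j))
        + (\<Sum>i\<in>A. e i * (\<Sum>j\<in>A. a j * K i j)) + (\<Sum>i\<in>A. e i * (\<Sum>j\<in>A. e j * K i j))"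
      by (simp add: algebra_simps sum.distrib sum_distrib_left)
    also have "\<dots> = (\<Sum>i\<in>A. \<Sum>j\<in>A. a i * a j * K i j) + t * s + t * s + t * (t * K n n)"
    proof -
      have "(\<Sum>i\<in>A. a i * (t * K i n)) = t * s"
        by (simp add: s_def sum_distrib_left mult.left_commute)
      then show ?thesis by (simp only: delta s2[symmetric])
    qed
    also have "t * (t * K n n) = - (t * s)"
      using False by (simp add: t_def)
    also have "(\<Sum>i\<in>A. \<Sum>j\<in>A. a i * a j * K i j) + t * s + t * s + - (t * s) =
        (\<Sum>i\<in>A. \<Sum>j\<in>A. a i * a j * K i j) - s * s / K n n"
      by (simp add: t_def)
    also have "s * s = (\<Sum>i\<in>A. \<Sum>j\<in>A. a i * a j * (K i n * K n j))"
      by (subst s2, subst s_def) (simp add: sum_product algebra_simps)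
    finally show ?thesis
      by (simp add: schur_complement_def sum_subtractf sum_divide_distrib right_diff_distrib)
  qed
  \<comment> \<open>An index set without \<open>n\<close> is enlarged by \<open>n\<close> with
    weight 0.\<close>
  have "0 \<le> (\<Sum>i\<in>A. \<Sum>j\<in>A. a i * a j * schur_complement n K i j)" if "finite A" for A a
  proof (cases "n \<in> A")
    case False
    have "(\<Sum>i\<in>insert n A. \<Sum>j\<in>insert n A. (a(n := 0)) i * (a(n := 0)) j * schur_complement n K i j)
      = (\<Sum>i\<in>A. \<Sum>j\<in>A. a i * a j * schur_complement n K i j)"
      using False that by simp (intro sum.cong refl, auto)
    then show ?thesis using main[of "insert n A" "a(n := 0)"] that by simp
  qed (use main that in simp)
  then show ?thesis
    unfolding psd_kernel_def
  proof (intro conjI allI impI)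
    show "schur_complement n K i j = schur_complement n K j i" for i j
      unfolding schur_complement_def by (simp only: sym[of i j] sym[of i n] sym[of n j] mult.commute)
  qed
qed

text \<open>\<open>R m\<close> is the residual after eliminating the indices below \<open>m\<close>.
  Each elimination splits off a rank-one kernel and leaves the rows and columns already treated at
  zero, which makes \<open>c\<close> triangular and every expansion finite.\<close>

lemma psd_kernel_cholesky:
  assumes K: "psd_kernel K"
  obtains c where "\<And>i m. m > i \<Longrightarrow> c i m = 0"
    and "\<And>i j N. N > j \<Longrightarrow> K i j = (\<Sum>m<N. c i m * c j m)"
proof -
  define R where "R = rec_nat K (\<lambda>m. schur_complement m)"
  have R0: "R 0 = K" and RS: "R (Suc m) = schur_complement m (R m)" for m
    by (simp_all add: R_def)
  have psd: "psd_kernel (R m)" for m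
    by (induction m) (simp_all add: R0 RS K psd_kernel_schur_complement)
  have sym: "R m i j = R m j i" for m i j using psd[of m] by (auto simp: psd_kernel_def)
  have zero: "R l i m = 0" if "m < l" for l i m
    using that
  proof (induction l arbitrary: i)
    case (Suc l)
    show ?case
    proof (cases "m = l")
      case True
      show ?thesis
        using psd_kernel_zero_row[OF psd[of l], of l i]
        by (cases "R l l l = 0") (simp_all add: RS schur_complement_def True)
    next
      case False
      then have "R l i m = 0" for i using Suc by simp
      then show ?thesis by (simp add: RS schur_complement_def)
    qed
  qed simp
  \<comment> \<open>For a vanishing pivot, division by zero makes the column zero; nothing is lost,
    since by \<open>psd_kernel_zero_row\<close> the residual column vanishes too.\<close>
  define c where "c i m = R m i m / sqrt (R m m m)" for i m
  have step: "R m i j = c i m * c j m + R (Suc m) i j" for m i j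
    using psd_kernel_diag[OF psd[of m], of m] sym[of m m j]
    by (simp add: c_def RS schur_complement_def)
  have expand: "K i j = (\<Sum>m<N. c i m * c j m) + R N i j" for i j N
  proof (induction N)
    case (Suc N)
    then show ?case using step[of N i j] by simp
  qed (simp add: R0)
  show ?thesis
  proof (rule that[of c])
    show "c i m = 0" if "m > i" for i m
      using zero[OF that, of m] sym[of m i m] by (simp add: c_def)
    show "K i j = (\<Sum>m<N. c i m * c j m)" if "N > j" for i j N
      using expand[of i j N] zero[OF that] by simp
  qed
qed

section \<open>The one-dimensional central limit theorem, tested on cosines\<close>

lemma integral_cos_char:
  assumes "prob_space M" and [measurable]: "Y \<in> borel_measurable M"
  shows "(\<integral>\<omega>. cos (Y \<omega> + c) \<partial>M) = Re (iexp c * char (distr M borel Y) 1)"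
proof -
  interpret prob_space M by fact
  have "iexp c * char (distr M borel Y) 1 = (CLINT \<omega>|M. iexp c * iexp (Y \<omega>))"
    by (simp add: char_def integral_distr)
  also have "\<dots> = (CLINT \<omega>|M. iexp (Y \<omega> + c))"
    by (simp add: exp_add[symmetric] distrib_left add.commute)
  also have "Re \<dots> = (\<integral>\<omega>. Re (iexp (Y \<omega> + c)) \<partial>M)"
    by (intro integral_Re[symmetric] integrable_iexp) auto
  finally show ?thesis by (simp add: Re_exp)
qed

lemma indep_vars_coordinates:
  assumes P: "prob_space P" and f: "\<And>i. f i \<in> P \<rightarrow>\<^sub>M borel"
  shows "prob_space.indep_vars (PiM UNIV (\<lambda>_::nat. P)) (\<lambda>_. borel) (\<lambda>i \<omega>. f i (\<omega> i) :: real) UNIV"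
proof -
  interpret Q: prob_space "PiM UNIV (\<lambda>_::nat. P)" by (intro prob_space_PiM P)
  have d: "distr (PiM UNIV (\<lambda>_::nat. P)) P (\<lambda>\<omega>. \<omega> i) = P" for i
    using P by (intro distr_PiM_component) auto
  have "Q.indep_vars (\<lambda>_. P) (\<lambda>i \<omega>. \<omega> i) UNIV"
    by (subst Q.indep_vars_iff_distr_eq_PiM) (auto simp: d restrict_UNIV distr_id)
  then show ?thesis
    by (rule Q.indep_vars_compose2) (use f in auto)
qed

lemma variance_iid_sum:
  fixes g :: "'b \<Rightarrow> real"
  assumes P: "prob_space P" and [measurable]: "g \<in> borel_measurable P"
    and g2: "integrable P (\<lambda>z. (g z)\<^sup>2)" and g0: "(\<integral>z. g z \<partial>P) = 0"
  defines "Q \<equiv> PiM UNIV (\<lambda>_::nat. P)"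
  shows "integrable Q (\<lambda>\<omega>. (\<Sum>i<n. g (\<omega> i))\<^sup>2)"
    and "(\<integral>\<omega>. (\<Sum>i<n. g (\<omega> i))\<^sup>2 \<partial>Q) = n * (\<integral>z. (g z)\<^sup>2 \<partial>P)"
proof -
  interpret P: prob_space P by fact
  interpret Q: prob_space Q unfolding Q_def by (intro prob_space_PiM P)
  have g1: "integrable P g" by (rule P.square_integrable_imp_integrable[OF _ g2]) simp
  note co = PiM_coordinate[where I="UNIV :: nat set", OF P UNIV_I, folded Q_def]
  have gi: "integrable Q (\<lambda>\<omega>. g (\<omega> i))" "(\<integral>\<omega>. g (\<omega> i) \<partial>Q) = 0" for i :: nat
    using co[of g i] g1 g0 by auto
  have gi2: "integrable Q (\<lambda>\<omega>. (g (\<omega> i))\<^sup>2)" "(\<integral>\<omega>. (g (\<omega> i))\<^sup>2 \<partial>Q) = (\<integral>z. (g z)\<^sup>2 \<partial>P)" for i :: nat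
    using co[of "\<lambda>z. (g z)\<^sup>2" i] g2 by auto
  have iv: "Q.indep_vars (\<lambda>_. borel) (\<lambda>i \<omega>. g (\<omega> i)) UNIV"
    unfolding Q_def by (rule indep_vars_coordinates[OF P]) simp
  \<comment> \<open>Pairwise independence is read off from independence of one variable and a sum,
    here the sum over the single index \<open>j\<close>.\<close>
  have ind: "Q.indep_var borel (\<lambda>\<omega>. g (\<omega> i)) borel (\<lambda>\<omega>. g (\<omega> j))" if "i \<noteq> j" for i j
    using Q.indep_vars_sum[of "{j}" i "\<lambda>i \<omega>. g (\<omega> i)"] Q.indep_vars_subset[OF iv] that by simp
  have prod: "integrable Q (\<lambda>\<omega>. g (\<omega> i) * g (\<omega> j))"
    "(\<integral>\<omega>. g (\<omega> i) * g (\<omega> j) \<partial>Q) = (if i = j then (\<integral>z. (g z)\<^sup>2 \<partial>P) else 0)" for i j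
  proof -
    show "integrable Q (\<lambda>\<omega>. g (\<omega> i) * g (\<omega> j))"
      using gi2(1)[of i] Q.indep_var_integrable[OF ind gi(1) gi(1), of i j]
      by (cases "i = j") (auto simp: power2_eq_square)
    show "(\<integral>\<omega>. g (\<omega> i) * g (\<omega> j) \<partial>Q) = (if i = j then (\<integral>z. (g z)\<^sup>2 \<partial>P) else 0)"
      using gi2(2)[of i] Q.indep_var_lebesgue_integral[OF ind gi(1) gi(1), of i j] gi(2)
      by (cases "i = j") (auto simp: power2_eq_square)
  qed
  have sq: "(\<Sum>i<n. g (\<omega> i))\<^sup>2 = (\<Sum>i<n. \<Sum>j<n. g (\<omega> i) * g (\<omega> j))" for \<omega> :: "nat \<Rightarrow> 'b"
    by (simp add: power2_eq_square sum_product)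
  show "integrable Q (\<lambda>\<omega>. (\<Sum>i<n. g (\<omega> i))\<^sup>2)"
    unfolding sq by (intro Bochner_Integration.integrable_sum prod)
  show "(\<integral>\<omega>. (\<Sum>i<n. g (\<omega> i))\<^sup>2 \<partial>Q) = n * (\<integral>z. (g z)\<^sup>2 \<partial>P)"
    unfolding sq by (simp add: Bochner_Integration.integral_sum prod)
qed

lemma clt_cos:
  fixes g :: "'b \<Rightarrow> real"
  assumes P: "prob_space P" and [measurable]: "g \<in> borel_measurable P"
    and g2: "integrable P (\<lambda>z. (g z)\<^sup>2)" and g0: "(\<integral>z. g z \<partial>P) = 0"
  defines "Q \<equiv> PiM UNIV (\<lambda>_::nat. P)"
  shows "(\<lambda>n. \<integral>\<omega>. cos ((\<Sum>i<n. g (\<omega> i)) / sqrt n + c) \<partial>Q) \<longlonglongrightarrow> exp (- (\<integral>z. (g z)\<^sup>2 \<partial>P) / 2) * cos c"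
proof -
  interpret P: prob_space P by fact
  interpret Q: prob_space Q unfolding Q_def by (intro prob_space_PiM P)
  note co = PiM_coordinate[where I="UNIV :: nat set", OF P UNIV_I, folded Q_def]
  define v where "v = (\<integral>z. (g z)\<^sup>2 \<partial>P)"
  have v: "v \<ge> 0" by (simp add: v_def)
  have meas [measurable]: "(\<lambda>\<omega>. g (\<omega> i)) \<in> borel_measurable Q" for i :: nat
    unfolding Q_def by measurable
  show ?thesis
  proof (cases "v = 0")
    \<comment> \<open>The central limit theorem requires a positive variance. For variance zero all
      summands vanish almost surely and the integral is \<open>cos c\<close> for every
      \<open>n\<close>.\<close>
    case True
    then have "AE z in P. (g z)\<^sup>2 = 0"
      using integral_nonneg_eq_0_iff_AE[OF g2] by (simp add: v_def)
    then have "AE \<omega> in Q. (g (\<omega> i))\<^sup>2 = 0" for i :: nat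
      unfolding Q_def by (intro AE_PiM_component P) auto
    then have "AE \<omega> in Q. \<forall>i::nat. g (\<omega> i) = 0" by (simp add: AE_all_countable)
    then have "(\<integral>\<omega>. cos ((\<Sum>i<n. g (\<omega> i)) / sqrt n + c) \<partial>Q) = (\<integral>\<omega>. cos c \<partial>Q)" for n
      by (intro integral_cong_AE) auto
    then show ?thesis using True by (simp add: v_def Q.prob_space)
  next
    case False
    define \<sigma> where "\<sigma> = sqrt v"
    have \<sigma>: "\<sigma> > 0" "\<sigma>\<^sup>2 = v" using False v by (simp_all add: \<sigma>_def)
    have "weak_conv_m (\<lambda>n. distr Q borel (\<lambda>\<omega>. (\<Sum>i<n. g (\<omega> i)) / sqrt (n * \<sigma>\<^sup>2))) std_normal_distribution"
    proof (rule Q.central_limit_theorem_zero_mean)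
      show "Q.indep_vars (\<lambda>_. borel) (\<lambda>i \<omega>. g (\<omega> i)) UNIV"
        unfolding Q_def by (rule indep_vars_coordinates[OF P]) simp
      show "distr Q borel (\<lambda>\<omega>. g (\<omega> n)) = distr P borel g" for n :: nat
      proof -
        have "distr Q borel (\<lambda>\<omega>. g (\<omega> n)) = distr (distr Q P (\<lambda>\<omega>. \<omega> n)) borel g"
          by (subst distr_distr) (auto simp: comp_def Q_def)
        also have "distr Q P (\<lambda>\<omega>. \<omega> n) = P"
          unfolding Q_def using P by (intro distr_PiM_component) auto
        finally show ?thesis .
      qed
    qed (use co[of g] co[of "\<lambda>z. (g z)\<^sup>2"] g0 g2 \<sigma> in \<open>auto simp: v_def\<close>)
    \<comment> \<open>The theorem normalizes by the standard deviation as well; evaluating the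
      characteristic function at \<open>\<sigma>\<close> instead of 1 undoes that.\<close>
    then have "(\<lambda>n. char (distr Q borel (\<lambda>\<omega>. (\<Sum>i<n. g (\<omega> i)) / sqrt (n * \<sigma>\<^sup>2))) \<sigma>)
      \<longlonglongrightarrow> char std_normal_distribution \<sigma>"
      by (intro levy_continuity1 real_dist_normal_dist Q.real_distribution_distr) auto
    moreover have "char (distr Q borel (\<lambda>\<omega>. (\<Sum>i<n. g (\<omega> i)) / sqrt (n * \<sigma>\<^sup>2))) \<sigma>
       = char (distr Q borel (\<lambda>\<omega>. (\<Sum>i<n. g (\<omega> i)) / sqrt n)) 1" for n
      using \<sigma>(1) by (simp add: char_def integral_distr real_sqrt_mult)
    ultimately have "(\<lambda>n. Re (iexp c * char (distr Q borel (\<lambda>\<omega>. (\<Sum>i<n. g (\<omega> i)) / sqrt n)) 1))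
      \<longlonglongrightarrow> Re (iexp c * char std_normal_distribution \<sigma>)"
      by (intro tendsto_Re tendsto_mult_left) simp
    moreover have "Re (iexp c * char std_normal_distribution \<sigma>) = exp (- v / 2) * cos c"
      using \<sigma> by (simp add: char_std_normal_distribution Re_exp)
    ultimately show ?thesis
      using integral_cos_char[OF Q.prob_space_axioms, of "\<lambda>\<omega>. (\<Sum>i<n. g (\<omega> i)) / sqrt n" c for n]
      by (simp add: v_def)
  qed
qed

lemma gaussian_sum_cos:
  defines "N \<equiv> PiM UNIV (\<lambda>_::nat. std_normal_distribution)"
  shows "(\<integral>\<omega>. cos ((\<Sum>l<m. b l * \<omega> l) + c) \<partial>N) = exp (- (\<Sum>l<m. (b l)\<^sup>2) / 2) * cos c"
proof -
  interpret S: real_distribution std_normal_distribution by (rule real_dist_normal_dist)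
  have P: "prob_space std_normal_distribution" by unfold_locales
  interpret N: prob_space N unfolding N_def by (intro prob_space_PiM P)
  have [measurable]: "(\<lambda>\<omega>. \<omega> l) \<in> borel_measurable N" for l :: nat
  proof -
    have "(\<lambda>\<omega>. \<omega> l) \<in> N \<rightarrow>\<^sub>M std_normal_distribution"
      unfolding N_def by (rule measurable_component_singleton) simp
    moreover have "sets std_normal_distribution = sets borel" by simp
    ultimately show ?thesis using measurable_cong_sets by blast
  qed
  have iv: "N.indep_vars (\<lambda>_. borel) (\<lambda>l \<omega>. b l * \<omega> l) {..<m}"
    unfolding N_def
    by (rule prob_space.indep_vars_subset[OF _ indep_vars_coordinates[OF P]]) (auto intro: prob_space_PiM P)
  have "char (distr N borel (\<lambda>\<omega>. b l * \<omega> l)) 1 = char std_normal_distribution (b l)" for l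
  proof -
    have "char (distr N borel (\<lambda>\<omega>. b l * \<omega> l)) 1 = (CLINT \<omega>|N. iexp (b l * \<omega> l))"
      by (simp add: char_def integral_distr)
    also have "\<dots> = (CLINT x|distr N std_normal_distribution (\<lambda>\<omega>. \<omega> l). iexp (b l * x))"
      by (subst integral_distr) auto
    also have "distr N std_normal_distribution (\<lambda>\<omega>. \<omega> l) = std_normal_distribution"
      unfolding N_def using P by (intro distr_PiM_component) auto
    finally show ?thesis by (simp add: char_def)
  qed
  then have "char (distr N borel (\<lambda>\<omega>. \<Sum>l<m. b l * \<omega> l)) 1 = (\<Prod>l<m. complex_of_real (exp (- (b l)\<^sup>2 / 2)))"
    unfolding N.char_distr_sum[OF iv] char_std_normal_distribution by (simp only:)
  also have "\<dots> = complex_of_real (exp (- (\<Sum>l<m. (b l)\<^sup>2) / 2))"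
  proof -
    have "(\<Prod>l<m. exp (- (b l)\<^sup>2 / 2)) = exp (\<Sum>l<m. - (b l)\<^sup>2 / 2)"
      by (rule exp_sum[symmetric]) simp
    also have "(\<Sum>l<m. - (b l)\<^sup>2 / 2) = - (\<Sum>l<m. (b l)\<^sup>2) / 2"
      by (simp add: sum_negf sum_divide_distrib)
    finally show ?thesis by (metis of_real_prod)
  qed
  finally have ch: "char (distr N borel (\<lambda>\<omega>. \<Sum>l<m. b l * \<omega> l)) 1 = \<dots>" .
  have "(\<lambda>\<omega>. \<Sum>l<m. b l * \<omega> l) \<in> borel_measurable N" by measurable
  from integral_cos_char[OF N.prob_space_axioms this, of c] show ?thesis
    unfolding ch by (simp add: Re_exp)
qed

section \<open>Weak convergence and tightness in metric spaces\<close>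

definition lipschitz_real :: "'a metric \<Rightarrow> real \<Rightarrow> ('a \<Rightarrow> real) \<Rightarrow> bool" where
  "lipschitz_real m L h \<longleftrightarrow>
     0 \<le> L \<and> (\<forall>x\<in>mspace m. \<forall>y\<in>mspace m. \<bar>h x - h y\<bar> \<le> L * mdist m x y)"

text \<open>The Pasch-Hausdorff envelope: for bounded \<open>h\<close> and nonnegative
  \<open>j\<close>, the largest \<open>j\<close>-Lipschitz function below \<open>h\<close>. It
  increases to a continuous \<open>h\<close> as \<open>j\<close> grows.\<close>

definition inf_conv :: "'a metric \<Rightarrow> real \<Rightarrow> ('a \<Rightarrow> real) \<Rightarrow> 'a \<Rightarrow> real" where
  "inf_conv m j h x = Inf ((\<lambda>y. h y + j * mdist m x y) ` mspace m)"

context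
  fixes m :: "'a metric" and h :: "'a \<Rightarrow> real" and b j :: real
  assumes b: "\<And>y. y \<in> mspace m \<Longrightarrow> \<bar>h y\<bar> \<le> b" and j: "j \<ge> 0"
begin

lemma inf_conv_upper:
  assumes "y \<in> mspace m"
  shows "inf_conv m j h x \<le> h y + j * mdist m x y"
  unfolding inf_conv_def
proof (rule cInf_lower)
  have "- b \<le> h y + j * mdist m x y" if "y \<in> mspace m" for y
    using b[OF that] mult_nonneg_nonneg[OF j mdist_nonneg[of m x y]] by linarith
  then show "bdd_below ((\<lambda>y. h y + j * mdist m x y) ` mspace m)"
    by (intro bdd_belowI2)
qed (use assms in auto)

lemma inf_conv_greatest:
  assumes "x \<in> mspace m" "\<And>y. y \<in> mspace m \<Longrightarrow> c \<le> h y + j * mdist m x y"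
  shows "c \<le> inf_conv m j h x"
  unfolding inf_conv_def using assms by (intro cInf_greatest) auto

lemma inf_conv_le:
  assumes "x \<in> mspace m"
  shows "inf_conv m j h x \<le> h x"
proof -
  have "mdist m x x = 0" using assms by simp
  then show ?thesis using inf_conv_upper[OF assms, of x] by simp
qed

lemma inf_conv_bounded:
  assumes x: "x \<in> mspace m"
  shows "\<bar>inf_conv m j h x\<bar> \<le> b"
proof -
  have "- b \<le> inf_conv m j h x"
  proof (rule inf_conv_greatest[OF x])
    fix y assume "y \<in> mspace m"
    then show "- b \<le> h y + j * mdist m x y"
      using b[of y] mult_nonneg_nonneg[OF j mdist_nonneg[of m x y]] by linarith
  qed
  moreover have "inf_conv m j h x \<le> b"
    using inf_conv_le[OF x] b[OF x] by simp
  ultimately show ?thesis by simp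
qed

lemma lipschitz_inf_conv: "lipschitz_real m j (inf_conv m j h)"
proof -
  have *: "inf_conv m j h x - inf_conv m j h y \<le> j * mdist m x y"
    if "x \<in> mspace m" "y \<in> mspace m" for x y
  proof -
    have "inf_conv m j h x - j * mdist m x y \<le> inf_conv m j h y"
    proof (rule inf_conv_greatest[OF that(2)])
      fix z assume z: "z \<in> mspace m"
      have "j * mdist m x z \<le> j * (mdist m x y + mdist m y z)"
        using that z j by (intro mult_left_mono mdist_triangle)
      then show "inf_conv m j h x - j * mdist m x y \<le> h z + j * mdist m y z"
        using inf_conv_upper[OF z, of x] by (simp add: distrib_left)
    qed
    then show ?thesis by simp
  qed
  show ?thesis
    unfolding lipschitz_real_def
  proof (intro conjI ballI j)
    fix x y assume "x \<in> mspace m" "y \<in> mspace m"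
    then show "\<bar>inf_conv m j h x - inf_conv m j h y\<bar> \<le> j * mdist m x y"
      using *[of x y] *[of y x] by (simp add: mdist_commute[of m y x] abs_le_iff)
  qed
qed

end

lemma continuous_map_metricD:
  assumes "continuous_map (mtopology_of m) euclideanreal h" "x \<in> mspace m" "e > 0"
  obtains d where "d > 0" "\<And>y. y \<in> mspace m \<Longrightarrow> mdist m x y < d \<Longrightarrow> \<bar>h y - h x\<bar> < e"
proof -
  interpret X: Metric_space "mspace m" "mdist m" by (rule Metric_space_mspace_mdist)
  have "openin X.mtopology {y \<in> topspace X.mtopology. h y \<in> ball (h x) e}"
    using assms(1) unfolding mtopology_of_def by (rule openin_continuous_map_preimage) simp
  then obtain d where "d > 0" "X.mball x d \<subseteq> {y \<in> mspace m. h y \<in> ball (h x) e}"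
    using assms(2,3) unfolding X.openin_mtopology by fastforce
  then show ?thesis
    using assms(2) by (intro that[of d]) (auto simp: dist_real_def subset_iff abs_minus_commute)
qed

lemma inf_conv_tendsto:
  assumes h: "continuous_map (mtopology_of m) euclideanreal h"
    and b: "\<And>y. y \<in> mspace m \<Longrightarrow> \<bar>h y\<bar> \<le> b" and x: "x \<in> mspace m"
  shows "(\<lambda>j. inf_conv m (real j) h x) \<longlonglongrightarrow> h x"
proof (rule LIMSEQ_I)
  fix e :: real assume e: "e > 0"
  obtain d where d: "d > 0" "\<And>y. y \<in> mspace m \<Longrightarrow> mdist m x y < d \<Longrightarrow> \<bar>h y - h x\<bar> < e / 2"
    using continuous_map_metricD[OF h x, of "e/2"] e by auto
  \<comment> \<open>Beyond distance \<open>d\<close> the penalty exceeds \<open>2 * b\<close>, the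
    largest possible drop of \<open>h\<close>; within distance \<open>d\<close> continuity controls
    the drop.\<close>
  obtain J :: nat where J: "2 * b \<le> J * d"
    using reals_Archimedean3[OF d(1)] by (meson less_imp_le)
  show "\<exists>no. \<forall>n\<ge>no. norm (inf_conv m (real n) h x - h x) < e"
  proof (intro exI allI impI)
    fix n :: nat assume n: "n \<ge> J"
    have "h x - e / 2 \<le> inf_conv m (real n) h x"
    proof (rule inf_conv_greatest[OF b _ x])
      fix y assume y: "y \<in> mspace m"
      show "h x - e / 2 \<le> h y + real n * mdist m x y"
      proof (cases "mdist m x y < d")
        case True
        have "0 \<le> real n * mdist m x y" by simp
        then show ?thesis using d(2)[OF y True] by linarith
      next
        case False
        have "real J * d \<le> real n * mdist m x y"
          using n False d(1) by (intro mult_mono) auto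
        then show ?thesis using J b[OF x] b[OF y] e by (simp add: abs_le_iff)
      qed
    qed auto
    then show "norm (inf_conv m (real n) h x - h x) < e"
      using inf_conv_le[where h=h and b=b and j="real n" and m=m and x=x] b x e by (simp add: abs_less_iff)
  qed
qed

lemma lipschitz_real_continuous:
  assumes "lipschitz_real m L h"
  shows "continuous_map (mtopology_of m) euclideanreal h"
proof -
  have "Lipschitz_continuous_map m euclidean_metric h"
    using assms unfolding Lipschitz_continuous_map_def lipschitz_real_def
    by (auto simp: dist_real_def)
  from Lipschitz_continuous_imp_continuous_map[OF this] show ?thesis by simp
qed

section \<open>Borel sets and outer expectations\<close>

lemma space_metric_borel [simp]: "space (metric_borel m) = mspace m"
  using openin_subset[of "mtopology_of m"] by (auto simp: metric_borel_def space_measure_of_conv)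

lemma sets_metric_borel_open:
  assumes "openin (mtopology_of m) U"
  shows "U \<in> sets (metric_borel m)"
proof -
  have "{U. openin (mtopology_of m) U} \<subseteq> Pow (mspace m)"
    using openin_subset[of "mtopology_of m"] by auto
  then show ?thesis using assms by (simp add: metric_borel_def sets_measure_of)
qed

lemma sets_metric_borel_closed:
  assumes "closedin (mtopology_of m) C"
  shows "C \<in> sets (metric_borel m)"
proof -
  have "mspace m - (mspace m - C) \<in> sets (metric_borel m)"
    using sets.compl_sets[OF sets_metric_borel_open, of m "mspace m - C"] assms
    by (auto simp: closedin_def)
  moreover have "mspace m - (mspace m - C) = C"
    using closedin_subset[OF assms] by auto
  ultimately show ?thesis by simp
qed

lemma continuous_map_borel_measurable:
  assumes h: "continuous_map (mtopology_of m) euclideanreal h" and L: "sets L = sets (metric_borel m)"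
  shows "h \<in> borel_measurable L"
proof (rule borel_measurableI)
  fix S :: "real set" assume "open S"
  then have "openin (mtopology_of m) {x \<in> topspace (mtopology_of m). h x \<in> S}"
    using h by (intro openin_continuous_map_preimage) auto
  moreover have "{x \<in> topspace (mtopology_of m). h x \<in> S} = h -` S \<inter> space L"
    using sets_eq_imp_space_eq[OF L] by auto
  ultimately show "h -` S \<inter> space L \<in> sets L"
    using sets_metric_borel_open L by metis
qed

context
  fixes M :: "'w measure" and Z :: "'w \<Rightarrow> real" and b :: real
  assumes M: "prob_space M" and b: "\<And>\<omega>. \<omega> \<in> space M \<Longrightarrow> \<bar>Z \<omega>\<bar> \<le> b"
begin

lemma outer_expectation_le:
  assumes "integrable M U" "\<And>\<omega>. \<omega> \<in> space M \<Longrightarrow> Z \<omega> \<le> U \<omega>"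
  shows "outer_expectation M Z \<le> integral\<^sup>L M U"
  unfolding outer_expectation_def
proof (rule cInf_lower)
  interpret prob_space M by fact
  show "bdd_below {integral\<^sup>L M U |U. integrable M U \<and> (\<forall>\<omega>\<in>space M. Z \<omega> \<le> U \<omega>)}"
  proof (rule bdd_belowI[of _ "- b"], clarify)
    fix U assume U: "integrable M U" "\<forall>\<omega>\<in>space M. Z \<omega> \<le> U \<omega>"
    have "(\<integral>\<omega>. - b \<partial>M) \<le> integral\<^sup>L M U"
    proof (rule integral_mono)
      fix \<omega> assume "\<omega> \<in> space M"
      then show "- b \<le> U \<omega>" using U(2) b[of \<omega>] by fastforce
    qed (use U in auto)
    then show "- b \<le> integral\<^sup>L M U" by (simp add: prob_space)
  qed
qed (use assms in auto)

lemma outer_expectation_ge: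
  assumes "\<And>U. integrable M U \<Longrightarrow> (\<And>\<omega>. \<omega> \<in> space M \<Longrightarrow> Z \<omega> \<le> U \<omega>) \<Longrightarrow> c \<le> integral\<^sup>L M U"
  shows "c \<le> outer_expectation M Z"
  unfolding outer_expectation_def
proof (rule cInf_greatest)
  interpret prob_space M by fact
  \<comment> \<open>The constant \<open>b\<close> is an integrable majorant, so the infimum is not
    taken over the empty set.\<close>
  have "Z \<omega> \<le> b" if "\<omega> \<in> space M" for \<omega> using b[OF that] by simp
  then show "{integral\<^sup>L M U |U. integrable M U \<and> (\<forall>\<omega>\<in>space M. Z \<omega> \<le> U \<omega>)} \<noteq> {}"
    by (auto intro!: exI[of _ "\<lambda>_. b"])
qed (use assms in auto)

lemma outer_expectation_eq:
  assumes "Z \<in> borel_measurable M"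
  shows "outer_expectation M Z = integral\<^sup>L M Z"
proof (rule antisym)
  interpret prob_space M by fact
  have Z: "integrable M Z" using assms b by (intro integrable_const_bound[where B=b]) auto
  show "outer_expectation M Z \<le> integral\<^sup>L M Z" using Z by (intro outer_expectation_le) auto
  show "integral\<^sup>L M Z \<le> outer_expectation M Z"
    using Z by (intro outer_expectation_ge integral_mono) auto
qed

end

lemma outer_expectation_mono:
  assumes "prob_space M" "\<And>\<omega>. \<omega> \<in> space M \<Longrightarrow> \<bar>Z \<omega>\<bar> \<le> b" "\<And>\<omega>. \<omega> \<in> space M \<Longrightarrow> \<bar>Z' \<omega>\<bar> \<le> b"
    and le: "\<And>\<omega>. \<omega> \<in> space M \<Longrightarrow> Z \<omega> \<le> Z' \<omega>"
  shows "outer_expectation M Z \<le> outer_expectation M Z'"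
  using assms(1,3)
proof (rule outer_expectation_ge)
  fix U assume "integrable M U" "\<And>\<omega>. \<omega> \<in> space M \<Longrightarrow> Z' \<omega> \<le> U \<omega>"
  then show "outer_expectation M Z \<le> integral\<^sup>L M U"
    using outer_expectation_le[where Z=Z and b=b and M=M and U=U] assms(1,2) le by (meson order_trans)
qed

text \<open>The inf-convolutions of \<open>h\<close> and of \<open>- h\<close> squeeze \<open>h\<close> between Lipschitz functions that
  converge to it pointwise, so dominated convergence under the limit law is enough.\<close>

lemma weakly_converges_to_lipschitzI:
  fixes m :: "'a metric"
  assumes M: "prob_space M" and L: "prob_space L" and sL: "sets L = sets (metric_borel m)"
    and Y: "\<And>n \<omega>. \<omega> \<in> space M \<Longrightarrow> Y n \<omega> \<in> mspace m"
    and lip: "\<And>h l b. lipschitz_real m l h \<Longrightarrow> (\<And>x. x \<in> mspace m \<Longrightarrow> \<bar>h x\<bar> \<le> b) \<Longrightarrow>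
       (\<lambda>n. outer_expectation M (\<lambda>\<omega>. h (Y n \<omega>))) \<longlonglongrightarrow> integral\<^sup>L L h"
  shows "weakly_converges_to M m Y L"
  unfolding weakly_converges_to_def
proof (intro conjI allI impI ballI Y L sL)
  interpret L: prob_space L by fact
  have spL: "space L = mspace m" using sets_eq_imp_space_eq[OF sL] by simp
  fix h :: "'a \<Rightarrow> real"
  assume "continuous_map (mtopology_of m) euclideanreal h \<and> bounded (h ` mspace m)"
  then have h: "continuous_map (mtopology_of m) euclideanreal h" and "bounded (h ` mspace m)" by auto
  then obtain b where b: "\<And>x. x \<in> mspace m \<Longrightarrow> \<bar>h x\<bar> \<le> b" by (auto simp: bounded_iff)
  have nh: "continuous_map (mtopology_of m) euclideanreal (\<lambda>x. - h x)"
    using h by (rule continuous_map_minus)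
  have nb: "\<And>x. x \<in> mspace m \<Longrightarrow> \<bar>- h x\<bar> \<le> b" using b by simp
  define lo where "lo j = inf_conv m (real j) h" for j
  define hi where "hi j x = - inf_conv m (real j) (\<lambda>x. - h x) x" for j x
  have lo_lip: "lipschitz_real m j (lo j)" for j
    unfolding lo_def using b by (rule lipschitz_inf_conv) auto
  have hi_lip: "lipschitz_real m j (hi j)" for j
    using lipschitz_inf_conv[where h="\<lambda>x. - h x" and b=b and m=m and j="real j"] nb unfolding hi_def lipschitz_real_def
    by (auto simp: abs_minus_commute)
  have lo_b: "\<bar>lo j x\<bar> \<le> b" "lo j x \<le> h x" if "x \<in> mspace m" for j x
    using inf_conv_bounded[of m h b "real j" x] inf_conv_le[of m h b "real j" x] b that by (auto simp: lo_def)
  have hi_b: "\<bar>hi j x\<bar> \<le> b" "h x \<le> hi j x" if "x \<in> mspace m" for j x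
    using inf_conv_bounded[of m "\<lambda>x. - h x" b "real j" x] inf_conv_le[of m "\<lambda>x. - h x" b "real j" x] nb that
    by (auto simp: hi_def)
  note meas = continuous_map_borel_measurable[OF _ sL]
  have lo_m: "lo j \<in> borel_measurable L" and hi_m: "hi j \<in> borel_measurable L" for j
    by (rule meas[OF lipschitz_real_continuous[OF lo_lip]], rule meas[OF lipschitz_real_continuous[OF hi_lip]])
  have "(\<lambda>j. integral\<^sup>L L (lo j)) \<longlonglongrightarrow> integral\<^sup>L L h"
  proof (rule integral_dominated_convergence[where w="\<lambda>_. b"])
    show "AE x in L. (\<lambda>j. lo j x) \<longlonglongrightarrow> h x"
      using inf_conv_tendsto[OF h b] by (intro AE_I2) (simp add: lo_def spL)
    show "AE x in L. norm (lo j x) \<le> b" for j using lo_b by (intro AE_I2) (simp add: spL)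
  qed (use meas[OF h] lo_m in auto)
  moreover have "(\<lambda>j. integral\<^sup>L L (hi j)) \<longlonglongrightarrow> integral\<^sup>L L h"
  proof (rule integral_dominated_convergence[where w="\<lambda>_. b"])
    show "AE x in L. (\<lambda>j. hi j x) \<longlonglongrightarrow> h x"
      using tendsto_minus[OF inf_conv_tendsto[OF nh nb]] by (intro AE_I2) (simp add: hi_def spL)
    show "AE x in L. norm (hi j x) \<le> b" for j using hi_b by (intro AE_I2) (simp add: spL)
  qed (use meas[OF h] hi_m in auto)
  ultimately have conv: "(\<lambda>j. integral\<^sup>L L (lo j)) \<longlonglongrightarrow> integral\<^sup>L L h" "(\<lambda>j. integral\<^sup>L L (hi j)) \<longlonglongrightarrow> integral\<^sup>L L h" .
  show "(\<lambda>n. outer_expectation M (\<lambda>\<omega>. h (Y n \<omega>))) \<longlonglongrightarrow> integral\<^sup>L L h"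
  proof (rule LIMSEQ_I)
    fix e :: real assume "e > 0"
    then have e2: "e / 2 > 0" by simp
    obtain j1 where j1: "\<bar>integral\<^sup>L L (lo j1) - integral\<^sup>L L h\<bar> < e / 2"
      using LIMSEQ_D[OF conv(1) e2] by (auto simp: real_norm_def)
    obtain j2 where j2: "\<bar>integral\<^sup>L L (hi j2) - integral\<^sup>L L h\<bar> < e / 2"
      using LIMSEQ_D[OF conv(2) e2] by (auto simp: real_norm_def)
    obtain n1 where n1: "\<And>n. n \<ge> n1 \<Longrightarrow> \<bar>outer_expectation M (\<lambda>\<omega>. lo j1 (Y n \<omega>)) - integral\<^sup>L L (lo j1)\<bar> < e / 2"
      using LIMSEQ_D[OF lip[OF lo_lip lo_b(1)] e2] by (auto simp: real_norm_def)
    obtain n2 where n2: "\<And>n. n \<ge> n2 \<Longrightarrow> \<bar>outer_expectation M (\<lambda>\<omega>. hi j2 (Y n \<omega>)) - integral\<^sup>L L (hi j2)\<bar> < e / 2"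
      using LIMSEQ_D[OF lip[OF hi_lip hi_b(1)] e2] by (auto simp: real_norm_def)
    show "\<exists>no. \<forall>n\<ge>no. norm (outer_expectation M (\<lambda>\<omega>. h (Y n \<omega>)) - integral\<^sup>L L h) < e"
    proof (intro exI allI impI)
      fix n assume n: "n \<ge> max n1 n2"
      have "outer_expectation M (\<lambda>\<omega>. lo j1 (Y n \<omega>)) \<le> outer_expectation M (\<lambda>\<omega>. h (Y n \<omega>))"
        using Y b lo_b by (intro outer_expectation_mono[OF M, where b=b]) auto
      moreover have "outer_expectation M (\<lambda>\<omega>. h (Y n \<omega>)) \<le> outer_expectation M (\<lambda>\<omega>. hi j2 (Y n \<omega>))"
        using Y b hi_b by (intro outer_expectation_mono[OF M, where b=b]) auto
      ultimately show "norm (outer_expectation M (\<lambda>\<omega>. h (Y n \<omega>)) - integral\<^sup>L L h) < e"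
        using n1[of n] n2[of n] n j1 j2 unfolding real_norm_def by linarith
    qed
  qed
qed

text \<open>Bounded Lipschitz functions detect all open sets, since each open set is the positivity
  set of its truncated distance to the complement; no separability is involved.\<close>

lemma measurable_metric_borelI:
  fixes m :: "'a metric"
  assumes Z: "\<And>\<omega>. \<omega> \<in> space N \<Longrightarrow> Z \<omega> \<in> mspace m"
    and lip: "\<And>h l b. lipschitz_real m l h \<Longrightarrow> (\<And>x. x \<in> mspace m \<Longrightarrow> \<bar>h x\<bar> \<le> b) \<Longrightarrow>
       (\<lambda>\<omega>. h (Z \<omega>)) \<in> borel_measurable N"
  shows "Z \<in> N \<rightarrow>\<^sub>M metric_borel m"
  unfolding metric_borel_def
proof (rule measurable_measure_of)
  interpret X: Metric_space "mspace m" "mdist m" by (rule Metric_space_mspace_mdist)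
  show "{U. openin (mtopology_of m) U} \<subseteq> Pow (mspace m)"
    using openin_subset[of "mtopology_of m"] by auto
  show "Z \<in> space N \<rightarrow> mspace m" using Z by auto
  fix U assume "U \<in> {U. openin (mtopology_of m) U}"
  then have U: "openin X.mtopology U" by (simp add: mtopology_of_def)
  \<comment> \<open>On the space this is the distance to the complement of \<open>U\<close>,
    truncated at 1.\<close>
  define h where "h = inf_conv m 1 (indicator U :: 'a \<Rightarrow> real)"
  have b: "\<bar>indicator U y :: real\<bar> \<le> 1" for y by (simp add: indicator_def)
  have pos: "0 < h x \<longleftrightarrow> x \<in> U" if x: "x \<in> mspace m" for x
  proof
    assume "0 < h x"
    then show "x \<in> U"
      using inf_conv_le[of m "indicator U" 1 1 x, OF b _ x] by (cases "x \<in> U") (auto simp: h_def)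
  next
    assume "x \<in> U"
    then obtain r where r: "r > 0" "X.mball x r \<subseteq> U" using U by (auto simp: X.openin_mtopology)
    have "min 1 r \<le> h x"
      unfolding h_def
    proof (rule inf_conv_greatest[OF b _ x])
      fix y assume y: "y \<in> mspace m"
      show "min 1 r \<le> indicator U y + 1 * mdist m x y"
      proof (cases "y \<in> U")
        case True then show ?thesis using mdist_nonneg[of m x y] by (simp add: min_le_iff_disj)
      next
        case False
        then have "\<not> mdist m x y < r" using r x y by auto
        then show ?thesis using False by simp
      qed
    qed simp
    then show "0 < h x" using r by linarith
  qed
  have "(\<lambda>\<omega>. h (Z \<omega>)) \<in> borel_measurable N"
    using lipschitz_inf_conv[of m "indicator U" 1 1, OF b] inf_conv_bounded[of m "indicator U" 1 1, OF b]
    unfolding h_def by (intro lip) auto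
  then have "{\<omega> \<in> space N. 0 < h (Z \<omega>)} \<in> sets N" by measurable
  moreover have "{\<omega> \<in> space N. 0 < h (Z \<omega>)} = Z -` U \<inter> space N"
    using pos Z by auto
  ultimately show "Z -` U \<inter> space N \<in> sets N" by simp
qed

text \<open>Ulam's argument. Separability is asked only of the values of \<open>Z\<close>, through
  the countable set \<open>D\<close>, because the target space itself may fail to be
  separable.\<close>

lemma tight_measure_distr:
  fixes m :: "'a metric"
  assumes N: "prob_space N" and Z: "Z \<in> N \<rightarrow>\<^sub>M metric_borel m" and compl: "mcomplete_of m"
    and D: "countable D" "D \<subseteq> mspace m" "D \<noteq> {}"
    and dense: "\<And>\<omega> e. \<omega> \<in> space N \<Longrightarrow> e > 0 \<Longrightarrow> \<exists>d\<in>D. mdist m d (Z \<omega>) < e"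
  shows "tight_measure m (distr N (metric_borel m) Z)"
  unfolding tight_measure_def
proof (intro allI impI)
  interpret N: prob_space N by fact
  interpret X: Metric_space "mspace m" "mdist m" by (rule Metric_space_mspace_mdist)
  fix e :: real assume e: "e > 0"
  define d where "d = from_nat_into D"
  have d: "d i \<in> mspace m" for i
    using from_nat_into[OF D(3)] D(2) by (auto simp: d_def)
  have dD: "\<exists>i. x = d i" if "x \<in> D" for x
    using from_nat_into_surj[OF D(1) that] by (auto simp: d_def)
  have ZM: "Z \<omega> \<in> mspace m" if "\<omega> \<in> space N" for \<omega>
    using measurable_space[OF Z that] by simp
  define B where "B j n = (\<Union>i\<le>n. X.mcball (d i) (1 / Suc j))" for j n :: nat
  have Bcl: "closedin (mtopology_of m) (B j n)" for j n
    unfolding B_def mtopology_of_def by (intro closedin_Union) auto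
  define A where "A j n = Z -` B j n \<inter> space N" for j n
  have A [measurable]: "A j n \<in> sets N" for j n
    unfolding A_def by (rule measurable_sets[OF Z sets_metric_borel_closed[OF Bcl]])
  \<comment> \<open>The losses \<open>e * (1/2) ^ Suc j\<close> over all \<open>j\<close> add up to
    exactly \<open>e\<close>.\<close>
  have "\<exists>n. N.prob (A j n) > 1 - e * (1/2) ^ Suc j" for j
  proof -
    have "incseq (A j)" by (auto simp: incseq_def A_def B_def intro: order_trans)
    then have "(\<lambda>n. N.prob (A j n)) \<longlonglongrightarrow> N.prob (\<Union>n. A j n)"
      by (intro N.finite_Lim_measure_incseq) auto
    moreover have "(\<Union>n. A j n) = space N"
    proof (intro equalityI subsetI)
      fix \<omega> assume \<omega>: "\<omega> \<in> space N"
      obtain i where "mdist m (d i) (Z \<omega>) < 1 / Suc j"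
        using dense[OF \<omega>, of "1 / Suc j"] dD by fastforce
      then have "\<omega> \<in> A j i" using \<omega> d ZM by (auto simp: A_def B_def intro!: bexI[of _ i])
      then show "\<omega> \<in> (\<Union>n. A j n)" by auto
    qed (auto simp: A_def)
    ultimately have "(\<lambda>n. N.prob (A j n)) \<longlonglongrightarrow> 1" by (simp add: N.prob_space)
    moreover have "1 - e * (1/2) ^ Suc j < 1" using e by simp
    ultimately have "\<forall>\<^sub>F n in sequentially. N.prob (A j n) > 1 - e * (1/2) ^ Suc j"
      by (rule order_tendstoD(1))
    then show ?thesis by (auto simp: eventually_sequentially)
  qed
  then obtain n where n: "\<And>j. N.prob (A j (n j)) > 1 - e * (1/2) ^ Suc j" by metis
  define K where "K = (\<Inter>j. B j (n j))"
  have Kcl: "closedin X.mtopology K"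
    unfolding K_def using Bcl by (intro closedin_Inter) (auto simp: mtopology_of_def)
  have "X.mtotally_bounded K"
    unfolding X.mtotally_bounded_def
  proof (intro allI impI)
    fix r :: real assume r: "r > 0"
    then obtain j where j: "2 / Suc j < r"
      using reals_Archimedean[of "r / 2"] by (auto simp: field_simps inverse_eq_divide)
    \<comment> \<open>Total boundedness asks for net points inside \<open>K\<close>. Each ball that
      meets \<open>K\<close> therefore gets a representative \<open>p i\<close> in \<open>K\<close>,
      which doubles the radius; hence the choice \<open>2 / Suc j < r\<close>.\<close>
    define I where "I = {i. i \<le> n j \<and> K \<inter> X.mcball (d i) (1 / Suc j) \<noteq> {}}"
    have "\<forall>i\<in>I. \<exists>x. x \<in> K \<inter> X.mcball (d i) (1 / Suc j)" by (auto simp: I_def)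
    then obtain p where p: "\<And>i. i \<in> I \<Longrightarrow> p i \<in> K \<inter> X.mcball (d i) (1 / Suc j)" by metis
    have "K \<subseteq> (\<Union>x\<in>p ` I. X.mball x r)"
    proof
      fix x assume x: "x \<in> K"
      then have "x \<in> B j (n j)" by (auto simp: K_def)
      then obtain i where i: "i \<le> n j" "x \<in> X.mcball (d i) (1 / Suc j)" by (auto simp: B_def)
      then have iI: "i \<in> I" using x by (auto simp: I_def)
      have "mdist m (p i) x \<le> mdist m (p i) (d i) + mdist m (d i) x"
        using p[OF iI] i d by (intro mdist_triangle) auto
      also have "\<dots> \<le> 1 / Suc j + 1 / Suc j"
        using p[OF iI] i by (intro add_mono) (auto simp: mdist_commute)
      also have "\<dots> < r" using j by simp
      finally show "x \<in> (\<Union>x\<in>p ` I. X.mball x r)"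
        using p[OF iI] i iI by auto
    qed
    moreover have "finite (p ` I)" by (auto simp: I_def)
    moreover have "p ` I \<subseteq> K" using p by auto
    ultimately show "\<exists>F. finite F \<and> F \<subseteq> K \<and> K \<subseteq> (\<Union>x\<in>F. X.mball x r)" by blast
  qed
  then have "compactin X.mtopology (X.mtopology closure_of K)"
    using X.mtotally_bounded_eq_compact_closure_of compl by (simp add: mcomplete_of_def)
  then have Kc: "compactin (mtopology_of m) K"
    using Kcl by (simp add: closure_of_closedin mtopology_of_def)
  have "N.prob (\<Union>j. space N - A j (n j)) \<le> (\<Sum>j. N.prob (space N - A j (n j)))"
  proof (rule N.finite_measure_subadditive_countably)
    show "summable (\<lambda>j. N.prob (space N - A j (n j)))"
    proof (rule summable_comparison_test')
      show "summable (\<lambda>j. e * (1/2) ^ Suc j)"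
        by (intro summable_mult summable_Suc_iff[THEN iffD2] summable_geometric) simp
      show "norm (N.prob (space N - A j (n j))) \<le> e * (1/2) ^ Suc j" if "j \<ge> 0" for j
        using n[of j] by (simp add: N.prob_compl)
    qed
  qed auto
  also have "\<dots> \<le> (\<Sum>j. e * (1/2) ^ Suc j)"
  proof (rule suminf_le)
    show sm: "summable (\<lambda>j. e * (1/2) ^ Suc j)"
      by (intro summable_mult summable_Suc_iff[THEN iffD2] summable_geometric) simp
    show le: "N.prob (space N - A j (n j)) \<le> e * (1/2) ^ Suc j" for j
      using n[of j] by (simp add: N.prob_compl)
    show "summable (\<lambda>j. N.prob (space N - A j (n j)))"
      by (rule summable_comparison_test'[OF sm, of 0]) (use le in simp)
  qed
  also have "\<dots> = e"
    using sums_mult[OF power_half_series, of e] by (simp add: sums_iff)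
  finally have "N.prob (\<Union>j. space N - A j (n j)) \<le> e" .
  moreover have "N.prob (\<Union>j. space N - A j (n j)) = 1 - N.prob (space N - (\<Union>j. space N - A j (n j)))"
    by (subst N.prob_compl) auto
  moreover have "space N - (\<Union>j. space N - A j (n j)) = Z -` K \<inter> space N"
    by (auto simp: A_def K_def)
  ultimately have "N.prob (Z -` K \<inter> space N) \<ge> 1 - e" by simp
  moreover have "measure (distr N (metric_borel m) Z) K = N.prob (Z -` K \<inter> space N)"
    using sets_metric_borel_closed[of m K] Kcl by (intro measure_distr Z) (simp add: mtopology_of_def)
  ultimately show "\<exists>K. compactin (mtopology_of m) K \<and> 1 - e \<le> measure (distr N (metric_borel m) Z) K"
    using Kc by auto
qed

section \<open>Classes with a Lipschitz entropy condition\<close>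

lemma maximal_inequality_normalized:
  fixes g :: "'j \<Rightarrow> 'b \<Rightarrow> real" and E :: "'b \<Rightarrow> real"
  assumes P: "prob_space P" and J: "finite J" "J \<noteq> {}"
    and g: "\<And>j. j \<in> J \<Longrightarrow> integrable P (g j)"
    and E: "E \<in> borel_measurable P" "integrable P (\<lambda>z. (E z)\<^sup>2)"
    and bnd: "\<And>j z. j \<in> J \<Longrightarrow> z \<in> space P \<Longrightarrow> \<bar>g j z\<bar> \<le> \<delta> * E z"
    and "\<delta> > 0" "n > 0"
  defines "Q \<equiv> PiM UNIV (\<lambda>_::nat. P)"
  shows "(\<integral>\<omega>. Max ((\<lambda>j. \<bar>(\<Sum>i<n. g j (\<omega> i) - (\<integral>z. g j z \<partial>P)) / sqrt n\<bar>) ` J) \<partial>Q)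
    \<le> 3 * \<delta> * sqrt (((\<integral>z. (E z)\<^sup>2 \<partial>P) + 1) * ln (2 * card J))"
proof -
  interpret Q: prob_space Q unfolding Q_def by (intro prob_space_PiM P)
  \<comment> \<open>The added 1 keeps \<open>W\<close>, and with it the denominator of
    \<open>l\<close>, positive even when \<open>E\<close> vanishes almost surely.\<close>
  define W where "W = (\<integral>z. (E z)\<^sup>2 \<partial>P) + 1"
  define A where "A = ln (2 * real (card J))"
  have W: "W > 0" "(\<integral>z. (E z)\<^sup>2 \<partial>P) \<le> W" by (auto simp: W_def intro: add_nonneg_pos)
  have "card J \<ge> 1" using J by (simp add: card_gt_0_iff Suc_le_eq)
  then have A: "A > 0" by (simp add: A_def)
  define a where "a = sqrt A"
  define w where "w = sqrt W"
  define s where "s = sqrt (real n)"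
  have pos: "a > 0" "w > 0" "s > 0" using A W \<open>n > 0\<close> by (auto simp: a_def w_def s_def)
  have sq: "A = a * a" "W = w * w" "real n = s * s"
    using A W \<open>n > 0\<close> by (simp_all add: a_def w_def s_def)
  \<comment> \<open>Balances the two terms of \<open>maximal_inequality\<close> up to a constant:
    they become \<open>2 * a * \<delta> * s * w\<close> and \<open>a * \<delta> * s * w\<close>,
    whence the factor 3 after division by \<open>s\<close>.\<close>
  define l where "l = a / (\<delta> * s * w)"
  have l: "l > 0" using pos \<open>\<delta> > 0\<close> by (simp add: l_def)
  have gi: "integrable Q (\<lambda>\<omega>. g j (\<omega> i))" if "j \<in> J" for j and i :: nat
    using PiM_coordinate(1)[OF P, of i UNIV "g j"] g[OF that] by (simp add: Q_def)
  have int: "integrable Q (\<lambda>\<omega>. \<Sum>i<n. g j (\<omega> i) - (\<integral>z. g j z \<partial>P))" if "j \<in> J" for j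
    by (intro Bochner_Integration.integrable_sum Bochner_Integration.integrable_diff gi that Q.integrable_const)
  have "(\<integral>\<omega>. Max ((\<lambda>j. \<bar>(\<Sum>i<n. g j (\<omega> i) - (\<integral>z. g j z \<partial>P)) / sqrt n\<bar>) ` J) \<partial>Q)
    \<le> (\<integral>\<omega>. Max ((\<lambda>j. \<bar>\<Sum>i<n. g j (\<omega> i) - (\<integral>z. g j z \<partial>P)\<bar>) ` J) / s \<partial>Q)"
  proof (rule integral_mono)
    show "integrable Q (\<lambda>\<omega>. Max ((\<lambda>j. \<bar>(\<Sum>i<n. g j (\<omega> i) - (\<integral>z. g j z \<partial>P)) / sqrt n\<bar>) ` J))"
      using int by (intro integrable_Max_abs J) auto
    show "integrable Q (\<lambda>\<omega>. Max ((\<lambda>j. \<bar>\<Sum>i<n. g j (\<omega> i) - (\<integral>z. g j z \<partial>P)\<bar>) ` J) / s)"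
      by (intro integrable_divide integrable_Max_abs J int)
    fix \<omega>
    show "Max ((\<lambda>j. \<bar>(\<Sum>i<n. g j (\<omega> i) - (\<integral>z. g j z \<partial>P)) / sqrt n\<bar>) ` J)
      \<le> Max ((\<lambda>j. \<bar>\<Sum>i<n. g j (\<omega> i) - (\<integral>z. g j z \<partial>P)\<bar>) ` J) / s"
    proof (rule Max.boundedI)
      fix x assume "x \<in> (\<lambda>j. \<bar>(\<Sum>i<n. g j (\<omega> i) - (\<integral>z. g j z \<partial>P)) / sqrt n\<bar>) ` J"
      then obtain j where j: "j \<in> J" "x = \<bar>\<Sum>i<n. g j (\<omega> i) - (\<integral>z. g j z \<partial>P)\<bar> / s"
        using pos by (auto simp: s_def abs_divide)
      then show "x \<le> Max ((\<lambda>j. \<bar>\<Sum>i<n. g j (\<omega> i) - (\<integral>z. g j z \<partial>P)\<bar>) ` J) / s"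
        using J pos by (auto intro!: divide_right_mono Max_ge)
    qed (use J in auto)
  qed
  also have "\<dots> = (\<integral>\<omega>. Max ((\<lambda>j. \<bar>\<Sum>i<n. g j (\<omega> i) - (\<integral>z. g j z \<partial>P)\<bar>) ` J) \<partial>Q) / s"
    by simp
  also have "\<dots> \<le> (l * (2 * n * \<delta>\<^sup>2 * (\<integral>z. (E z)\<^sup>2 \<partial>P)) + A / l) / s"
    unfolding A_def Q_def using pos maximal_inequality[OF P J g E bnd l, where n=n] by (intro divide_right_mono) auto
  also have "\<dots> \<le> (l * (2 * n * \<delta>\<^sup>2 * W) + A / l) / s"
    using l W(2) pos by (intro divide_right_mono add_mono mult_left_mono) auto
  also have "\<dots> = 3 * \<delta> * (w * a)"
    using pos \<open>\<delta> > 0\<close> unfolding sq(1,2) l_def by (simp add: field_simps power2_eq_square sq(3))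
  also have "w * a = sqrt (W * A)" by (simp add: w_def a_def real_sqrt_mult)
  finally show ?thesis by (simp add: W_def A_def)
qed

text \<open>What the limit theorem uses of the class of squared distances. The nets lie in
  \<open>F\<close>, so their members inherit its integrability. The projections are not nested:
  \<open>proj m f\<close> is chosen from \<open>f\<close>, not from
  \<open>proj (Suc m) f\<close>.\<close>

locale entropy_class = prob_space P for P :: "'b measure" +
  fixes F :: "('b \<Rightarrow> real) set" and E :: "'b \<Rightarrow> real"
    and proj :: "nat \<Rightarrow> ('b \<Rightarrow> real) \<Rightarrow> 'b \<Rightarrow> real"
  assumes F_ne: "F \<noteq> {}"
    and F_meas [measurable]: "\<And>f. f \<in> F \<Longrightarrow> f \<in> borel_measurable P"
    and F_sq: "\<And>f. f \<in> F \<Longrightarrow> integrable P (\<lambda>z. (f z)\<^sup>2)"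
    and E_meas [measurable]: "E \<in> borel_measurable P"
    and E_sq: "integrable P (\<lambda>z. (E z)\<^sup>2)"
    and proj_in: "\<And>m f. f \<in> F \<Longrightarrow> proj m f \<in> F"
    and proj_fin: "\<And>m. finite (proj m ` F)"
    and proj_err: "\<And>m f z. f \<in> F \<Longrightarrow> z \<in> space P \<Longrightarrow> \<bar>f z - proj m f z\<bar> \<le> (1/2) ^ m * E z"
    and entropy: "summable (\<lambda>m. (1/2) ^ m * sqrt (ln (card (proj m ` F))))"
begin

definition Q :: "(nat \<Rightarrow> 'b) measure" where
  "Q = PiM UNIV (\<lambda>_. P)"

definition emp :: "nat \<Rightarrow> (nat \<Rightarrow> 'b) \<Rightarrow> ('b \<Rightarrow> real) \<Rightarrow> real" where
  "emp n \<omega> f = (\<Sum>i<n. f (\<omega> i) - integral\<^sup>L P f) / sqrt n"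

sublocale Q: prob_space Q
  unfolding Q_def by (intro prob_space_PiM prob_space_axioms)

lemma space_Q: "\<omega> \<in> space Q \<Longrightarrow> \<omega> i \<in> space P"
  by (auto simp: Q_def space_PiM)

lemma F_int: "f \<in> F \<Longrightarrow> integrable P f"
  by (rule square_integrable_imp_integrable[OF F_meas F_sq])

lemma E_int: "integrable P E"
  by (rule square_integrable_imp_integrable[OF E_meas E_sq])

lemma E_nonneg: "z \<in> space P \<Longrightarrow> 0 \<le> E z"
  using F_ne proj_err[of _ z 0] by fastforce

lemma integrable_coordinate: "integrable P (f :: 'b \<Rightarrow> real) \<Longrightarrow> integrable Q (\<lambda>\<omega>. f (\<omega> i))"
  using PiM_coordinate(1)[OF prob_space_axioms, of i UNIV f] by (simp add: Q_def borel_measurable_integrable)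

lemma emp_int: "f \<in> F \<Longrightarrow> integrable Q (\<lambda>\<omega>. emp n \<omega> f)"
  unfolding emp_def
  by (intro integrable_divide Bochner_Integration.integrable_sum Bochner_Integration.integrable_diff
    Q.integrable_const integrable_coordinate F_int)

lemma emp_meas [measurable]: "f \<in> F \<Longrightarrow> (\<lambda>\<omega>. emp n \<omega> f) \<in> borel_measurable Q"
  using emp_int by (rule borel_measurable_integrable)

definition cent :: "('b \<Rightarrow> real) \<Rightarrow> 'b \<Rightarrow> real" where
  "cent f z = f z - integral\<^sup>L P f"

lemma cent_meas [measurable]: "f \<in> F \<Longrightarrow> cent f \<in> borel_measurable P"
  unfolding cent_def by measurable

lemma cent_mean: "f \<in> F \<Longrightarrow> integral\<^sup>L P (cent f) = 0"
  unfolding cent_def using F_int by (simp add: prob_space)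

lemma cent_int: "f \<in> F \<Longrightarrow> integrable P (cent f)"
  unfolding cent_def using F_int by simp

lemma cent_sq: "f \<in> F \<Longrightarrow> integrable P (\<lambda>z. (cent f z)\<^sup>2)"
  unfolding cent_def power2_diff using F_int F_sq by simp

lemma cent_mult:
  assumes "f \<in> F" "g \<in> F"
  shows "integrable P (\<lambda>z. cent f z * cent g z)"
proof (rule Bochner_Integration.integrable_bound)
  show "integrable P (\<lambda>z. (cent f z)\<^sup>2 + (cent g z)\<^sup>2)" using assms cent_sq by auto
  have "\<bar>a * b\<bar> \<le> a\<^sup>2 + b\<^sup>2" for a b :: real
  proof -
    have "2 * (\<bar>a\<bar> * \<bar>b\<bar>) \<le> a\<^sup>2 + b\<^sup>2"
      using zero_le_power2[of "\<bar>a\<bar> - \<bar>b\<bar>"] by (simp add: power2_diff)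
    then show ?thesis using sum_power2_ge_zero[of a b] unfolding abs_mult by linarith
  qed
  then show "AE z in P. norm (cent f z * cent g z) \<le> norm ((cent f z)\<^sup>2 + (cent g z)\<^sup>2)"
    by (intro AE_I2) simp
qed (use assms in measurable)

lemma cent_comb:
  assumes "finite A" "\<And>k. k \<in> A \<Longrightarrow> s k \<in> F"
  shows "(\<Sum>k\<in>A. u k * cent (s k) z)\<^sup>2 = (\<Sum>k\<in>A. \<Sum>l\<in>A. u k * u l * (cent (s k) z * cent (s l) z))"
    and "integrable P (\<lambda>z. (\<Sum>k\<in>A. u k * cent (s k) z)\<^sup>2)"
    and "(\<integral>z. (\<Sum>k\<in>A. u k * cent (s k) z)\<^sup>2 \<partial>P) =
      (\<Sum>k\<in>A. \<Sum>l\<in>A. u k * u l * (\<integral>z. cent (s k) z * cent (s l) z \<partial>P))"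
proof -
  show *: "(\<Sum>k\<in>A. u k * cent (s k) z)\<^sup>2 = (\<Sum>k\<in>A. \<Sum>l\<in>A. u k * u l * (cent (s k) z * cent (s l) z))" for z
    by (simp add: power2_eq_square sum_product mult_ac)
  show "integrable P (\<lambda>z. (\<Sum>k\<in>A. u k * cent (s k) z)\<^sup>2)"
    unfolding * using assms cent_mult by (intro Bochner_Integration.integrable_sum integrable_mult_right) auto
  show "(\<integral>z. (\<Sum>k\<in>A. u k * cent (s k) z)\<^sup>2 \<partial>P) =
      (\<Sum>k\<in>A. \<Sum>l\<in>A. u k * u l * (\<integral>z. cent (s k) z * cent (s l) z \<partial>P))"
    unfolding * using assms cent_mult
    by (subst Bochner_Integration.integral_sum, simp)
       (intro sum.cong refl, subst Bochner_Integration.integral_sum, auto)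
qed

lemma emp_comb:
  assumes "finite A"
  shows "(\<Sum>k\<in>A. u k * emp n \<omega> (s k)) = (\<Sum>i<n. \<Sum>k\<in>A. u k * cent (s k) (\<omega> i)) / sqrt n"
proof -
  have "(\<Sum>i<n. \<Sum>k\<in>A. u k * cent (s k) (\<omega> i)) = (\<Sum>k\<in>A. u k * (\<Sum>i<n. cent (s k) (\<omega> i)))"
    by (subst sum.swap) (simp add: sum_distrib_left)
  then show ?thesis by (simp add: emp_def cent_def flip: sum_divide_distrib)
qed

text \<open>By linearity the combination is the normalized sum of a single centred function along
  the sample, so \<open>clt_cos\<close> applies to it.\<close>

lemma emp_cos_tendsto:
  assumes A: "finite A" "\<And>k. k \<in> A \<Longrightarrow> s k \<in> F"
  shows "(\<lambda>n. \<integral>\<omega>. cos ((\<Sum>k\<in>A. u k * emp n \<omega> (s k)) + c) \<partial>Q)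
    \<longlonglongrightarrow> exp (- (\<integral>z. (\<Sum>k\<in>A. u k * cent (s k) z)\<^sup>2 \<partial>P) / 2) * cos c"
proof -
  have "(\<integral>z. (\<Sum>k\<in>A. u k * cent (s k) z) \<partial>P) = 0"
    using A cent_int cent_mean by (simp add: Bochner_Integration.integral_sum)
  moreover have "(\<lambda>z. \<Sum>k\<in>A. u k * cent (s k) z) \<in> borel_measurable P"
    using A by (intro borel_measurable_sum borel_measurable_times cent_meas) auto
  ultimately show ?thesis
    unfolding emp_comb[OF A(1)] Q_def by (intro clt_cos prob_space_axioms cent_comb(2) A)
qed

lemma emp_sq:
  assumes f: "f \<in> F"
  shows "integrable Q (\<lambda>\<omega>. (emp n \<omega> f)\<^sup>2)" "(\<integral>\<omega>. (emp n \<omega> f)\<^sup>2 \<partial>Q) \<le> (\<integral>z. (cent f z)\<^sup>2 \<partial>P)"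
proof -
  have eq: "(emp n \<omega> f)\<^sup>2 = (\<Sum>i<n. cent f (\<omega> i))\<^sup>2 / n" for \<omega>
    by (simp add: emp_def cent_def power_divide)
  note v = variance_iid_sum[OF prob_space_axioms cent_meas[OF f] cent_sq[OF f] cent_mean[OF f], where n=n, folded Q_def]
  show "integrable Q (\<lambda>\<omega>. (emp n \<omega> f)\<^sup>2)" unfolding eq using v(1) by simp
  \<comment> \<open>An inequality because of \<open>n = 0\<close>, where division by zero makes
    \<open>emp\<close> vanish; otherwise equality holds.\<close>
  show "(\<integral>\<omega>. (emp n \<omega> f)\<^sup>2 \<partial>Q) \<le> (\<integral>z. (cent f z)\<^sup>2 \<partial>P)"
    unfolding eq using v(2) by (cases "n = 0") auto
qed

section \<open>The Gaussian sequence indexed by the union of the nets\<close>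

definition net :: "('b \<Rightarrow> real) set" where
  "net = (\<Union>m. proj m ` F)"

text \<open>Numbering the countable union of the nets turns processes on it into real sequences, to
  which the finite-dimensional convergence and the Cholesky factorization apply.\<close>

definition elt :: "nat \<Rightarrow> 'b \<Rightarrow> real" where
  "elt = from_nat_into net"

definition idx :: "('b \<Rightarrow> real) \<Rightarrow> nat" where
  "idx = to_nat_on net"

lemma net: "countable net" "net \<noteq> {}" "net \<subseteq> F"
  using proj_in F_ne by (auto simp: net_def intro!: countable_UN countable_finite[OF proj_fin])

lemma elt_in: "elt i \<in> F"
  using from_nat_into[OF net(2)] net(3) by (auto simp: elt_def)

lemma elt_idx: "f \<in> F \<Longrightarrow> elt (idx (proj m f)) = proj m f"
  unfolding elt_def idx_def by (rule from_nat_into_to_nat_on[OF net(1)]) (auto simp: net_def)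

definition kernel :: "nat \<Rightarrow> nat \<Rightarrow> real" where
  "kernel i j = (\<integral>z. cent (elt i) z * cent (elt j) z \<partial>P)"

lemma kernel_sum:
  "finite A \<Longrightarrow> (\<Sum>i\<in>A. \<Sum>j\<in>A. u i * u j * kernel i j) = (\<integral>z. (\<Sum>i\<in>A. u i * cent (elt i) z)\<^sup>2 \<partial>P)"
  unfolding kernel_def using cent_comb(3)[of A elt u] elt_in by simp

lemma psd_kernel: "psd_kernel kernel"
  unfolding psd_kernel_def
proof (intro conjI allI impI)
  show "kernel i j = kernel j i" for i j by (simp add: kernel_def mult.commute)
qed (simp add: kernel_sum)

definition chol :: "nat \<Rightarrow> nat \<Rightarrow> real" where
  "chol = (SOME c. (\<forall>i m. m > i \<longrightarrow> c i m = 0) \<and> (\<forall>i j n. n > j \<longrightarrow> kernel i j = (\<Sum>m<n. c i m * c j m)))"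

lemma chol: "m > i \<Longrightarrow> chol i m = 0" "n > j \<Longrightarrow> kernel i j = (\<Sum>m<n. chol i m * chol j m)"
proof -
  have "\<exists>c. (\<forall>i m. m > i \<longrightarrow> c i m = 0) \<and> (\<forall>i j n. n > j \<longrightarrow> kernel i j = (\<Sum>m<n. c i m * c j m))"
    using psd_kernel_cholesky[OF psd_kernel] by metis
  from someI_ex[OF this, folded chol_def]
  show "m > i \<Longrightarrow> chol i m = 0" "n > j \<Longrightarrow> kernel i j = (\<Sum>m<n. chol i m * chol j m)" by auto
qed

definition N :: "(nat \<Rightarrow> real) measure" where
  "N = PiM UNIV (\<lambda>_. std_normal_distribution)"

definition gau :: "(nat \<Rightarrow> real) \<Rightarrow> nat \<Rightarrow> real" where
  "gau \<xi> i = (\<Sum>l<Suc i. chol i l * \<xi> l)"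

lemma prob_space_std_normal: "prob_space std_normal_distribution"
  using real_dist_normal_dist by (simp add: real_distribution_def)

sublocale N: prob_space N
  unfolding N_def by (intro prob_space_PiM prob_space_std_normal)

lemma component_N [measurable]: "(\<lambda>\<xi>. \<xi> l) \<in> borel_measurable N"
proof -
  have "(\<lambda>\<xi>. \<xi> l) \<in> N \<rightarrow>\<^sub>M std_normal_distribution"
    unfolding N_def by (rule measurable_component_singleton) simp
  moreover have "sets std_normal_distribution = sets borel" by simp
  ultimately show ?thesis using measurable_cong_sets by blast
qed

lemma gau_meas [measurable]: "(\<lambda>\<xi>. gau \<xi> i) \<in> borel_measurable N"
  unfolding gau_def by measurable

lemma gau_extend: "M > i \<Longrightarrow> gau \<xi> i = (\<Sum>l<M. chol i l * \<xi> l)"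
  unfolding gau_def by (rule sum.mono_neutral_left) (auto simp: chol)

lemma gau_sq: "integrable N (\<lambda>\<xi>. (gau \<xi> i)\<^sup>2)"
proof (rule Bochner_Integration.integrable_bound)
  have "integrable N (\<lambda>\<xi>. (\<xi> l)\<^sup>2)" for l
    using PiM_coordinate(1)[OF prob_space_std_normal, of l UNIV "\<lambda>x. x\<^sup>2"]
      integrable_std_normal_distribution_moment[of 2] by (simp add: N_def)
  then show "integrable N (\<lambda>\<xi>. Suc i * (\<Sum>l<Suc i. (chol i l)\<^sup>2 * (\<xi> l)\<^sup>2))" by auto
  have "(gau \<xi> i)\<^sup>2 \<le> Suc i * (\<Sum>l<Suc i. (chol i l)\<^sup>2 * (\<xi> l)\<^sup>2)" for \<xi>
    using sum_squared_le_sum_of_squares[of "\<lambda>l. chol i l * \<xi> l" "{..<Suc i}"]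
    by (simp add: gau_def power_mult_distrib mult.commute del: sum.lessThan_Suc)
  then show "AE \<xi> in N. norm ((gau \<xi> i)\<^sup>2) \<le> norm (Suc i * (\<Sum>l<Suc i. (chol i l)\<^sup>2 * (\<xi> l)\<^sup>2))"
    by (intro AE_I2) (simp add: sum_nonneg del: sum.lessThan_Suc)
qed measurable

text \<open>The right-hand side is the limit found in \<open>emp_cos_tendsto\<close>: the Cholesky
  factor gives the linear combination the variance prescribed by \<open>kernel\<close>.\<close>

lemma gau_cos:
  assumes I: "finite I"
  shows "(\<integral>\<xi>. cos ((\<Sum>i\<in>I. u i * gau \<xi> i) + c) \<partial>N)
    = exp (- (\<integral>z. (\<Sum>i\<in>I. u i * cent (elt i) z)\<^sup>2 \<partial>P) / 2) * cos c"
proof -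
  obtain M where M: "\<And>i. i \<in> I \<Longrightarrow> i < M" using I finite_nat_set_iff_bounded by auto
  have "(\<Sum>i\<in>I. u i * gau \<xi> i) = (\<Sum>l<M. (\<Sum>i\<in>I. u i * chol i l) * \<xi> l)" for \<xi>
  proof -
    have "(\<Sum>i\<in>I. u i * gau \<xi> i) = (\<Sum>i\<in>I. \<Sum>l<M. u i * chol i l * \<xi> l)"
      by (intro sum.cong refl) (simp add: gau_extend[OF M] sum_distrib_left mult.assoc)
    then show ?thesis by (subst (asm) sum.swap) (simp add: sum_distrib_right)
  qed
  moreover have "(\<Sum>l<M. (\<Sum>i\<in>I. u i * chol i l)\<^sup>2) = (\<Sum>i\<in>I. \<Sum>j\<in>I. u i * u j * kernel i j)"
  proof -
    have "(\<Sum>l<M. (\<Sum>i\<in>I. u i * chol i l)\<^sup>2) = (\<Sum>l<M. \<Sum>i\<in>I. \<Sum>j\<in>I. u i * u j * (chol i l * chol j l))"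
      by (simp add: power2_eq_square sum_product mult_ac)
    also have "\<dots> = (\<Sum>i\<in>I. \<Sum>l<M. \<Sum>j\<in>I. u i * u j * (chol i l * chol j l))"
      by (rule sum.swap)
    also have "\<dots> = (\<Sum>i\<in>I. \<Sum>j\<in>I. \<Sum>l<M. u i * u j * (chol i l * chol j l))"
      by (intro sum.cong refl sum.swap)
    also have "\<dots> = (\<Sum>i\<in>I. \<Sum>j\<in>I. u i * u j * kernel i j)"
      by (intro sum.cong refl) (simp add: chol(2)[OF M] sum_distrib_left)
    finally show ?thesis .
  qed
  ultimately show ?thesis
    using gaussian_sum_cos[of "\<lambda>l. \<Sum>i\<in>I. u i * chol i l" M c] kernel_sum[OF I, of u]
    by (simp add: N_def)
qed

lemma finite_dimensional:
  assumes I: "finite I" and lip: "\<And>x y. \<bar>g x - g y\<bar> \<le> L * (\<Sum>i\<in>I. \<bar>x i - y i\<bar>)" and "L \<ge> 0"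
    and bnd: "\<And>x. \<bar>g x\<bar> \<le> b"
  shows "(\<lambda>n. \<integral>\<omega>. g (\<lambda>i. emp n \<omega> (elt i)) \<partial>Q) \<longlonglongrightarrow> (\<integral>\<xi>. g (gau \<xi>) \<partial>N)"
proof (rule finite_dimensional_convergence[OF Q.prob_space_axioms N.prob_space_axioms I _ _ _ _ _ _ _ lip \<open>L \<ge> 0\<close> bnd])
  \<comment> \<open>\<open>finite_dimensional_convergence\<close> wants one bound for the second
    moments of both the sequence and its limit.\<close>
  define B where "B = (\<Sum>i\<in>I. (\<integral>z. (cent (elt i) z)\<^sup>2 \<partial>P) + (\<integral>\<xi>. (gau \<xi> i)\<^sup>2 \<partial>N))"
  have B: "(\<integral>z. (cent (elt i) z)\<^sup>2 \<partial>P) + (\<integral>\<xi>. (gau \<xi> i)\<^sup>2 \<partial>N) \<le> B" if "i \<in> I" for i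
    unfolding B_def using that I by (intro member_le_sum) auto
  show "(\<integral>\<omega>. (emp n \<omega> (elt i))\<^sup>2 \<partial>Q) \<le> B" if "i \<in> I" for n i
  proof -
    have "0 \<le> (\<integral>\<xi>. (gau \<xi> i)\<^sup>2 \<partial>N)" by simp
    then show ?thesis using B[OF that] emp_sq(2)[OF elt_in, of n i] by linarith
  qed
  show "(\<integral>\<xi>. (gau \<xi> i)\<^sup>2 \<partial>N) \<le> B" if "i \<in> I" for i
  proof -
    have "0 \<le> (\<integral>z. (cent (elt i) z)\<^sup>2 \<partial>P)" by simp
    then show ?thesis using B[OF that] by linarith
  qed
  show "(\<lambda>n. \<integral>\<omega>. cos ((\<Sum>i\<in>I. u i * emp n \<omega> (elt i)) + c) \<partial>Q) \<longlonglongrightarrow>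
     (\<integral>\<xi>. cos ((\<Sum>i\<in>I. u i * gau \<xi> i) + c) \<partial>N)" for u c
    unfolding gau_cos[OF I] by (rule emp_cos_tendsto[OF I elt_in])
qed (use emp_sq(1) gau_sq elt_in in auto)

end

section \<open>Chaining\<close>

context entropy_class
begin

text \<open>Only pairs arising from a common \<open>f\<close> are kept. Their members differ by a
  multiple of \<open>(1/2) ^ m * E\<close>, whereas arbitrary members of two nets need not be
  close.\<close>

definition links :: "nat \<Rightarrow> (('b \<Rightarrow> real) \<times> ('b \<Rightarrow> real)) set" where
  "links m = (\<lambda>f. (proj (Suc m) f, proj m f)) ` F"

definition jump :: "nat \<Rightarrow> nat \<Rightarrow> (nat \<Rightarrow> 'b) \<Rightarrow> real" where
  "jump n m \<omega> = Max ((\<lambda>(p, q). \<bar>emp n \<omega> p - emp n \<omega> q\<bar>) ` links m)"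

text \<open>The bound of \<open>maximal_inequality_normalized\<close> for the links of level
  \<open>m\<close>. Passing through \<open>f\<close>, the two projections differ by at most
  \<open>2 * (1/2) ^ m * E\<close>, so the factor 3 becomes 6.\<close>

definition rate :: "nat \<Rightarrow> real" where
  "rate m = 6 * (1/2) ^ m * sqrt (((\<integral>z. (E z)\<^sup>2 \<partial>P) + 1) * ln (2 * card (links m)))"

lemma links:
  "finite (links m)" "links m \<noteq> {}" "card (links m) \<le> card (proj (Suc m) ` F) * card (proj m ` F)"
proof -
  have sub: "links m \<subseteq> (proj (Suc m) ` F) \<times> (proj m ` F)" by (auto simp: links_def)
  have fin: "finite ((proj (Suc m) ` F) \<times> (proj m ` F))" using proj_fin by blast
  show "finite (links m)" using sub fin by (rule finite_subset)
  show "links m \<noteq> {}" using F_ne by (simp add: links_def)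
  show "card (links m) \<le> card (proj (Suc m) ` F) * card (proj m ` F)"
    using card_mono[OF fin sub] by (simp add: card_cartesian_product)
qed

lemma emp_diff:
  assumes "p \<in> F" "q \<in> F"
  shows "emp n \<omega> p - emp n \<omega> q = (\<Sum>i<n. (p (\<omega> i) - q (\<omega> i)) - (\<integral>z. p z - q z \<partial>P)) / sqrt n"
  using assms F_int by (simp add: emp_def sum_subtractf sum.distrib diff_divide_distrib[symmetric] algebra_simps)

lemma links_F: "pq \<in> links m \<Longrightarrow> fst pq \<in> F \<and> snd pq \<in> F"
  by (auto simp: links_def proj_in)

lemma jump_eq: "jump n m \<omega> = Max ((\<lambda>pq. \<bar>emp n \<omega> (fst pq) - emp n \<omega> (snd pq)\<bar>) ` links m)"
  by (simp add: jump_def case_prod_beta)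

lemma jump_int: "integrable Q (jump n m)"
  unfolding jump_eq using links_F by (intro integrable_Max_abs links Bochner_Integration.integrable_diff emp_int) auto

lemma rate_nonneg: "0 \<le> rate m"
proof -
  have "card (links m) \<ge> 1" using links[of m] by (simp add: card_gt_0_iff Suc_le_eq)
  then have "0 \<le> ln (2 * real (card (links m)))" by simp
  then show ?thesis unfolding rate_def by (intro mult_nonneg_nonneg real_sqrt_ge_zero) auto
qed

lemma jump_expectation: "(\<integral>\<omega>. jump n m \<omega> \<partial>Q) \<le> rate m"
proof (cases "n = 0")
  case True
  have "(\<lambda>pq. \<bar>emp 0 \<omega> (fst pq) - emp 0 \<omega> (snd pq)\<bar>) ` links m = {0}" for \<omega>
    using links(2)[of m] by (auto simp: emp_def)
  then show ?thesis using True rate_nonneg by (simp add: jump_eq)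
next
  case False
  define g where "g pq z = fst pq z - snd pq z" for pq :: "('b \<Rightarrow> real) \<times> ('b \<Rightarrow> real)" and z
  have g: "integrable P (g pq)" if "pq \<in> links m" for pq
    unfolding g_def using links_F[OF that] F_int by auto
  have bnd: "\<bar>g pq z\<bar> \<le> (2 * (1/2) ^ m) * E z" if pq: "pq \<in> links m" and z: "z \<in> space P" for pq z
  proof -
    obtain f where f: "f \<in> F" "pq = (proj (Suc m) f, proj m f)" using pq unfolding links_def by blast
    have "\<bar>f z - proj (Suc m) f z\<bar> \<le> (1/2) ^ Suc m * E z" "\<bar>f z - proj m f z\<bar> \<le> (1/2) ^ m * E z"
      using proj_err[OF f(1) z] by blast+
    moreover have "(1/2) ^ Suc m * E z \<le> (1/2) ^ m * E z"
      using E_nonneg[OF z] by (intro mult_right_mono) auto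
    ultimately have "\<bar>proj (Suc m) f z - proj m f z\<bar> \<le> 2 * ((1/2) ^ m * E z)" by linarith
    then show ?thesis by (simp add: g_def f)
  qed
  have eq: "jump n m \<omega> = Max ((\<lambda>pq. \<bar>(\<Sum>i<n. g pq (\<omega> i) - integral\<^sup>L P (g pq)) / sqrt n\<bar>) ` links m)" for \<omega>
    unfolding jump_eq using links_F by (intro arg_cong[where f=Max] image_cong refl) (simp add: emp_diff g_def[abs_def])
  have "(\<integral>\<omega>. jump n m \<omega> \<partial>Q) \<le> 3 * (2 * (1/2) ^ m) * sqrt (((\<integral>z. (E z)\<^sup>2 \<partial>P) + 1) * ln (2 * card (links m)))"
    unfolding eq Q_def using False
    by (intro maximal_inequality_normalized[OF prob_space_axioms links(1,2) g E_meas E_sq bnd]) auto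
  then show ?thesis by (simp add: rate_def)
qed

lemma rate_summable: "summable rate"
proof -
  define s where "s m = (1/2) ^ m * sqrt (ln (card (proj m ` F)))" for m
  have s: "summable s" using entropy by (simp add: s_def[abs_def])
  define W where "W = sqrt ((\<integral>z. (E z)\<^sup>2 \<partial>P) + 1)"
  have W: "W \<ge> 0" by (auto simp: W_def)
  have c: "card (proj m ` F) \<ge> 1" for m
    using proj_fin F_ne by (simp add: card_gt_0_iff Suc_le_eq)
  \<comment> \<open>The number of links is at most the product of two net sizes, and the square root
    is subadditive, so the logarithms separate. The coefficient 2 adapts the weight
    \<open>(1/2) ^ m\<close> to level \<open>Suc m\<close>.\<close>
  have le: "rate m \<le> 6 * W * ((1/2) ^ m * sqrt (ln 2) + (2 * s (Suc m) + s m))" for m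
  proof -
    let ?a = "real (card (proj (Suc m) ` F))" and ?b = "real (card (proj m ` F))"
    have ab: "?a \<ge> 1" "?b \<ge> 1" using c by (simp_all only: real_of_nat_ge_one_iff)
    have "card (links m) \<ge> 1" using links[of m] by (simp add: card_gt_0_iff Suc_le_eq)
    moreover have "real (card (links m)) \<le> ?a * ?b"
      using links(3)[of m] by (metis of_nat_le_iff of_nat_mult)
    ultimately have "ln (2 * real (card (links m))) \<le> ln (2 * (?a * ?b))"
      by (subst ln_le_cancel_iff) (auto intro: order_trans)
    also have "\<dots> = ln 2 + (ln ?a + ln ?b)"
      using ab by (subst ln_mult, simp, simp, subst ln_mult) auto
    finally have "sqrt (ln (2 * real (card (links m)))) \<le> sqrt (ln 2 + (ln ?a + ln ?b))" by simp
    also have "\<dots> \<le> sqrt (ln 2) + sqrt (ln ?a + ln ?b)"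
      using ab by (intro sqrt_add_le_add_sqrt) auto
    also have "\<dots> \<le> sqrt (ln 2) + (sqrt (ln ?a) + sqrt (ln ?b))"
      using ab by (intro add_left_mono sqrt_add_le_add_sqrt) auto
    finally have *: "sqrt (ln (2 * real (card (links m)))) \<le> sqrt (ln 2) + (sqrt (ln ?a) + sqrt (ln ?b))" .
    have "rate m = 6 * W * ((1/2) ^ m * sqrt (ln (2 * real (card (links m)))))"
      by (simp add: rate_def W_def real_sqrt_mult)
    also have "\<dots> \<le> 6 * W * ((1/2) ^ m * (sqrt (ln 2) + (sqrt (ln ?a) + sqrt (ln ?b))))"
      using * W by (intro mult_left_mono) auto
    also have "\<dots> = 6 * W * ((1/2) ^ m * sqrt (ln 2) + (2 * s (Suc m) + s m))"
      by (simp add: s_def algebra_simps)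
    finally show ?thesis .
  qed
  have "summable (\<lambda>m. 6 * W * ((1/2) ^ m * sqrt (ln 2) + (2 * s (Suc m) + s m)))"
    using s by (intro summable_mult summable_add summable_mult2 summable_geometric) (auto simp: summable_Suc_iff)
  then show ?thesis
    by (rule summable_comparison_test'[of _ 0]) (use le rate_nonneg in simp)
qed

definition tail :: "nat \<Rightarrow> real" where
  "tail m = (\<Sum>l. rate (l + m))"

lemma tail_tendsto: "tail \<longlonglongrightarrow> 0"
  unfolding tail_def using rate_summable by (rule suminf_exist_split2)

lemma sum_rate_le: "(\<Sum>l\<in>{m..<j}. rate l) \<le> tail m"
proof (cases "m \<le> j")
  case True
  have "(\<Sum>l\<in>{m..<j}. rate l) = (\<Sum>l<j - m. rate (l + m))"
    using True by (subst atLeast0LessThan[symmetric], subst sum.shift_bounds_nat_ivl[symmetric]) simp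
  also have "\<dots> \<le> tail m"
    unfolding tail_def using rate_summable rate_nonneg
    by (intro sum_le_suminf) (auto simp: summable_iff_shift)
  finally show ?thesis .
next
  case False
  then show ?thesis
    unfolding tail_def using rate_summable rate_nonneg
    by (auto intro!: suminf_nonneg simp: summable_iff_shift)
qed

text \<open>A crude integrable majorant for the end of a chain. Its mean grows like the square root
  of \<open>n\<close>, which is harmless because it is multiplied by \<open>(1/2) ^ j\<close> with
  \<open>j\<close> free.\<close>

definition total :: "nat \<Rightarrow> (nat \<Rightarrow> 'b) \<Rightarrow> real" where
  "total n \<omega> = (\<Sum>i<n. E (\<omega> i) + integral\<^sup>L P E) / sqrt n"

lemma total_int: "integrable Q (total n)"
  unfolding total_def
  by (intro integrable_divide Bochner_Integration.integrable_sum Bochner_Integration.integrable_add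
    Q.integrable_const integrable_coordinate E_int)

lemma emp_proj_le_total:
  assumes f: "f \<in> F" and \<omega>: "\<omega> \<in> space Q"
  shows "\<bar>emp n \<omega> f - emp n \<omega> (proj j f)\<bar> \<le> (1/2) ^ j * total n \<omega>"
proof -
  have "\<bar>\<integral>z. f z - proj j f z \<partial>P\<bar> \<le> (\<integral>z. \<bar>f z - proj j f z\<bar> \<partial>P)" by (rule integral_abs_bound)
  also have "\<dots> \<le> (\<integral>z. (1/2) ^ j * E z \<partial>P)"
    using f proj_in F_int E_int proj_err by (intro integral_mono) auto
  finally have i: "\<bar>\<integral>z. f z - proj j f z \<partial>P\<bar> \<le> (1/2) ^ j * integral\<^sup>L P E" by simp
  have "\<bar>\<Sum>i<n. (f (\<omega> i) - proj j f (\<omega> i)) - (\<integral>z. f z - proj j f z \<partial>P)\<bar>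
    \<le> (\<Sum>i<n. \<bar>(f (\<omega> i) - proj j f (\<omega> i)) - (\<integral>z. f z - proj j f z \<partial>P)\<bar>)"
    by (rule sum_abs)
  also have "\<dots> \<le> (\<Sum>i<n. (1/2) ^ j * (E (\<omega> i) + integral\<^sup>L P E))"
  proof (rule sum_mono)
    fix i
    show "\<bar>(f (\<omega> i) - proj j f (\<omega> i)) - (\<integral>z. f z - proj j f z \<partial>P)\<bar> \<le> (1/2) ^ j * (E (\<omega> i) + integral\<^sup>L P E)"
      using proj_err[OF f space_Q[OF \<omega>], of i j] i unfolding distrib_left by linarith
  qed
  also have "\<dots> = (1/2) ^ j * (\<Sum>i<n. E (\<omega> i) + integral\<^sup>L P E)" by (simp add: sum_distrib_left)
  finally have "\<bar>emp n \<omega> f - emp n \<omega> (proj j f)\<bar> \<le> (1/2) ^ j * (\<Sum>i<n. E (\<omega> i) + integral\<^sup>L P E) / sqrt n"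
    unfolding emp_diff[OF f proj_in[OF f]] by (simp add: abs_divide divide_right_mono)
  then show ?thesis by (simp add: total_def)
qed

lemma emp_chain:
  assumes f: "f \<in> F" and "m \<le> j"
  shows "\<bar>emp n \<omega> f - emp n \<omega> (proj m f)\<bar> \<le> (\<Sum>l\<in>{m..<j}. jump n l \<omega>) + \<bar>emp n \<omega> f - emp n \<omega> (proj j f)\<bar>"
  using \<open>m \<le> j\<close>
proof (induction j rule: dec_induct)
  case (step j)
  have "\<bar>emp n \<omega> (proj (Suc j) f) - emp n \<omega> (proj j f)\<bar> \<le> jump n j \<omega>"
    unfolding jump_def by (rule Max_ge) (use links(1)[of j] f in \<open>auto simp: links_def\<close>)
  then show ?case using step by (simp add: sum.atLeastLessThan_Suc)
qed simp

text \<open>Spreads a sequence of values on the net of level \<open>m\<close> to a function on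
  \<open>F\<close> that is constant on the fibres of \<open>proj m\<close>. Only the finitely many
  coordinates in \<open>block m\<close> matter, so functions of it fall under the finite-dimensional
  theory.\<close>

definition emb :: "nat \<Rightarrow> (nat \<Rightarrow> real) \<Rightarrow> ('b \<Rightarrow> real) \<Rightarrow> real" where
  "emb m x = (\<lambda>f\<in>F. x (idx (proj m f)))"

definition block :: "nat \<Rightarrow> nat set" where
  "block m = idx ` proj m ` F"

abbreviation emp_seq :: "nat \<Rightarrow> (nat \<Rightarrow> 'b) \<Rightarrow> nat \<Rightarrow> real" where
  "emp_seq n \<omega> \<equiv> (\<lambda>i. emp n \<omega> (elt i))"

lemma block_fin: "finite (block m)"
  by (simp add: block_def proj_fin)

lemma emb_mspace: "emb m x \<in> mspace (linfty F)"
proof -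
  have "emb m x ` F = x ` block m" by (auto simp: emb_def block_def image_image)
  then show ?thesis by (simp add: mspace_linfty emb_def[abs_def] finite_imp_bounded block_fin)
qed

lemma mdist_linfty_le:
  assumes "\<phi> \<in> mspace (linfty F)" "\<psi> \<in> mspace (linfty F)" "\<And>f. f \<in> F \<Longrightarrow> \<bar>\<phi> f - \<psi> f\<bar> \<le> a"
  shows "mdist (linfty F) \<phi> \<psi> \<le> a"
  using assms F_ne by (simp add: mdist_linfty cSUP_least)

lemma mdist_linfty_ge:
  assumes "\<phi> \<in> mspace (linfty F)" "\<psi> \<in> mspace (linfty F)" "f \<in> F"
  shows "\<bar>\<phi> f - \<psi> f\<bar> \<le> mdist (linfty F) \<phi> \<psi>"
proof -
  obtain a b where "\<And>f. f \<in> F \<Longrightarrow> \<bar>\<phi> f\<bar> \<le> a" "\<And>f. f \<in> F \<Longrightarrow> \<bar>\<psi> f\<bar> \<le> b"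
    using assms(1,2) by (auto simp: mspace_linfty bounded_iff)
  then have "\<bar>\<phi> g - \<psi> g\<bar> \<le> a + b" if "g \<in> F" for g
    using that abs_triangle_ineq4[of "\<phi> g" "\<psi> g"] by (meson add_mono order_trans)
  then have "bdd_above ((\<lambda>f. \<bar>\<phi> f - \<psi> f\<bar>) ` F)" by (auto intro!: bdd_aboveI2)
  then show ?thesis
    unfolding mdist_linfty[OF assms(1,2) F_ne] by (intro cSUP_upper assms)
qed

lemma emb_lipschitz: "mdist (linfty F) (emb m x) (emb m y) \<le> (\<Sum>i\<in>block m. \<bar>x i - y i\<bar>)"
proof (rule mdist_linfty_le[OF emb_mspace emb_mspace])
  fix f assume f: "f \<in> F"
  have "\<bar>x (idx (proj m f)) - y (idx (proj m f))\<bar> \<le> (\<Sum>i\<in>block m. \<bar>x i - y i\<bar>)"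
    using f block_fin by (intro member_le_sum) (auto simp: block_def)
  then show "\<bar>emb m x f - emb m y f\<bar> \<le> (\<Sum>i\<in>block m. \<bar>x i - y i\<bar>)"
    using f by (simp add: emb_def)
qed

lemma emb_emp: "f \<in> F \<Longrightarrow> emb m (emp_seq n \<omega>) f = emp n \<omega> (proj m f)"
  by (simp add: emb_def elt_idx)

lemma empirical_process_eq: "f \<in> F \<Longrightarrow> empirical_process P F n \<omega> f = emp n \<omega> f"
  by (simp add: empirical_process_def emp_def)

lemma empirical_process_mspace:
  assumes \<omega>: "\<omega> \<in> space Q"
  shows "empirical_process P F n \<omega> \<in> mspace (linfty F)"
proof -
  obtain b where b: "\<And>f. f \<in> F \<Longrightarrow> \<bar>emb 0 (emp_seq n \<omega>) f\<bar> \<le> b"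
    using emb_mspace[of 0 "emp_seq n \<omega>"] by (auto simp: mspace_linfty bounded_iff)
  have "\<bar>empirical_process P F n \<omega> f\<bar> \<le> b + total n \<omega>" if f: "f \<in> F" for f
    using b[OF f] emp_proj_le_total[OF f \<omega>, of n 0] f
    by (simp add: emb_emp empirical_process_eq)
  then show ?thesis
    by (auto simp: mspace_linfty bounded_iff empirical_process_def[abs_def] simp del: restrict_apply')
qed

lemma empirical_process_approx:
  assumes \<omega>: "\<omega> \<in> space Q" and "m \<le> j"
  shows "mdist (linfty F) (empirical_process P F n \<omega>) (emb m (emp_seq n \<omega>))
    \<le> (\<Sum>l\<in>{m..<j}. jump n l \<omega>) + (1/2) ^ j * total n \<omega>"
proof (rule mdist_linfty_le[OF empirical_process_mspace[OF \<omega>] emb_mspace])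
  fix f assume f: "f \<in> F"
  show "\<bar>empirical_process P F n \<omega> f - emb m (emp_seq n \<omega>) f\<bar>
    \<le> (\<Sum>l\<in>{m..<j}. jump n l \<omega>) + (1/2) ^ j * total n \<omega>"
    using emp_chain[OF f \<open>m \<le> j\<close>, of n \<omega>] emp_proj_le_total[OF f \<omega>, of n j] f
    by (simp add: emb_emp empirical_process_eq)
qed

lemma lipschitz_emb:
  assumes h: "lipschitz_real (linfty F) L h"
  shows "\<bar>h (emb m x) - h (emb m y)\<bar> \<le> L * (\<Sum>i\<in>block m. \<bar>x i - y i\<bar>)"
proof -
  have "\<bar>h (emb m x) - h (emb m y)\<bar> \<le> L * mdist (linfty F) (emb m x) (emb m y)"
    using h emb_mspace by (auto simp: lipschitz_real_def)
  also have "\<dots> \<le> L * (\<Sum>i\<in>block m. \<bar>x i - y i\<bar>)"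
    using h by (intro mult_left_mono emb_lipschitz) (auto simp: lipschitz_real_def)
  finally show ?thesis .
qed

text \<open>Asymptotic equicontinuity, with a bound free of \<open>n\<close>. The possibly
  nonmeasurable distance is replaced by the integrable majorant \<open>R\<close>, so the outer
  expectation is squeezed between ordinary integrals.\<close>

lemma outer_expectation_approx:
  assumes h: "lipschitz_real (linfty F) L h" and b: "\<And>x. x \<in> mspace (linfty F) \<Longrightarrow> \<bar>h x\<bar> \<le> b"
  shows "\<bar>outer_expectation Q (\<lambda>\<omega>. h (empirical_process P F n \<omega>)) - (\<integral>\<omega>. h (emb m (emp_seq n \<omega>)) \<partial>Q)\<bar> \<le> L * tail m"
proof -
  let ?o = "outer_expectation Q (\<lambda>\<omega>. h (empirical_process P F n \<omega>))"
  let ?i = "\<integral>\<omega>. h (emb m (emp_seq n \<omega>)) \<partial>Q"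
  have L: "L \<ge> 0" using h by (simp add: lipschitz_real_def)
  have hb: "\<bar>h (empirical_process P F n \<omega>)\<bar> \<le> b" if "\<omega> \<in> space Q" for \<omega>
    using b empirical_process_mspace[OF that] by auto
  have int: "integrable Q (\<lambda>\<omega>. h (emb m (emp_seq n \<omega>)))"
  proof (rule Q.integrable_const_bound[where B=b])
    show "(\<lambda>\<omega>. h (emb m (emp_seq n \<omega>))) \<in> borel_measurable Q"
      by (rule lipschitz_coordinates_measurable(2)[OF block_fin lipschitz_emb[OF h]]) (use elt_in in measurable)
  qed (use b emb_mspace in auto)
  have le: "\<bar>?o - ?i\<bar> \<le> L * (tail m + (1/2) ^ j * integral\<^sup>L Q (total n))" if j: "m \<le> j" for j
  proof -
    define R where "R \<omega> = (\<Sum>l\<in>{m..<j}. jump n l \<omega>) + (1/2) ^ j * total n \<omega>" for \<omega>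
    have intR: "integrable Q R" unfolding R_def using jump_int total_int by auto
    have "integral\<^sup>L Q R = (\<Sum>l\<in>{m..<j}. integral\<^sup>L Q (jump n l)) + (1/2) ^ j * integral\<^sup>L Q (total n)"
      unfolding R_def using jump_int total_int by (subst Bochner_Integration.integral_add) auto
    also have "\<dots> \<le> tail m + (1/2) ^ j * integral\<^sup>L Q (total n)"
      by (intro add_right_mono order_trans[OF sum_mono sum_rate_le] jump_expectation)
    finally have R: "L * integral\<^sup>L Q R \<le> L * (tail m + (1/2) ^ j * integral\<^sup>L Q (total n))"
      using L by (rule mult_left_mono)
    have pt: "\<bar>h (empirical_process P F n \<omega>) - h (emb m (emp_seq n \<omega>))\<bar> \<le> L * R \<omega>" if \<omega>: "\<omega> \<in> space Q" for \<omega>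
    proof -
      have "\<bar>h (empirical_process P F n \<omega>) - h (emb m (emp_seq n \<omega>))\<bar>
        \<le> L * mdist (linfty F) (empirical_process P F n \<omega>) (emb m (emp_seq n \<omega>))"
        using h emb_mspace empirical_process_mspace[OF \<omega>] by (auto simp: lipschitz_real_def)
      also have "\<dots> \<le> L * R \<omega>"
        unfolding R_def using L \<omega> j by (intro mult_left_mono empirical_process_approx)
      finally show ?thesis .
    qed
    have "?o \<le> (\<integral>\<omega>. h (emb m (emp_seq n \<omega>)) + L * R \<omega> \<partial>Q)"
    proof (rule outer_expectation_le[OF Q.prob_space_axioms hb])
      fix \<omega> assume "\<omega> \<in> space Q"
      then show "h (empirical_process P F n \<omega>) \<le> h (emb m (emp_seq n \<omega>)) + L * R \<omega>"
        using pt[of \<omega>] by linarith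
    qed (use int intR in auto)
    \<comment> \<open>Every integrable majorant of the empirical functional also dominates the
      measurable lower bound, hence so does the infimum of their integrals.\<close>
    moreover have "(\<integral>\<omega>. h (emb m (emp_seq n \<omega>)) - L * R \<omega> \<partial>Q) \<le> ?o"
    proof (rule outer_expectation_ge[OF Q.prob_space_axioms hb])
      fix U assume U: "integrable Q U" "\<And>\<omega>. \<omega> \<in> space Q \<Longrightarrow> h (empirical_process P F n \<omega>) \<le> U \<omega>"
      show "(\<integral>\<omega>. h (emb m (emp_seq n \<omega>)) - L * R \<omega> \<partial>Q) \<le> integral\<^sup>L Q U"
      proof (rule integral_mono)
        fix \<omega> assume "\<omega> \<in> space Q"
        then show "h (emb m (emp_seq n \<omega>)) - L * R \<omega> \<le> U \<omega>"
          using pt[of \<omega>] U(2)[of \<omega>] by linarith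
      qed (use int intR U in auto)
    qed auto
    ultimately have "\<bar>?o - ?i\<bar> \<le> L * integral\<^sup>L Q R"
      using int intR by (simp add: abs_le_iff)
    then show ?thesis using R by linarith
  qed
  \<comment> \<open>The sample size is fixed, so the remainder with \<open>total n\<close>
    disappears as the chain is refined.\<close>
  have "(\<lambda>j. (1/2::real) ^ j) \<longlonglongrightarrow> 0" by (rule LIMSEQ_realpow_zero) auto
  then have "(\<lambda>j. L * (tail m + (1/2) ^ j * integral\<^sup>L Q (total n))) \<longlonglongrightarrow> L * (tail m + 0 * integral\<^sup>L Q (total n))"
    by (intro tendsto_mult tendsto_add tendsto_const)
  then have "\<bar>?o - ?i\<bar> \<le> L * (tail m + 0 * integral\<^sup>L Q (total n))"
    by (rule LIMSEQ_le_const) (use le in blast)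
  then show ?thesis by simp
qed

end

section \<open>The Gaussian limit\<close>

text \<open>No moment of \<open>X\<close> is assumed. The cosine integrals fix the characteristic
  function, Levy uniqueness fixes the law, and the moments are then read off from that law.\<close>

lemma gaussian_rv_charI:
  assumes L: "prob_space L" and X [measurable]: "X \<in> borel_measurable L" and v: "v \<ge> 0"
    and cos: "\<And>t d. (\<integral>x. cos (t * X x + d) \<partial>L) = exp (- (t\<^sup>2 * v) / 2) * cos d"
  shows "gaussian_rv L X" "integral\<^sup>L L X = 0"
    "integrable L (\<lambda>x. (X x)\<^sup>2)" "(\<integral>x. (X x)\<^sup>2 \<partial>L) = v"
proof -
  interpret prob_space L by fact
  have char: "char (distr L borel (\<lambda>x. a * X x)) t = exp (- ((t * a)\<^sup>2 * v) / 2)" for a t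
  proof -
    have "char (distr L borel (\<lambda>x. a * X x)) t = (CLINT x|L. iexp ((t * a) * X x))"
      by (simp add: char_def integral_distr mult.assoc)
    \<comment> \<open>Phase 0 gives the real part and phase \<open>- (pi / 2)\<close> the imaginary
      part.\<close>
    also have "\<dots> = Complex (\<integral>x. cos ((t * a) * X x + 0) \<partial>L) (\<integral>x. cos ((t * a) * X x + (- (pi / 2))) \<partial>L)"
    proof (rule complex_eqI)
      have int: "integrable L (\<lambda>x. iexp ((t * a) * X x))"
        by (rule integrable_iexp) auto
      show "Re (CLINT x|L. iexp ((t * a) * X x)) =
        Re (Complex (\<integral>x. cos ((t * a) * X x + 0) \<partial>L) (\<integral>x. cos ((t * a) * X x + (- (pi / 2))) \<partial>L))"
        by (subst integral_Re[symmetric, OF int]) (simp add: Re_exp)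
      show "Im (CLINT x|L. iexp ((t * a) * X x)) =
        Im (Complex (\<integral>x. cos ((t * a) * X x + 0) \<partial>L) (\<integral>x. cos ((t * a) * X x + (- (pi / 2))) \<partial>L))"
        by (subst integral_Im[symmetric, OF int]) (simp add: Im_exp cos_diff)
    qed
    also have "\<dots> = exp (- ((t * a)\<^sup>2 * v) / 2)"
      unfolding cos by (simp add: complex_eq_iff Re_exp Im_exp)
    finally show ?thesis .
  qed
  have "gaussian_rv L X \<and> integral\<^sup>L L X = 0 \<and> integrable L (\<lambda>x. (X x)\<^sup>2) \<and> (\<integral>x. (X x)\<^sup>2 \<partial>L) = v"
  proof (cases "v = 0")
    case True
    have R: "real_distribution (return borel (0::real))"
      by (intro real_distribution.intro prob_space_return real_distribution_axioms.intro) auto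
    have "char (distr L borel X) = char (return borel 0)"
      using char[of 1] True by (auto simp: fun_eq_iff char_def integral_return)
    then have d: "distr L borel X = return borel 0"
      by (intro Levy_uniqueness R real_distribution_distr) auto
    have "AE y in distr L borel X. y = 0"
      unfolding d by (subst AE_return) auto
    then have ae: "AE x in L. X x = 0"
      by (subst (asm) AE_distr_iff) auto
    have "integrable L (\<lambda>x. (X x)\<^sup>2) \<longleftrightarrow> integrable L (\<lambda>x. 0::real)"
      using ae by (intro integrable_cong_AE) auto
    moreover have "(\<integral>x. (X x)\<^sup>2 \<partial>L) = (\<integral>x. 0 \<partial>L)"
      using ae by (intro integral_cong_AE) auto
    moreover have "integral\<^sup>L L X = (\<integral>x. 0 \<partial>L)"
      using ae by (intro integral_cong_AE) auto
    ultimately show ?thesis using ae True by (auto simp: gaussian_rv_def)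
  next
    case False
    define \<sigma> where "\<sigma> = sqrt v"
    have \<sigma>: "\<sigma> > 0" "\<sigma>\<^sup>2 = v" using v False by (auto simp: \<sigma>_def)
    have "char (distr L borel (\<lambda>x. (1 / \<sigma>) * X x)) t = char std_normal_distribution t" for t
    proof -
      have "(t * (1 / \<sigma>))\<^sup>2 * v = t\<^sup>2"
        using \<sigma>(1) by (simp add: \<sigma>(2)[symmetric] power_mult_distrib power_divide)
      then show ?thesis unfolding char char_std_normal_distribution by (simp add: exp_of_real)
    qed
    then have d: "distr L borel (\<lambda>x. (1 / \<sigma>) * X x) = std_normal_distribution"
      by (intro Levy_uniqueness real_dist_normal_dist real_distribution_distr) auto
    have "distr L lborel (\<lambda>x. (1 / \<sigma>) * X x) = distr L borel (\<lambda>x. (1 / \<sigma>) * X x)"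
      by (intro distr_cong) auto
    then have "distributed L lborel (\<lambda>x. (1 / \<sigma>) * X x) std_normal_density"
      using d by (simp add: distributed_def)
    then have D: "distributed L lborel X (normal_density 0 \<sigma>)"
      using normal_standard_normal_convert[of \<sigma> X 0] \<sigma> by simp
    have E: "expectation X = 0" by (rule normal_distributed_expectation[OF \<sigma>(1) D])
    have "variance X = \<sigma>\<^sup>2" by (rule normal_distributed_variance[OF \<sigma>(1) D])
    moreover have "integrable L (\<lambda>x. (X x)\<^sup>2)"
    proof -
      have "integrable lborel (\<lambda>x. normal_density 0 \<sigma> x * (x - 0) ^ 2)"
        by (rule integrable_normal_moment[OF \<sigma>(1)])
      then show ?thesis using distributed_integrable[OF D, of "\<lambda>x. x\<^sup>2"] \<sigma> by simp
    qed
    ultimately show ?thesis using D \<sigma> E by (auto simp: gaussian_rv_def)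
  qed
  then show "gaussian_rv L X" "integral\<^sup>L L X = 0" "integrable L (\<lambda>x. (X x)\<^sup>2)" "(\<integral>x. (X x)\<^sup>2 \<partial>L) = v"
    by auto
qed

text \<open>Summability forces the truncated distances below 1 eventually; from there on truncation
  has no effect and the distances themselves are summable.\<close>

lemma Cauchy_of_summable_min:
  fixes m :: "'a metric"
  assumes x: "\<And>n. x n \<in> mspace m" and s: "summable (\<lambda>n. min 1 (mdist m (x (Suc n)) (x n)))"
  shows "Metric_space.MCauchy (mspace m) (mdist m) x"
proof -
  interpret X: Metric_space "mspace m" "mdist m" by (rule Metric_space_mspace_mdist)
  define a where "a n = min 1 (mdist m (x (Suc n)) (x n))" for n
  have "a \<longlonglongrightarrow> 0" using summable_LIMSEQ_zero[OF s] by (simp add: a_def[abs_def])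
  then have "\<forall>\<^sub>F n in sequentially. a n < 1" by (rule order_tendstoD) simp
  then obtain n0 where n0: "\<And>n. n \<ge> n0 \<Longrightarrow> a n < 1" by (auto simp: eventually_sequentially)
  have le: "mdist m (x p) (x n) \<le> sum a {p..<n}" if "n0 \<le> p" "p \<le> n" for p n
    using that(2)
  proof (induction n rule: dec_induct)
    case base
    then show ?case using x by simp
  next
    case (step n)
    have "mdist m (x n) (x (Suc n)) = a n"
      using n0[of n] step that by (simp add: a_def mdist_commute min_def split: if_splits)
    moreover have "mdist m (x p) (x (Suc n)) \<le> mdist m (x p) (x n) + mdist m (x n) (x (Suc n))"
      by (intro mdist_triangle x)
    ultimately show ?case using step by (simp add: sum.atLeastLessThan_Suc)
  qed
  show ?thesis
    unfolding X.MCauchy_def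
  proof (intro conjI allI impI)
    fix e :: real assume "e > 0"
    moreover have "summable a" using s by (simp add: a_def[abs_def])
    ultimately obtain M where M: "\<And>p n. p \<ge> M \<Longrightarrow> norm (sum a {p..<n}) < e"
      unfolding summable_Cauchy by blast
    have *: "mdist m (x p) (x n) < e" if "max n0 M \<le> p" "p \<le> n" for p n
      using le[of p n] M[of p n] that by (auto simp: abs_less_iff)
    show "\<exists>M. \<forall>n n'. M \<le> n \<longrightarrow> M \<le> n' \<longrightarrow> mdist m (x n) (x n') < e"
    proof (intro exI[of _ "max n0 M"] allI impI)
      fix n n' assume "max n0 M \<le> n" "max n0 M \<le> n'"
      then show "mdist m (x n) (x n') < e"
        using *[of n n'] *[of n' n] by (cases "n \<le> n'") (auto simp: mdist_commute)
    qed
  qed (use x in auto)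
qed

lemma lipschitz_real_tendsto:
  assumes h: "lipschitz_real m l h" and "\<And>n. x n \<in> mspace m" "z \<in> mspace m"
    and lim: "(\<lambda>n. mdist m (x n) z) \<longlonglongrightarrow> 0"
  shows "(\<lambda>n. h (x n)) \<longlonglongrightarrow> h z"
proof -
  have "(\<lambda>n. l * mdist m (x n) z) \<longlonglongrightarrow> 0"
    by (rule tendsto_mult_right_zero[OF lim])
  moreover have "norm (h (x n) - h z) \<le> l * mdist m (x n) z" for n
    using assms by (auto simp: lipschitz_real_def)
  ultimately have "(\<lambda>n. h (x n) - h z) \<longlonglongrightarrow> 0"
    by (rule Lim_null_comparison[OF always_eventually[OF allI], rotated])
  then show ?thesis by (simp add: LIM_zero_iff)
qed

lemma mcomplete_linfty: "mcomplete_of (linfty F)"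
proof -
  \<comment> \<open>Completeness of the function space is stated for the packaged metric
    \<open>Met_TC.Self\<close>, while \<open>linfty\<close> is built from
    \<open>euclidean_metric\<close>; the two coincide.\<close>
  have "Met_TC.Self = (euclidean_metric :: real metric)"
    by (simp add: Met_TC.Self_def euclidean_metric_def)
  moreover have "Met_TC.mcomplete (TYPE(real))" 
    by (simp add: complete_UNIV)
  ultimately show ?thesis
    unfolding linfty_def using Met_TC.mcomplete_funspace by metis
qed

context entropy_class
begin

text \<open>The truncation at 1 makes this distance a bounded Lipschitz function of finitely many
  coordinates. Its mean under \<open>N\<close> is therefore the limit of the means for the empirical
  process, which \<open>jump_expectation\<close> bounds uniformly in \<open>n\<close>.\<close>

lemma step_expectation:
  "integrable N (\<lambda>\<xi>. min 1 (mdist (linfty F) (emb (Suc m) (gau \<xi>)) (emb m (gau \<xi>))))"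
  "(\<integral>\<xi>. min 1 (mdist (linfty F) (emb (Suc m) (gau \<xi>)) (emb m (gau \<xi>))) \<partial>N) \<le> rate m"
proof -
  define g where "g x = min 1 (mdist (linfty F) (emb (Suc m) x) (emb m x))" for x
  define I where "I = block m \<union> block (Suc m)"
  have I: "finite I" by (simp add: I_def block_fin)
  \<comment> \<open>The constant is 2 because each of the two embeddings contributes one coordinate
    sum.\<close>
  have lip: "\<bar>g x - g y\<bar> \<le> 2 * (\<Sum>i\<in>I. \<bar>x i - y i\<bar>)" for x y
  proof -
    have tri: "mdist (linfty F) (emb (Suc m) x) (emb m x) \<le> mdist (linfty F) (emb (Suc m) x) (emb (Suc m) y)
       + (mdist (linfty F) (emb (Suc m) y) (emb m y) + mdist (linfty F) (emb m y) (emb m x))" for x y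
      by (intro order_trans[OF mdist_triangle add_left_mono] mdist_triangle emb_mspace)
    have "\<bar>mdist (linfty F) (emb (Suc m) x) (emb m x) - mdist (linfty F) (emb (Suc m) y) (emb m y)\<bar>
      \<le> mdist (linfty F) (emb (Suc m) x) (emb (Suc m) y) + mdist (linfty F) (emb m x) (emb m y)"
      using tri[of x y] tri[of y x]
      by (simp add: abs_le_iff mdist_commute[of _ "emb (Suc m) y" "emb (Suc m) x"] mdist_commute[of _ "emb m y" "emb m x"])
    also have "\<dots> \<le> (\<Sum>i\<in>I. \<bar>x i - y i\<bar>) + (\<Sum>i\<in>I. \<bar>x i - y i\<bar>)"
      using I unfolding I_def
      by (intro add_mono order_trans[OF emb_lipschitz] sum_mono2) auto
    finally show ?thesis unfolding g_def by linarith
  qed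
  have b: "\<bar>g x\<bar> \<le> 1" for x by (simp add: g_def)
  have lim: "(\<lambda>n. \<integral>\<omega>. g (emp_seq n \<omega>) \<partial>Q) \<longlonglongrightarrow> (\<integral>\<xi>. g (gau \<xi>) \<partial>N)"
    by (rule finite_dimensional[OF I lip _ b]) simp
  have "(\<integral>\<omega>. g (emp_seq n \<omega>) \<partial>Q) \<le> rate m" for n
  proof -
    have "(\<integral>\<omega>. g (emp_seq n \<omega>) \<partial>Q) \<le> (\<integral>\<omega>. jump n m \<omega> \<partial>Q)"
    proof (rule integral_mono[OF Q.integrable_const_bound[where B=1] jump_int])
      show "(\<lambda>\<omega>. g (emp_seq n \<omega>)) \<in> borel_measurable Q"
        by (rule lipschitz_coordinates_measurable(2)[OF I lip]) (use elt_in in measurable)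
      fix \<omega> assume \<omega>: "\<omega> \<in> space Q"
      have "mdist (linfty F) (emb (Suc m) (emp_seq n \<omega>)) (emb m (emp_seq n \<omega>)) \<le> jump n m \<omega>"
      proof (rule mdist_linfty_le[OF emb_mspace emb_mspace])
        fix f assume f: "f \<in> F"
        show "\<bar>emb (Suc m) (emp_seq n \<omega>) f - emb m (emp_seq n \<omega>) f\<bar> \<le> jump n m \<omega>"
          unfolding jump_def emb_emp[OF f]
          by (rule Max_ge) (use links(1)[of m] f in \<open>auto simp: links_def\<close>)
      qed
      then show "g (emp_seq n \<omega>) \<le> jump n m \<omega>" by (simp add: g_def)
    qed (use b in auto)
    also have "\<dots> \<le> rate m" by (rule jump_expectation)
    finally show ?thesis .
  qed
  then have "(\<integral>\<xi>. g (gau \<xi>) \<partial>N) \<le> rate m"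
    by (intro LIMSEQ_le_const2[OF lim]) auto
  then show "(\<integral>\<xi>. min 1 (mdist (linfty F) (emb (Suc m) (gau \<xi>)) (emb m (gau \<xi>))) \<partial>N) \<le> rate m"
    by (simp add: g_def)
  have "integrable N (\<lambda>\<xi>. g (gau \<xi>))"
    by (rule N.integrable_const_bound[where B=1], use b in simp,
        rule lipschitz_coordinates_measurable(2)[OF I lip]) measurable
  then show "integrable N (\<lambda>\<xi>. min 1 (mdist (linfty F) (emb (Suc m) (gau \<xi>)) (emb m (gau \<xi>))))"
    by (simp add: g_def)
qed

text \<open>The truncated step lengths have a finite expected sum, so the sum is finite almost
  surely; completeness of \<open>linfty F\<close> supplies the limit.\<close>

lemma AE_limit:
  "AE \<xi> in N. \<exists>\<phi>\<in>mspace (linfty F). (\<lambda>m. mdist (linfty F) (emb m (gau \<xi>)) \<phi>) \<longlonglongrightarrow> 0"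
proof -
  define a where "a m \<xi> = min 1 (mdist (linfty F) (emb (Suc m) (gau \<xi>)) (emb m (gau \<xi>)))" for m \<xi>
  have a0: "0 \<le> a m \<xi>" for m \<xi> by (simp add: a_def)
  have am: "integrable N (a m)" for m using step_expectation(1)[of m] by (simp add: a_def[abs_def])
  have "(\<integral>\<^sup>+\<xi>. (\<Sum>m. ennreal (a m \<xi>)) \<partial>N) = (\<Sum>m. \<integral>\<^sup>+\<xi>. ennreal (a m \<xi>) \<partial>N)"
    using am by (intro nn_integral_suminf) auto
  also have "\<dots> = (\<Sum>m. ennreal (integral\<^sup>L N (a m)))"
    using am a0 by (intro suminf_cong nn_integral_eq_integral) auto
  also have "\<dots> \<le> (\<Sum>m. ennreal (rate m))"
    using step_expectation(2) by (intro suminf_le ennreal_leI) (auto simp: a_def[abs_def])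
  also have "\<dots> < top"
    using ennreal_suminf_neq_top[OF rate_summable rate_nonneg] by (simp add: less_top)
  finally have "AE \<xi> in N. (\<Sum>m. ennreal (a m \<xi>)) \<noteq> \<infinity>"
    using am by (intro nn_integral_PInf_AE) auto
  then show ?thesis
  proof eventually_elim
    case (elim \<xi>)
    interpret X: Metric_space "mspace (linfty F)" "mdist (linfty F)" by (rule Metric_space_mspace_mdist)
    have "summable (\<lambda>m. a m \<xi>)" using elim a0 by (intro summable_suminf_not_top) auto
    then have "X.MCauchy (\<lambda>m. emb m (gau \<xi>))"
      by (intro Cauchy_of_summable_min emb_mspace) (simp add: a_def)
    then obtain \<phi> where "limitin X.mtopology (\<lambda>m. emb m (gau \<xi>)) \<phi> sequentially"
      using mcomplete_linfty[of F] by (auto simp: mcomplete_of_def X.mcomplete_def)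
    then have "\<phi> \<in> mspace (linfty F)" "\<forall>e>0. \<exists>N. \<forall>n\<ge>N. mdist (linfty F) (emb n (gau \<xi>)) \<phi> < e"
      unfolding X.limit_metric_sequentially by blast+
    then show ?case
      unfolding lim_sequentially dist_real_def by (intro bexI[of _ \<phi>]) simp_all
  qed
qed

lemma gaussian_limit:
  obtains Z where "Z \<in> N \<rightarrow>\<^sub>M metric_borel (linfty F)"
    and "\<And>\<xi>. \<xi> \<in> space N \<Longrightarrow> Z \<xi> \<in> mspace (linfty F)"
    and "AE \<xi> in N. (\<lambda>m. mdist (linfty F) (emb m (gau \<xi>)) (Z \<xi>)) \<longlonglongrightarrow> 0"
    and "\<And>\<xi> e. e > 0 \<Longrightarrow> \<exists>m x. mdist (linfty F) (emb m x) (Z \<xi>) < e"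
proof -
  let ?conv = "\<lambda>\<xi> \<phi>. \<phi> \<in> mspace (linfty F) \<and> (\<lambda>m. mdist (linfty F) (emb m (gau \<xi>)) \<phi>) \<longlonglongrightarrow> 0"
  have "AE \<xi> in N. \<exists>\<phi>. ?conv \<xi> \<phi>" using AE_limit by (simp add: Bex_def)
  then obtain A where sub: "{\<xi> \<in> space N. \<not> (\<exists>\<phi>. ?conv \<xi> \<phi>)} \<subseteq> A"
    and A: "emeasure N A = 0" "A \<in> sets N"
    by (rule AE_E)
  then have ex: "\<exists>\<phi>. ?conv \<xi> \<phi>" if "\<xi> \<in> space N" "\<xi> \<notin> A" for \<xi> using that by blast
  \<comment> \<open>On the measurable null set \<open>A\<close> the zero function is used. This
    keeps every value of \<open>Z\<close>, not merely almost every one, in the closure of the ranges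
    of \<open>emb\<close>, as the tightness argument requires.\<close>
  define Z where "Z \<xi> = (if \<xi> \<in> space N - A then SOME \<phi>. ?conv \<xi> \<phi> else emb 0 (\<lambda>_. 0))" for \<xi>
  have good: "?conv \<xi> (Z \<xi>)" if "\<xi> \<in> space N" "\<xi> \<notin> A" for \<xi>
    using someI_ex[OF ex[OF that]] that by (simp add: Z_def)
  have bad: "Z \<xi> = emb 0 (\<lambda>_. 0)" if "\<xi> \<notin> space N - A" for \<xi> using that by (auto simp: Z_def)
  have Zin: "Z \<xi> \<in> mspace (linfty F)" for \<xi>
    using good[of \<xi>] bad[of \<xi>] emb_mspace by (cases "\<xi> \<in> space N - A") auto
  show ?thesis
  proof (rule that[of Z])
    show "Z \<in> N \<rightarrow>\<^sub>M metric_borel (linfty F)"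
    proof (rule measurable_metric_borelI[OF Zin])
      fix h l b assume h: "lipschitz_real (linfty F) l h"
      show "(\<lambda>\<xi>. h (Z \<xi>)) \<in> borel_measurable N"
      \<comment> \<open>The use of \<open>SOME\<close> does not endanger measurability: off
        \<open>A\<close>, \<open>h (Z \<xi>)\<close> is a pointwise limit of functions of finitely
        many Gaussian coordinates.\<close>
      proof (rule borel_measurable_LIMSEQ_real)
        fix \<xi> assume \<xi>: "\<xi> \<in> space N"
        show "(\<lambda>m. if \<xi> \<in> A then h (emb 0 (\<lambda>_. 0)) else h (emb m (gau \<xi>))) \<longlonglongrightarrow> h (Z \<xi>)"
        proof (cases "\<xi> \<in> A")
          case False
          have "(\<lambda>m. h (emb m (gau \<xi>))) \<longlonglongrightarrow> h (Z \<xi>)"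
            by (rule lipschitz_real_tendsto[OF h emb_mspace Zin]) (use good[OF \<xi> False] in simp)
          then show ?thesis using False by simp
        qed (simp add: bad)
      next
        fix m
        have "(\<lambda>\<xi>. h (emb m (gau \<xi>))) \<in> borel_measurable N"
          by (rule lipschitz_coordinates_measurable(2)[OF block_fin lipschitz_emb[OF h]]) measurable
        then show "(\<lambda>\<xi>. if \<xi> \<in> A then h (emb 0 (\<lambda>_. 0)) else h (emb m (gau \<xi>))) \<in> borel_measurable N"
          using A(2) by measurable
      qed
    qed
    show "AE \<xi> in N. (\<lambda>m. mdist (linfty F) (emb m (gau \<xi>)) (Z \<xi>)) \<longlonglongrightarrow> 0"
      using A good by (intro AE_I[of _ _ A]) auto
    show "\<exists>m x. mdist (linfty F) (emb m x) (Z \<xi>) < e" if "e > 0" for \<xi> e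
    proof (cases "\<xi> \<in> space N - A")
      case True
      then have "\<forall>\<^sub>F m in sequentially. mdist (linfty F) (emb m (gau \<xi>)) (Z \<xi>) < e"
        using good[of \<xi>] that by (intro order_tendstoD(2)) auto
      then show ?thesis by (auto simp: eventually_sequentially)
    next
      case False
      have "mdist (linfty F) (emb 0 (\<lambda>_. 0)) (emb 0 (\<lambda>_. 0)) = 0" using emb_mspace by simp
      then show ?thesis using bad[OF False] that by (intro exI[of _ 0] exI[of _ "\<lambda>_. 0"]) simp
    qed
  qed (rule Zin)
qed

text \<open>Finite rational lists, padded with zeros, give a countable set that is dense in the
  union of the ranges of \<open>emb\<close>, though not necessarily in
  \<open>linfty F\<close>.\<close>

lemma rational_dense:
  defines "D \<equiv> range (\<lambda>(m, qs). emb m (\<lambda>i. if i < length qs then real_of_rat (qs ! i) else 0))"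
  shows "countable D" "D \<noteq> {}" "D \<subseteq> mspace (linfty F)"
    "\<And>e m x. e > 0 \<Longrightarrow> \<exists>d\<in>D. mdist (linfty F) d (emb m x) < e"
proof -
  show "countable D" "D \<noteq> {}" "D \<subseteq> mspace (linfty F)"
    using emb_mspace by (auto simp: D_def)
  fix e :: real and m and x :: "nat \<Rightarrow> real" assume e: "e > 0"
  \<comment> \<open>Adding 1 to the cardinality makes the final bound strict and avoids an empty
    denominator.\<close>
  define \<delta> where "\<delta> = e / (card (block m) + 1)"
  have \<delta>: "\<delta> > 0" using e by (simp add: \<delta>_def)
  obtain K where K: "\<And>i. i \<in> block m \<Longrightarrow> i < K" using block_fin[of m] finite_nat_set_iff_bounded by auto
  have "\<exists>q. \<bar>real_of_rat q - x i\<bar> < \<delta>" for i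
  proof -
    obtain q where "x i - \<delta> < real_of_rat q" "real_of_rat q < x i + \<delta>"
      using of_rat_dense[of "x i - \<delta>" "x i + \<delta>"] \<delta> by auto
    then have "\<bar>real_of_rat q - x i\<bar> < \<delta>" by linarith
    then show ?thesis ..
  qed
  then obtain q where q: "\<And>i. \<bar>real_of_rat (q i) - x i\<bar> < \<delta>" by metis
  define y where "y = (\<lambda>i. if i < length (map q [0..<K]) then real_of_rat (map q [0..<K] ! i) else 0)"
  have "mdist (linfty F) (emb m y) (emb m x) \<le> (\<Sum>i\<in>block m. \<bar>y i - x i\<bar>)" by (rule emb_lipschitz)
  also have "\<dots> \<le> (\<Sum>i\<in>block m. \<delta>)"
    using q K by (intro sum_mono) (auto simp: y_def less_imp_le)
  also have "\<dots> < e"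
    using e by (simp add: \<delta>_def field_simps)
  finally have "mdist (linfty F) (emb m y) (emb m x) < e" .
  moreover have "emb m y \<in> D" unfolding D_def y_def by (intro image_eqI[of _ _ "(m, map q [0..<K])"]) auto
  ultimately show "\<exists>d\<in>D. mdist (linfty F) d (emb m x) < e" by blast
qed

text \<open>Three approximations compose: empirical process to level \<open>m\<close>, uniformly in
  \<open>n\<close>; level \<open>m\<close> of the empirical to level \<open>m\<close> of the
  Gaussian sequence, as \<open>n\<close> grows; Gaussian level \<open>m\<close> to \<open>Z\<close>,
  as \<open>m\<close> grows.\<close>

lemma weak_limit:
  obtains L where "prob_space L" "sets L = sets (metric_borel (linfty F))" "tight_measure (linfty F) L"
    "weakly_converges_to Q (linfty F) (empirical_process P F) L"
proof -
  obtain Z where Z: "Z \<in> N \<rightarrow>\<^sub>M metric_borel (linfty F)"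
    and Zin: "\<And>\<xi>. \<xi> \<in> space N \<Longrightarrow> Z \<xi> \<in> mspace (linfty F)"
    and lim: "AE \<xi> in N. (\<lambda>m. mdist (linfty F) (emb m (gau \<xi>)) (Z \<xi>)) \<longlonglongrightarrow> 0"
    and dense: "\<And>\<xi> e. e > 0 \<Longrightarrow> \<exists>m x. mdist (linfty F) (emb m x) (Z \<xi>) < e"
    by (rule gaussian_limit) blast
  define L where "L = distr N (metric_borel (linfty F)) Z"
  have pL: "prob_space L" unfolding L_def by (rule N.prob_space_distr[OF Z])
  have sL: "sets L = sets (metric_borel (linfty F))" by (simp add: L_def)
  have tight: "tight_measure (linfty F) L"
    unfolding L_def
  proof (rule tight_measure_distr[OF N.prob_space_axioms Z mcomplete_linfty rational_dense(1,3,2)])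
    fix \<xi> and e :: real assume \<xi>: "\<xi> \<in> space N" and e: "e > 0"
    obtain m x where mx: "mdist (linfty F) (emb m x) (Z \<xi>) < e / 2" using dense[of "e/2" \<xi>] e by auto
    obtain d where d: "d \<in> range (\<lambda>(m, qs). emb m (\<lambda>i. if i < length qs then real_of_rat (qs ! i) else 0))"
      "mdist (linfty F) d (emb m x) < e / 2" using rational_dense(4)[of "e/2" m x] e by auto
    have "mdist (linfty F) d (Z \<xi>) \<le> mdist (linfty F) d (emb m x) + mdist (linfty F) (emb m x) (Z \<xi>)"
      using rational_dense(3) d(1) by (intro mdist_triangle emb_mspace Zin \<xi>) auto
    then show "\<exists>d\<in>range (\<lambda>(m, qs). emb m (\<lambda>i. if i < length qs then real_of_rat (qs ! i) else 0)). mdist (linfty F) d (Z \<xi>) < e"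
      using d mx by (intro bexI[of _ d]) auto
  qed
  have "weakly_converges_to Q (linfty F) (empirical_process P F) L"
  proof (rule weakly_converges_to_lipschitzI[OF Q.prob_space_axioms pL sL empirical_process_mspace])
    fix h l b assume h: "lipschitz_real (linfty F) l h" and b: "\<And>x. x \<in> mspace (linfty F) \<Longrightarrow> \<bar>h x\<bar> \<le> b"
    have l: "l \<ge> 0" using h by (simp add: lipschitz_real_def)
    have hm: "h \<in> borel_measurable (metric_borel (linfty F))"
      by (rule continuous_map_borel_measurable[OF lipschitz_real_continuous[OF h] refl])
    have hL: "integral\<^sup>L L h = (\<integral>\<xi>. h (Z \<xi>) \<partial>N)"
      unfolding L_def by (rule integral_distr[OF Z hm])
    have gm: "(\<lambda>\<xi>. h (emb m (gau \<xi>))) \<in> borel_measurable N" for m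
      by (rule lipschitz_coordinates_measurable(2)[OF block_fin lipschitz_emb[OF h]]) measurable
    have c1: "(\<lambda>m. \<integral>\<xi>. h (emb m (gau \<xi>)) \<partial>N) \<longlonglongrightarrow> (\<integral>\<xi>. h (Z \<xi>) \<partial>N)"
    proof (rule integral_dominated_convergence[where w="\<lambda>_. b"])
      show "(\<lambda>\<xi>. h (Z \<xi>)) \<in> borel_measurable N" by (rule measurable_compose[OF Z hm])
      show "AE \<xi> in N. (\<lambda>m. h (emb m (gau \<xi>))) \<longlonglongrightarrow> h (Z \<xi>)"
        using lim AE_space
      proof eventually_elim
        case (elim \<xi>)
        show ?case
          by (rule lipschitz_real_tendsto[OF h emb_mspace Zin[OF elim(2)] elim(1)])
      qed
    qed (use gm b emb_mspace in auto)
    have c2: "(\<lambda>m. l * tail m) \<longlonglongrightarrow> 0" using tendsto_mult_right_zero tail_tendsto by blast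
    show "(\<lambda>n. outer_expectation Q (\<lambda>\<omega>. h (empirical_process P F n \<omega>))) \<longlonglongrightarrow> integral\<^sup>L L h"
    proof (rule LIMSEQ_I)
      fix e :: real assume "e > 0"
      then have e3: "e / 3 > 0" by simp
      have "\<forall>\<^sub>F m in sequentially. \<bar>(\<integral>\<xi>. h (emb m (gau \<xi>)) \<partial>N) - (\<integral>\<xi>. h (Z \<xi>) \<partial>N)\<bar> < e / 3"
        using tendstoD[OF c1 e3] by (simp add: dist_real_def)
      moreover have "\<forall>\<^sub>F m in sequentially. l * tail m < e / 3"
        using order_tendstoD(2)[OF c2 e3] .
      ultimately have "\<forall>\<^sub>F m in sequentially. \<bar>(\<integral>\<xi>. h (emb m (gau \<xi>)) \<partial>N) - (\<integral>\<xi>. h (Z \<xi>) \<partial>N)\<bar> < e / 3 \<and> l * tail m < e / 3"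
        by (rule eventually_conj)
      \<comment> \<open>The level is fixed before \<open>n\<close>; this is possible because the
        error \<open>l * tail m\<close> does not depend on \<open>n\<close>.\<close>
      then obtain m where m: "\<bar>(\<integral>\<xi>. h (emb m (gau \<xi>)) \<partial>N) - (\<integral>\<xi>. h (Z \<xi>) \<partial>N)\<bar> < e / 3" "l * tail m < e / 3"
        by (auto simp: eventually_sequentially)
      have "(\<lambda>n. \<integral>\<omega>. h (emb m (emp_seq n \<omega>)) \<partial>Q) \<longlonglongrightarrow> (\<integral>\<xi>. h (emb m (gau \<xi>)) \<partial>N)"
        using b emb_mspace by (intro finite_dimensional[OF block_fin lipschitz_emb[OF h] l]) auto
      from LIMSEQ_D[OF this e3] obtain n0 where n0:
        "\<And>n. n \<ge> n0 \<Longrightarrow> \<bar>(\<integral>\<omega>. h (emb m (emp_seq n \<omega>)) \<partial>Q) - (\<integral>\<xi>. h (emb m (gau \<xi>)) \<partial>N)\<bar> < e / 3"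
        by (auto simp: real_norm_def)
      show "\<exists>no. \<forall>n\<ge>no. norm (outer_expectation Q (\<lambda>\<omega>. h (empirical_process P F n \<omega>)) - integral\<^sup>L L h) < e"
      proof (intro exI allI impI)
        fix n assume "n \<ge> n0"
        then show "norm (outer_expectation Q (\<lambda>\<omega>. h (empirical_process P F n \<omega>)) - integral\<^sup>L L h) < e"
          using outer_expectation_approx[OF h b, of n m] m n0[of n] unfolding hL real_norm_def by linarith
      qed
    qed
  qed
  then show ?thesis using that[OF pL sL tight] by blast
qed

text \<open>A finite combination of evaluations is continuous on \<open>linfty F\<close>, so its
  cosines are admissible test functions. The functions are indexed by an arbitrary type so that a
  function may occur twice.\<close>

lemma weak_limit_combination:
  fixes A :: "'k set"
  assumes pL: "prob_space L" and sL: "sets L = sets (metric_borel (linfty F))"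
    and W: "weakly_converges_to Q (linfty F) (empirical_process P F) L"
    and A: "finite A" "\<And>k. k \<in> A \<Longrightarrow> s k \<in> F"
  shows "gaussian_rv L (\<lambda>\<phi>. \<Sum>k\<in>A. u k * \<phi> (s k))" "(\<integral>\<phi>. (\<Sum>k\<in>A. u k * \<phi> (s k)) \<partial>L) = 0"
    "integrable L (\<lambda>\<phi>. (\<Sum>k\<in>A. u k * \<phi> (s k))\<^sup>2)"
    "(\<integral>\<phi>. (\<Sum>k\<in>A. u k * \<phi> (s k))\<^sup>2 \<partial>L) = (\<integral>z. (\<Sum>k\<in>A. u k * cent (s k) z)\<^sup>2 \<partial>P)"
proof -
  interpret L: prob_space L by fact
  define X where "X \<phi> = (\<Sum>k\<in>A. u k * \<phi> (s k))" for \<phi>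
  define v where "v = (\<integral>z. (\<Sum>k\<in>A. u k * cent (s k) z)\<^sup>2 \<partial>P)"
  have "lipschitz_real (linfty F) (\<Sum>k\<in>A. \<bar>u k\<bar>) X"
    unfolding lipschitz_real_def
  proof (intro conjI ballI)
    fix \<phi> \<psi> assume ps: "\<phi> \<in> mspace (linfty F)" "\<psi> \<in> mspace (linfty F)"
    have "\<bar>X \<phi> - X \<psi>\<bar> = \<bar>\<Sum>k\<in>A. u k * (\<phi> (s k) - \<psi> (s k))\<bar>"
      by (simp add: X_def sum_subtractf right_diff_distrib)
    also have "\<dots> \<le> (\<Sum>k\<in>A. \<bar>u k\<bar> * \<bar>\<phi> (s k) - \<psi> (s k)\<bar>)"
      by (rule order_trans[OF sum_abs]) (simp add: abs_mult)
    also have "\<dots> \<le> (\<Sum>k\<in>A. \<bar>u k\<bar> * mdist (linfty F) \<phi> \<psi>)"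
      using A ps by (intro sum_mono mult_left_mono mdist_linfty_ge) auto
    finally show "\<bar>X \<phi> - X \<psi>\<bar> \<le> (\<Sum>k\<in>A. \<bar>u k\<bar>) * mdist (linfty F) \<phi> \<psi>"
      by (simp add: sum_distrib_right)
  qed (simp add: sum_nonneg)
  then have Xc: "continuous_map (mtopology_of (linfty F)) euclideanreal X"
    by (rule lipschitz_real_continuous)
  then have Xm [measurable]: "X \<in> borel_measurable L" by (rule continuous_map_borel_measurable[OF _ sL])
  have cosX: "L.expectation (\<lambda>\<phi>. cos (t * X \<phi> + d)) = exp (- (t\<^sup>2 * v) / 2) * cos d" for t d
  \<comment> \<open>The same sequence is evaluated twice: by weak convergence, and, since the
    functional is measurable on the sample space, by the central limit theorem.\<close>
  proof (rule LIMSEQ_unique)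
    have "continuous_map euclideanreal euclideanreal (\<lambda>x. cos (t * x + d))"
      by (auto intro!: continuous_intros)
    from continuous_map_compose[OF Xc this]
    have "continuous_map (mtopology_of (linfty F)) euclideanreal (\<lambda>\<phi>. cos (t * X \<phi> + d))"
      by (simp add: o_def)
    moreover have "bounded ((\<lambda>\<phi>. cos (t * X \<phi> + d)) ` mspace (linfty F))"
      by (auto simp: bounded_iff intro!: exI[of _ 1])
    ultimately show "(\<lambda>n. outer_expectation Q (\<lambda>\<omega>. cos (t * X (empirical_process P F n \<omega>) + d)))
        \<longlonglongrightarrow> L.expectation (\<lambda>\<phi>. cos (t * X \<phi> + d))"
      using W unfolding weakly_converges_to_def by blast
    have eq: "t * X (empirical_process P F n \<omega>) = (\<Sum>k\<in>A. (t * u k) * emp n \<omega> (s k))" for n \<omega>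
      using A by (simp add: X_def empirical_process_eq sum_distrib_left mult.assoc)
    have "outer_expectation Q (\<lambda>\<omega>. cos (t * X (empirical_process P F n \<omega>) + d)) =
        (\<integral>\<omega>. cos ((\<Sum>k\<in>A. (t * u k) * emp n \<omega> (s k)) + d) \<partial>Q)" for n
      unfolding eq
    proof (rule outer_expectation_eq[OF Q.prob_space_axioms, where b=1])
      have "(\<lambda>\<omega>. \<Sum>k\<in>A. (t * u k) * emp n \<omega> (s k)) \<in> borel_measurable Q"
        using A by (intro borel_measurable_sum borel_measurable_times emp_meas) auto
      then show "(\<lambda>\<omega>. cos ((\<Sum>k\<in>A. (t * u k) * emp n \<omega> (s k)) + d)) \<in> borel_measurable Q" by measurable
    qed auto
    moreover have "(\<integral>z. (\<Sum>k\<in>A. (t * u k) * cent (s k) z)\<^sup>2 \<partial>P) = t\<^sup>2 * v"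
      by (simp add: v_def mult.assoc sum_distrib_left[symmetric] power_mult_distrib)
    ultimately show "(\<lambda>n. outer_expectation Q (\<lambda>\<omega>. cos (t * X (empirical_process P F n \<omega>) + d)))
        \<longlonglongrightarrow> exp (- (t\<^sup>2 * v) / 2) * cos d"
      using emp_cos_tendsto[where A=A and s=s and u="\<lambda>k. t * u k" and c=d] A by simp
  qed
  have "v \<ge> 0" by (simp add: v_def)
  from gaussian_rv_charI[OF pL Xm this cosX, unfolded X_def v_def]
  show "gaussian_rv L (\<lambda>\<phi>. \<Sum>k\<in>A. u k * \<phi> (s k))" "(\<integral>\<phi>. (\<Sum>k\<in>A. u k * \<phi> (s k)) \<partial>L) = 0"
    "integrable L (\<lambda>\<phi>. (\<Sum>k\<in>A. u k * \<phi> (s k))\<^sup>2)"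
    "(\<integral>\<phi>. (\<Sum>k\<in>A. u k * \<phi> (s k))\<^sup>2 \<partial>L) = (\<integral>z. (\<Sum>k\<in>A. u k * cent (s k) z)\<^sup>2 \<partial>P)"
    by (simp_all only: X_def[abs_def])
qed

lemma brownian_bridge_weak_limit:
  assumes pL: "prob_space L" and sL: "sets L = sets (metric_borel (linfty F))"
    and W: "weakly_converges_to Q (linfty F) (empirical_process P F) L"
  shows "brownian_bridge P F L (\<lambda>f \<phi>. \<phi> f)"
proof -
  interpret L: prob_space L by fact
  note key = weak_limit_combination[OF assms]
  have single: "L.expectation (\<lambda>\<phi>. \<phi> f) = 0" "integrable L (\<lambda>\<phi>. (\<phi> f)\<^sup>2)"
    "L.expectation (\<lambda>\<phi>. (\<phi> f)\<^sup>2) = (\<integral>z. (cent f z)\<^sup>2 \<partial>P)" if "f \<in> F" for f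
    using key[of "{0::nat}" "\<lambda>_. f" "\<lambda>_. 1"] that by auto
  show ?thesis
    unfolding brownian_bridge_def gaussian_process_def
  proof (intro conjI allI ballI impI)
    fix J c assume "finite J \<and> J \<subseteq> F"
    then show "gaussian_rv L (\<lambda>\<phi>. \<Sum>f\<in>J. c f * \<phi> f)"
      using key[of J "\<lambda>f. f" c] by auto
  next
    fix f g assume fg: "f \<in> F" "g \<in> F"
    \<comment> \<open>Indexing by 0 and 1 instead of by the set of the two functions also covers
      \<open>f = g\<close>.\<close>
    define s where "s k = (if k = (0::nat) then f else g)" for k
    have d: "integrable L (\<lambda>\<phi>. (\<phi> f + \<phi> g)\<^sup>2)"
      "L.expectation (\<lambda>\<phi>. (\<phi> f + \<phi> g)\<^sup>2) = (\<integral>z. (cent f z + cent g z)\<^sup>2 \<partial>P)"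
      using key[of "{0::nat, 1}" s "\<lambda>_. 1"] fg by (auto simp: s_def)
    \<comment> \<open>Polarization: covariances are recovered from the variances of single
      combinations.\<close>
    have "L.expectation (\<lambda>\<phi>. \<phi> f * \<phi> g) = L.expectation (\<lambda>\<phi>. ((\<phi> f + \<phi> g)\<^sup>2 - (\<phi> f)\<^sup>2 - (\<phi> g)\<^sup>2) / 2)"
      by (intro Bochner_Integration.integral_cong refl) (simp add: power2_eq_square algebra_simps)
    also have "\<dots> = ((\<integral>z. (cent f z + cent g z)\<^sup>2 \<partial>P) - (\<integral>z. (cent f z)\<^sup>2 \<partial>P) - (\<integral>z. (cent g z)\<^sup>2 \<partial>P)) / 2"
      using d single fg by simp
    also have "(\<integral>z. (cent f z + cent g z)\<^sup>2 \<partial>P) = (\<integral>z. (cent f z)\<^sup>2 \<partial>P) + (\<integral>z. (cent g z)\<^sup>2 \<partial>P) + 2 * (\<integral>z. cent f z * cent g z \<partial>P)"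
      using cent_sq cent_mult fg by (simp add: power2_sum mult.assoc)
    finally have "L.expectation (\<lambda>\<phi>. \<phi> f * \<phi> g) = (\<integral>z. cent f z * cent g z \<partial>P)" by simp
    also have "\<dots> = (\<integral>z. f z * g z \<partial>P) - integral\<^sup>L P f * integral\<^sup>L P g"
    proof -
      have int: "integrable P (\<lambda>z. f z * g z)"
      proof -
        have "f z * g z = cent f z * cent g z + (integral\<^sup>L P f * g z + integral\<^sup>L P g * f z - integral\<^sup>L P f * integral\<^sup>L P g)" for z
          by (simp add: cent_def algebra_simps)
        then show ?thesis using cent_mult[OF fg] F_int fg by simp
      qed
      have "cent f z * cent g z = f z * g z - (integral\<^sup>L P f * g z + integral\<^sup>L P g * f z - integral\<^sup>L P f * integral\<^sup>L P g)" for z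
        by (simp add: cent_def algebra_simps)
      then show ?thesis using int F_int fg by (simp add: prob_space)
    qed
    finally show "L.expectation (\<lambda>\<phi>. (\<phi> f - L.expectation (\<lambda>\<phi>. \<phi> f)) * (\<phi> g - L.expectation (\<lambda>\<phi>. \<phi> g))) =
        (\<integral>z. f z * g z \<partial>P) - integral\<^sup>L P f * integral\<^sup>L P g"
      using single fg by simp
  qed (use single in auto)
qed

lemma Donsker_entropy_class: "Donsker P F"
proof -
  obtain L where L: "prob_space L" "sets L = sets (metric_borel (linfty F))" "tight_measure (linfty F) L"
    "weakly_converges_to Q (linfty F) (empirical_process P F) L"
    by (rule weak_limit)
  have "square_integrable_class P F"
    using F_meas F_sq by (auto simp: square_integrable_class_def)
  then show ?thesis
    unfolding Donsker_def using L brownian_bridge_weak_limit[OF L(1,2,4)] by (auto simp: Q_def)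
qed

end

section \<open>Covering numbers\<close>

text \<open>Needed when \<open>C\<close> has fewer than \<open>k\<close> points. The function space
  then has a single element, and the limit is its point mass.\<close>

lemma Donsker_empty:
  assumes P: "prob_space P"
  shows "Donsker P {}"
proof -
  let ?m = "linfty ({} :: ('a \<Rightarrow> real) set)"
  define u where "u = (\<lambda>f :: 'a \<Rightarrow> real. undefined :: real)"
  define L where "L = return (metric_borel ?m) u"
  have sp: "mspace ?m = {u}" by (auto simp: mspace_linfty u_def)
  have pL: "prob_space L" unfolding L_def by (rule prob_space_return) (simp add: sp)
  interpret L: prob_space L by fact
  have spL: "space L = {u}" by (simp add: L_def sp)
  have sL: "sets L = sets (metric_borel ?m)" by (simp add: L_def)
  have int: "integral\<^sup>L L h = h u" for h :: "_ \<Rightarrow> real"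
  proof -
    have "integral\<^sup>L L h = (\<integral>x. h u \<partial>L)"
      by (rule Bochner_Integration.integral_cong) (auto simp: spL)
    then show ?thesis by (simp add: L.prob_space)
  qed
  have proc: "empirical_process P {} n x = u" for n x
    by (simp add: empirical_process_def u_def restrict_def)
  have "tight_measure ?m L"
    unfolding tight_measure_def
  proof (intro allI impI exI[of _ "{u}"] conjI)
    show "compactin (mtopology_of ?m) {u}" by (simp add: sp)
    show "measure L {u} \<ge> 1 - e" if "e > 0" for e :: real
      using that L.prob_space by (simp add: spL)
  qed
  moreover have "brownian_bridge P {} L (\<lambda>f \<phi>. \<phi> f)"
    by (auto simp: brownian_bridge_def gaussian_process_def gaussian_rv_def)
  moreover have "weakly_converges_to (Pi\<^sub>M UNIV (\<lambda>_::nat. P)) ?m (empirical_process P {}) L"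
    unfolding weakly_converges_to_def
  proof (intro conjI allI impI ballI pL sL)
    have pQ: "prob_space (Pi\<^sub>M UNIV (\<lambda>_::nat. P))" by (intro prob_space_PiM P)
    then interpret Q: prob_space "Pi\<^sub>M UNIV (\<lambda>_::nat. P)" .
    fix h :: "_ \<Rightarrow> real"
    have "outer_expectation (Pi\<^sub>M UNIV (\<lambda>_::nat. P)) (\<lambda>\<omega>. h u) = h u"
      by (subst outer_expectation_eq[OF pQ, where b="\<bar>h u\<bar>"]) (auto simp: Q.prob_space)
    then show "(\<lambda>n. outer_expectation (Pi\<^sub>M UNIV (\<lambda>_::nat. P)) (\<lambda>\<omega>. h (empirical_process P {} n \<omega>)))
      \<longlonglongrightarrow> integral\<^sup>L L h"
      by (simp add: proc int)
  qed (simp add: proc sp)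
  ultimately show ?thesis
    unfolding Donsker_def by (auto simp: square_integrable_class_def)
qed

lemma sqrt_log_mono: "n \<le> n' \<Longrightarrow> sqrt_log n \<le> sqrt_log n'"
proof (cases n; cases n')
  fix i j assume "n \<le> n'" "n = enat i" "n' = enat j"
  then show ?thesis by (cases "i = 0") (auto simp: sqrt_log_def intro!: ennreal_leI)
qed (auto simp: sqrt_log_def)

lemma covering_number_antimono:
  assumes "\<epsilon> \<le> \<delta>"
  shows "covering_number \<delta> C \<le> covering_number \<epsilon> C"
proof -
  have sub: "(\<Union>x\<in>S. ball x \<epsilon>) \<subseteq> (\<Union>x\<in>S. ball x \<delta>)" for S :: "'a set"
    using assms by (intro UN_mono subset_ball order_refl)
  show ?thesis
    unfolding covering_number_def
  proof (intro Inf_superset_mono subsetI, elim CollectE exE conjE)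
    fix i S assume "i = enat (card S)" "finite S" "C \<subseteq> (\<Union>x\<in>S. ball x \<epsilon>)"
    then show "i \<in> {enat (card S) |S. finite S \<and> C \<subseteq> (\<Union>x\<in>S. ball x \<delta>)}"
      using order_trans[OF _ sub[of S], of C] by auto
  qed
qed

text \<open>A finite value excludes an empty set of covers, and a nonempty set of extended naturals
  contains its infimum.\<close>

lemma covering_number_attained:
  assumes "covering_number \<epsilon> C = enat n"
  obtains S where "finite S" "card S = n" "C \<subseteq> (\<Union>x\<in>S. ball x \<epsilon>)"
proof -
  let ?A = "{enat (card S) |S. finite S \<and> C \<subseteq> (\<Union>x\<in>S. ball x \<epsilon>)}"
  have "?A \<noteq> {}"
    using assms unfolding covering_number_def by (metis Inf_enat_def enat.distinct(2))
  then have "Inf ?A \<in> ?A" unfolding Inf_enat_def by (auto intro: LeastI)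
  then show ?thesis
    using assms that unfolding covering_number_def by auto
qed

text \<open>On the interval \<open>A m\<close> the covering number is at least its value at the
  right end \<open>(1/2) ^ m\<close>, and the interval has length \<open>(1/2) ^ Suc m\<close>. The
  integral thus dominates the dyadic sum, and one infinite covering number would make it
  infinite.\<close>

lemma dyadic_entropy:
  assumes "(\<integral>\<^sup>+\<epsilon>\<in>{0<..1}. sqrt_log (covering_number \<epsilon> C) \<partial>lborel) < \<infinity>" (is "?I < \<infinity>")
  obtains n where "\<And>m. covering_number ((1/2) ^ m) C = enat (n m)"
    "summable (\<lambda>m. (1/2) ^ m * sqrt (ln (real (n m))))"
proof -
  define c where "c m = sqrt_log (covering_number ((1/2) ^ m) C)" for m
  define A where "A m = {(1/2::real) ^ Suc m <.. (1/2) ^ m}" for m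
  have disj: "m = l" if "x \<in> A m" "x \<in> A l" for m l x
  proof (rule ccontr)
    assume "m \<noteq> l"
    moreover have False if "x \<in> A m" "x \<in> A l" "m < l" for m l
    proof -
      have "(1/2::real) ^ l \<le> (1/2) ^ Suc m" using that by (intro power_decreasing) auto
      then show False using that unfolding A_def greaterThanAtMost_iff by linarith
    qed
    ultimately show False using that by (meson linorder_neqE_nat)
  qed
  have partial: "(\<Sum>m<k. ennreal ((1/2) ^ Suc m) * c m) \<le> ?I" for k
  proof -
    have "(\<Sum>m<k. ennreal ((1/2) ^ Suc m) * c m) = (\<Sum>m<k. \<integral>\<^sup>+x. c m * indicator (A m) x \<partial>lborel)"
    proof (intro sum.cong refl)
      fix m
      have "emeasure lborel (A m) = ennreal ((1/2) ^ m - (1/2) ^ Suc m)"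
        unfolding A_def by (subst emeasure_lborel_Ioc) (auto intro: power_decreasing)
      then show "ennreal ((1/2) ^ Suc m) * c m = (\<integral>\<^sup>+x. c m * indicator (A m) x \<partial>lborel)"
        by (subst nn_integral_cmult_indicator) (auto simp: A_def mult.commute)
    qed
    also have "\<dots> = (\<integral>\<^sup>+x. (\<Sum>m<k. c m * indicator (A m) x) \<partial>lborel)"
      by (intro nn_integral_sum[symmetric]) (auto simp: A_def)
    also have "\<dots> \<le> ?I"
    \<comment> \<open>The intervals are disjoint, so at each \<open>x\<close> at most one summand is
      nonzero. Measurability enters only for the step function on the left.\<close>
    proof (intro nn_integral_mono)
      fix x :: real
      show "(\<Sum>m<k. c m * indicator (A m) x) \<le> sqrt_log (covering_number x C) * indicator {0<..1} x"
      proof (cases "\<exists>m<k. x \<in> A m")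
        case True
        then obtain m where m: "m < k" "x \<in> A m" by blast
        have "(\<Sum>m<k. c m * indicator (A m) x) = (\<Sum>l<k. if l = m then c m else 0)"
          using m disj by (intro sum.cong) (auto simp: indicator_def)
        also have "\<dots> = c m" using m by simp
        also have "\<dots> \<le> sqrt_log (covering_number x C)"
          unfolding c_def using m by (intro sqrt_log_mono covering_number_antimono) (auto simp: A_def)
        also have "\<dots> = sqrt_log (covering_number x C) * indicator {0<..1} x"
        proof -
          have "0 < x" "x \<le> 1"
            using m(2) power_le_one[of "1/2::real" m] zero_less_power[of "1/2::real" "Suc m"]
            unfolding A_def greaterThanAtMost_iff by linarith+
          then show ?thesis by simp
        qed
        finally show ?thesis .
      next
        case False
        then have "(\<Sum>m<k. c m * indicator (A m) x) = 0" by (intro sum.neutral) auto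
        then show ?thesis by simp
      qed
    qed
    finally show ?thesis .
  qed
  have "covering_number ((1/2) ^ m) C \<noteq> \<infinity>" for m
  proof
    assume "covering_number ((1/2) ^ m) C = \<infinity>"
    then have "c m = \<infinity>" by (simp add: c_def sqrt_log_def)
    then have "ennreal ((1/2) ^ Suc m) * c m = \<infinity>" by (simp add: ennreal_mult_top)
    moreover have "ennreal ((1/2) ^ Suc m) * c m \<le> (\<Sum>l<Suc m. ennreal ((1/2) ^ Suc l) * c l)"
      by (rule member_le_sum) auto
    ultimately show False using partial[of "Suc m"] assms by (simp add: top.extremum_unique)
  qed
  then have "\<forall>m. \<exists>i. covering_number ((1/2) ^ m) C = enat i"
    by (simp add: not_infinity_eq)
  then obtain n where n: "\<And>m. covering_number ((1/2) ^ m) C = enat (n m)"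
    using choice[of "\<lambda>m i. covering_number ((1/2) ^ m) C = enat i"] by blast
  have cn: "c m = ennreal (sqrt (ln (real (n m))))" for m
    unfolding c_def n sqrt_log_def enat.case ..
  have ln0: "0 \<le> sqrt (ln (real i))" for i :: nat
  proof (cases "i = 0")
    case False
    then have "1 \<le> real i" by linarith
    then show ?thesis by (intro real_sqrt_ge_zero ln_ge_zero)
  qed simp
  have "summable (\<lambda>m. (1/2) ^ Suc m * sqrt (ln (real (n m))))"
  proof (rule summableI_nonneg_bounded)
    show nonneg: "0 \<le> (1/2) ^ Suc m * sqrt (ln (real (n m)))" for m
      by (intro mult_nonneg_nonneg ln0) simp
    fix k
    have "ennreal (\<Sum>m<k. (1/2) ^ Suc m * sqrt (ln (real (n m)))) = (\<Sum>m<k. ennreal ((1/2) ^ Suc m) * c m)"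
      unfolding cn by (subst sum_ennreal[symmetric]) (intro nonneg, intro sum.cong refl ennreal_mult ln0, simp)
    also have "\<dots> \<le> ?I" by (rule partial)
    also have "?I = ennreal (enn2real ?I)" using assms by (simp add: less_top)
    finally show "(\<Sum>m<k. (1/2) ^ Suc m * sqrt (ln (real (n m)))) \<le> enn2real ?I"
      by (subst (asm) ennreal_le_iff) (rule enn2real_nonneg)
  qed
  \<comment> \<open>The factor 2 turns the interval lengths back into the radii
    \<open>(1/2) ^ m\<close>.\<close>
  then have "summable (\<lambda>m. 2 * ((1/2) ^ Suc m * sqrt (ln (real (n m)))))" by (rule summable_mult)
  then show ?thesis using that[of n] n by simp
qed

section \<open>The class of minimal squared distances\<close>

lemma Min_le_Min_add:
  fixes u v :: "'i \<Rightarrow> real"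
  assumes "finite I" "I \<noteq> {}" "\<And>i. i \<in> I \<Longrightarrow> u i \<le> v i + e"
  shows "(MIN i\<in>I. u i) \<le> (MIN i\<in>I. v i) + e"
proof -
  have "(MIN i\<in>I. v i) \<in> v ` I" using assms by (intro Min_in) auto
  then obtain i where i: "i \<in> I" "(MIN i\<in>I. v i) = v i" by auto
  have "(MIN i\<in>I. u i) \<le> u i" using i assms by (intro Min_le) auto
  then show ?thesis using assms(3)[OF i(1)] i(2) by simp
qed

text \<open>A difference of squares factors into the difference of two distances, at most
  \<open>d\<close>, and their sum, at most \<open>2 * norm z + 2 * R\<close>. The minimum does not
  enlarge a uniform perturbation.\<close>

lemma min_sq_dist_diff_le:
  assumes k: "k \<ge> 1" and d: "\<And>i. i \<in> {1..k} \<Longrightarrow> norm (a i - b i) \<le> d"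
    and R: "\<And>i. i \<in> {1..k} \<Longrightarrow> norm (a i) \<le> R" "\<And>i. i \<in> {1..k} \<Longrightarrow> norm (b i) \<le> R"
  shows "\<bar>min_sq_dist k a z - min_sq_dist k b z\<bar> \<le> d * (2 * norm z + 2 * R)"
proof -
  have *: "(norm (z - p))\<^sup>2 \<le> (norm (z - q))\<^sup>2 + d * (2 * norm z + 2 * R)"
    if "norm (p - q) \<le> d" "norm p \<le> R" "norm q \<le> R" for p q :: 'a
  proof -
    have "norm (z - p) - norm (z - q) \<le> norm (p - q)"
      using norm_triangle_ineq2[of "z - p" "z - q"] by (simp add: norm_minus_commute)
    then have 1: "norm (z - p) - norm (z - q) \<le> d" using that by simp
    have 2: "norm (z - p) + norm (z - q) \<le> 2 * norm z + 2 * R"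
      using norm_triangle_ineq4[of z p] norm_triangle_ineq4[of z q] that by linarith
    have "(norm (z - p))\<^sup>2 - (norm (z - q))\<^sup>2 = (norm (z - p) - norm (z - q)) * (norm (z - p) + norm (z - q))"
      by (simp add: power2_eq_square algebra_simps)
    also have "\<dots> \<le> d * (norm (z - p) + norm (z - q))"
      using 1 by (intro mult_right_mono) auto
    also have "\<dots> \<le> d * (2 * norm z + 2 * R)"
      using 2 order_trans[OF norm_ge_zero that(1)] by (intro mult_left_mono)
    finally show ?thesis by simp
  qed
  have ne: "{1..k} \<noteq> {}" using k by simp
  have "min_sq_dist k a z \<le> min_sq_dist k b z + d * (2 * norm z + 2 * R)"
    unfolding min_sq_dist_def using d R by (intro Min_le_Min_add ne * finite_atLeastAtMost) auto
  moreover have "min_sq_dist k b z \<le> min_sq_dist k a z + d * (2 * norm z + 2 * R)"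
    unfolding min_sq_dist_def using d R by (intro Min_le_Min_add ne * finite_atLeastAtMost) (auto simp: norm_minus_commute)
  ultimately show ?thesis by linarith
qed

text \<open>Integrability of one member of the class thereby yields a second moment of the norm, and
  so a square integrable envelope.\<close>

lemma norm_sq_le_min_sq_dist:
  assumes k: "k \<ge> 1" and R: "\<And>i. i \<in> {1..k} \<Longrightarrow> norm (a i) \<le> R"
  shows "(norm z)\<^sup>2 \<le> 2 * min_sq_dist k a z + 2 * R\<^sup>2"
proof -
  have "min_sq_dist k a z \<in> (\<lambda>i. (norm (z - a i))\<^sup>2) ` {1..k}"
    unfolding min_sq_dist_def using k by (intro Min_in) auto
  then obtain i where i: "i \<in> {1..k}" "min_sq_dist k a z = (norm (z - a i))\<^sup>2" by auto
  have "norm z \<le> norm (z - a i) + R"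
    using norm_triangle_ineq[of "z - a i" "a i"] R[OF i(1)] by simp
  then have "(norm z)\<^sup>2 \<le> (norm (z - a i) + R)\<^sup>2" by (intro power_mono) auto
  also have "\<dots> \<le> 2 * (norm (z - a i))\<^sup>2 + 2 * R\<^sup>2"
    using zero_le_power2[of "norm (z - a i) - R"] by (simp add: power2_eq_square algebra_simps)
  finally show ?thesis by (simp add: i(2))
qed

text \<open>The centres in \<open>S\<close> need not lie in \<open>C\<close>, and replacing points
  by them could destroy distinctness. Functions are therefore grouped by the pattern of assigned
  centres, and each group is represented by one of its own members.\<close>

lemma min_sq_dist_class_net:
  fixes C :: "'b::real_normed_vector set"
  assumes k: "k \<ge> 1" and S: "finite S" "C \<subseteq> (\<Union>x\<in>S. ball x \<epsilon>)"
    and R: "\<And>c. c \<in> C \<Longrightarrow> norm c \<le> R"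
  obtains p where "\<And>f. f \<in> min_sq_dist_class k C \<Longrightarrow> p f \<in> min_sq_dist_class k C"
    and "finite (p ` min_sq_dist_class k C)" "card (p ` min_sq_dist_class k C) \<le> card S ^ k"
    and "\<And>f z. f \<in> min_sq_dist_class k C \<Longrightarrow> \<bar>f z - p f z\<bar> \<le> \<epsilon> * (4 * norm z + 4 * R)"
proof -
  let ?F = "min_sq_dist_class k C"
  have "\<forall>f\<in>?F. \<exists>a. a \<in> distinct_tuples k C \<and> f = min_sq_dist k a" by (auto simp: min_sq_dist_class_def)
  then obtain a where a: "\<And>f. f \<in> ?F \<Longrightarrow> a f \<in> distinct_tuples k C" "\<And>f. f \<in> ?F \<Longrightarrow> f = min_sq_dist k (a f)"
    by metis
  have "\<forall>c\<in>C. \<exists>x. x \<in> S \<and> dist x c < \<epsilon>" using S(2) by fastforce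
  then obtain s where s: "\<And>c. c \<in> C \<Longrightarrow> s c \<in> S" "\<And>c. c \<in> C \<Longrightarrow> dist (s c) c < \<epsilon>"
    by metis
  have aC: "a f i \<in> C" if "f \<in> ?F" "i \<in> {1..k}" for f i
    using a(1)[OF that(1)] that(2) by (auto simp: distinct_tuples_def)
  define pat where "pat f = (\<lambda>i\<in>{1..k}. s (a f i))" for f
  have "pat ` ?F \<subseteq> {1..k} \<rightarrow>\<^sub>E S" using s aC by (auto simp: pat_def)
  moreover have finE: "finite ({1..k} \<rightarrow>\<^sub>E S)" using S(1) by (intro finite_PiE) auto
  ultimately have pat: "finite (pat ` ?F)" "card (pat ` ?F) \<le> card S ^ k"
    using card_mono[OF finE, of "pat ` ?F"] by (auto simp: card_PiE intro: finite_subset)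
  define rep where "rep q = (SOME g. g \<in> ?F \<and> pat g = q)" for q
  have rep: "rep (pat f) \<in> ?F" "pat (rep (pat f)) = pat f" if "f \<in> ?F" for f
    using someI[of "\<lambda>g. g \<in> ?F \<and> pat g = pat f" f] that by (auto simp: rep_def)
  show ?thesis
  proof (rule that[of "\<lambda>f. rep (pat f)"])
    have im: "(\<lambda>f. rep (pat f)) ` ?F = rep ` pat ` ?F" by auto
    show "finite ((\<lambda>f. rep (pat f)) ` ?F)" unfolding im using pat by simp
    show "card ((\<lambda>f. rep (pat f)) ` ?F) \<le> card S ^ k"
      unfolding im using card_image_le[OF pat(1), of rep] pat(2) by simp
    fix f z assume f: "f \<in> ?F"
    show "rep (pat f) \<in> ?F" by (rule rep(1)[OF f])
    let ?g = "rep (pat f)"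
    have "norm (a f i - a ?g i) \<le> 2 * \<epsilon>" if i: "i \<in> {1..k}" for i
    proof -
      have "s (a ?g i) = s (a f i)" using fun_cong[OF rep(2)[OF f], of i] i by (simp add: pat_def)
      then have "dist (s (a f i)) (a f i) < \<epsilon>" "dist (s (a f i)) (a ?g i) < \<epsilon>"
        using s(2)[OF aC[OF f i]] s(2)[OF aC[OF rep(1)[OF f] i]] by simp_all
      then have "dist (a f i) (a ?g i) < 2 * \<epsilon>"
        using dist_triangle3[of "a f i" "a ?g i" "s (a f i)"] by linarith
      then show ?thesis by (simp add: dist_norm)
    qed
    \<comment> \<open>Two tuples with the same pattern are within \<open>2 * \<epsilon>\<close> in
      each entry; together with the factor 2 of the Lipschitz bound this gives the 4 of the
      envelope.\<close>
    then have "\<bar>min_sq_dist k (a f) z - min_sq_dist k (a ?g) z\<bar> \<le> 2 * \<epsilon> * (2 * norm z + 2 * R)"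
      using aC[OF f] aC[OF rep(1)[OF f]] R by (intro min_sq_dist_diff_le[OF k]) auto
    then show "\<bar>f z - ?g z\<bar> \<le> \<epsilon> * (4 * norm z + 4 * R)"
      using a(2)[OF f] a(2)[OF rep(1)[OF f]] by (simp add: algebra_simps)
  qed
qed

theorem theorem3:
  fixes C :: "'b::{banach, second_countable_topology} set"
    and k :: nat
    and M :: "'w measure"
    and X :: "'w \<Rightarrow> 'b"
    and P :: "'b measure"
  assumes "k \<ge> 1"
    and "prob_space M"
    and "X \<in> M \<rightarrow>\<^sub>M borel"
    and "P = distr M borel X"
    and "square_integrable_class P (min_sq_dist_class k C)"
    and "(\<integral>\<^sup>+\<epsilon>\<in>{0<..1}. sqrt_log (covering_number \<epsilon> C) \<partial>lborel) < \<infinity>"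
  shows "Donsker P (min_sq_dist_class k C)"
proof (cases "min_sq_dist_class k C = {}")
  \<comment> \<open>This happens when \<open>C\<close> has fewer than \<open>k\<close> points; the
    locale requires a nonempty class.\<close>
  case True
  have "prob_space P" unfolding assms(4) using assms(2,3) by (rule prob_space.prob_space_distr)
  then show ?thesis unfolding True by (rule Donsker_empty)
next
  case False
  let ?F = "min_sq_dist_class k C"
  have P: "prob_space P" unfolding assms(4) using assms(2,3) by (rule prob_space.prob_space_distr)
  interpret P: prob_space P by (rule P)
  have sP [measurable_cong]: "sets P = sets borel" by (simp add: assms(4))
  obtain n where n: "\<And>m. covering_number ((1/2) ^ m) C = enat (n m)"
    and sum: "summable (\<lambda>m. (1/2) ^ m * sqrt (ln (real (n m))))"
    by (rule dyadic_entropy[OF assms(6)]) blast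
  have "\<forall>m. \<exists>S. finite S \<and> card S = n m \<and> C \<subseteq> (\<Union>x\<in>S. ball x ((1/2) ^ m))"
    using covering_number_attained[OF n] by metis
  then obtain S where S: "\<And>m. finite (S m)" "\<And>m. card (S m) = n m" "\<And>m. C \<subseteq> (\<Union>x\<in>S m. ball x ((1/2) ^ m))"
    by metis
  \<comment> \<open>The net at level 0 already covers \<open>C\<close> by finitely many unit balls;
    this is where the radius \<open>R\<close> comes from.\<close>
  have "bounded (\<Union>x\<in>S 0. ball x ((1/2) ^ 0))"
    using S(1) by (intro bounded_UN ballI bounded_ball) auto
  then have "bounded C" using S(3) by (rule bounded_subset)
  then obtain R where R: "\<And>c. c \<in> C \<Longrightarrow> norm c \<le> R" by (auto simp: bounded_iff)
  have "\<forall>m. \<exists>p. (\<forall>f\<in>?F. p f \<in> ?F) \<and> finite (p ` ?F) \<and> card (p ` ?F) \<le> n m ^ k \<and>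
     (\<forall>f\<in>?F. \<forall>z. \<bar>f z - p f z\<bar> \<le> (1/2) ^ m * (4 * norm z + 4 * R))"
  proof
    fix m
    show "\<exists>p. (\<forall>f\<in>?F. p f \<in> ?F) \<and> finite (p ` ?F) \<and> card (p ` ?F) \<le> n m ^ k \<and>
     (\<forall>f\<in>?F. \<forall>z. \<bar>f z - p f z\<bar> \<le> (1/2) ^ m * (4 * norm z + 4 * R))"
      by (rule min_sq_dist_class_net[OF assms(1) S(1)[of m] S(3)[of m] R]) (auto simp: S(2))
  qed
  then obtain p where p: "\<And>m f. f \<in> ?F \<Longrightarrow> p m f \<in> ?F" "\<And>m. finite (p m ` ?F)" "\<And>m. card (p m ` ?F) \<le> n m ^ k"
    "\<And>m f z. f \<in> ?F \<Longrightarrow> \<bar>f z - p m f z\<bar> \<le> (1/2) ^ m * (4 * norm z + 4 * R)"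
    by metis
  have F_meas: "f \<in> borel_measurable P" and F_sq: "integrable P (\<lambda>z. (f z)\<^sup>2)" if "f \<in> ?F" for f
    using assms(5) that by (auto simp: square_integrable_class_def)
  define E where "E z = 4 * norm z + 4 * R" for z :: 'b
  have E_meas: "E \<in> borel_measurable P" unfolding E_def by measurable
  have E_sq: "integrable P (\<lambda>z. (E z)\<^sup>2)"
  proof -
    obtain f where f: "f \<in> ?F" using False by auto
    then obtain a where a: "a \<in> distinct_tuples k C" "f = min_sq_dist k a" by (auto simp: min_sq_dist_class_def)
    have "integrable P f" by (rule P.square_integrable_imp_integrable[OF F_meas[OF f] F_sq[OF f]])
    \<comment> \<open>From \<open>(E z)\<^sup>2 \<le> 32 * (norm z)\<^sup>2 + 32 * R\<^sup>2\<close>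
      and \<open>(norm z)\<^sup>2 \<le> 2 * f z + 2 * R\<^sup>2\<close>, so that 96 is 64 +
      32.\<close>
    then have int: "integrable P (\<lambda>z. 64 * f z + 96 * R\<^sup>2)" by auto
    have bd: "(E z)\<^sup>2 \<le> 64 * f z + 96 * R\<^sup>2" for z
    proof -
      have "(norm z)\<^sup>2 \<le> 2 * f z + 2 * R\<^sup>2"
        unfolding a(2)
      proof (rule norm_sq_le_min_sq_dist[OF assms(1)])
        show "norm (a i) \<le> R" if "i \<in> {1..k}" for i
          using a(1) that R[of "a i"] PiE_mem[of a "{1..k}" "\<lambda>_. C" i] by (simp add: distinct_tuples_def)
      qed
      moreover have "(E z)\<^sup>2 \<le> 32 * (norm z)\<^sup>2 + 32 * R\<^sup>2"
        using zero_le_power2[of "norm z - R"] by (simp add: E_def power2_eq_square algebra_simps)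
      ultimately show ?thesis by linarith
    qed
    show ?thesis
    proof (rule Bochner_Integration.integrable_bound[OF int])
      show "AE z in P. norm ((E z)\<^sup>2) \<le> norm (64 * f z + 96 * R\<^sup>2)"
      proof (intro AE_I2)
        fix z
        have "(E z)\<^sup>2 \<le> \<bar>64 * f z + 96 * R\<^sup>2\<bar>" by (rule order_trans[OF bd abs_ge_self])
        then show "norm ((E z)\<^sup>2) \<le> norm (64 * f z + 96 * R\<^sup>2)" by simp
      qed
    qed (use E_meas in measurable)
  qed
  have ent: "summable (\<lambda>m. (1/2) ^ m * sqrt (ln (card (p m ` ?F))))"
  proof (rule summable_comparison_test')
    \<comment> \<open>Passing from points to \<open>k\<close>-tuples raises the net sizes to the
      power \<open>k\<close>, which costs only the constant \<open>sqrt k\<close> after logarithm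
      and square root.\<close>
    show "summable (\<lambda>m. sqrt k * ((1/2) ^ m * sqrt (ln (real (n m)))))" using sum by (rule summable_mult)
    fix m :: nat
    have c: "card (p m ` ?F) \<ge> 1" using p(2)[of m] False by (simp add: card_gt_0_iff Suc_le_eq)
    have "n m \<noteq> 0"
    proof
      assume "n m = 0"
      then have "n m ^ k = 0" using assms(1) by simp
      then show False using c p(3)[of m] by linarith
    qed
    have "real (card (p m ` ?F)) \<le> real (n m) ^ k"
      using p(3)[of m] by (metis of_nat_le_iff of_nat_power)
    moreover have "0 < real (card (p m ` ?F))" using c by linarith
    ultimately have "ln (real (card (p m ` ?F))) \<le> ln (real (n m) ^ k)"
      by (meson ln_le_cancel_iff less_le_trans)
    also have "\<dots> = k * ln (real (n m))" using \<open>n m \<noteq> 0\<close> by (simp add: ln_realpow)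
    finally have "sqrt (ln (real (card (p m ` ?F)))) \<le> sqrt (k * ln (real (n m)))"
      by (rule real_sqrt_le_mono)
    then have "sqrt (ln (real (card (p m ` ?F)))) \<le> sqrt k * sqrt (ln (real (n m)))"
      by (simp only: real_sqrt_mult)
    then have "(1/2) ^ m * sqrt (ln (real (card (p m ` ?F)))) \<le> (1/2) ^ m * (sqrt k * sqrt (ln (real (n m))))"
      by (intro mult_left_mono) auto
    moreover have "0 \<le> ln (real (card (p m ` ?F)))" using c by simp
    ultimately show "norm ((1/2) ^ m * sqrt (ln (card (p m ` ?F)))) \<le> sqrt k * ((1/2) ^ m * sqrt (ln (real (n m))))"
      by (simp add: mult.left_commute)
  qed
  interpret entropy_class P ?F E p
  proof unfold_locales
    show "\<bar>f z - p m f z\<bar> \<le> (1/2) ^ m * E z" if "f \<in> ?F" for m f z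
      unfolding E_def by (rule p(4)[OF that])
  qed (fact False F_meas F_sq E_meas E_sq p(1,2) ent)+
  show ?thesis by (rule Donsker_entropy_class)
qed

end
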